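(* Let $\mathbb{P}$ be the law of a ROSt that is invariant under the cavity mapping $\Phi_{\lambda,l}$ for a given $\lambda>0$, and let $\mu$ be its sampling measure. Then, $\mathbb{P}$-almost surely, $\mu$ is supported on a single vector or on an infinite-dimensional subset of $\mathcal{B}$ (i.e. either $\mu$ is a Dirac mass or $\dim\mu=\infty$).
   Context: Let $\mathbb{N}=\{1,2,\dots\}$. A Random Overlap Structure (ROSt) is a random symmetric positive semidefinite $\mathbb{N}\times\mathbb{N}$ matrix $Q=\{q_{ij}\}$ with $1$'s on the diagonal which is weakly exchangeable: $\tau Q\tau^{-1}$ has the same law as $Q$ for every permutation matrix $\tau$ that fixes all but finitely many elements. $\mathcal{H}$ is a fixed infinite-dimensional separable real Hilbert space with inner product $\cdot$ and norm $\|\cdot\|$, $\mathcal{B}$ is its closed unit ball, and $\mathcal{M}(\mathcal{B})$ is the set of Borel probability measures on $\mathcal{B}$. By the Dovbysh–Sudakov theorem, for every ROSt $Q$ there is a random element $\mu$ of $\mathcal{M}(\mathcal{B})$, called a sampling measure of $Q$, such that conditionally on $\mu$, $(q_{ij})_{i\neq j}$ has the law of $(v^i\cdot v^j)_{i\ne j}$ with $v^1,v^2,\dots$ i.i.d. of law $\mu$. Conversely every random element of $\mathcal{M}(\mathcal{B})$ is a sampling measure of the ROSt so constructed (diagonal entries set to $1$). The sampling measure is determined by the law of $Q$ up to isometry of $\mathcal{B}$. The law of a ROSt (and of its sampling measure) is denoted $\mathbb{P}$. Cavity field: let $(l_i)_{i\in\mathbb{N}}$ be i.i.d. standard Gaussians,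 independent of $\mathbb{P}$, with law $P_l$, let $(e_i)$ be a fixed orthonormal basis of $\mathcal{H}$, and $l(v)=\sum_i l_i\,(v\cdot e_i)$, so that $E_l[l(v)l(v')]=v\cdot v'$. The cavity mapping $\Phi_{\lambda,l}$ sends $\mathbb{P}$ to the law (under $\mathbb{P}\times P_l$) of the ROSt with sampling measure $$\Phi_{\lambda,l}\mu(dv)=\frac{e^{\lambda l(v)-\frac{\lambda^2}{2}\|v\|^2}\mu(dv)}{\int_{\mathcal{B}} e^{\lambda l(w)-\frac{\lambda^2}{2}\|w\|^2}\mu(dw)}.$$ The image law does not depend on the choice of $\mu$. $\mathbb{P}$ is invariant if it equals its image. For $\mu\in\mathcal{M}(\mathcal{B})$, the operator $\hat{\mathcal{C}}_\mu$ on $\mathcal{H}$ is defined by $v'\cdot(\hat{\mathcal{C}}_\mu v'')=\int_{\mathcal{B}}(v'\cdot v)(v\cdot v'')\,\mu(dv)$; it is self-adjoint and trace class, and $\dim\mu$ is the number (with multiplicity) of its non-zero eigenvalues, i.e. the dimension of the smallest closed subspace carrying $\mu$. *)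

theory Defs
  imports "HOL-Probability.Probability"
begin

text \<open>
  The Hilbert space \<open>\<H>\<close> is a type \<open>'h :: {real_inner, banach, second_countable_topology}\<close>
  (complete and separable). Infinite-dimensionality is carried by the orthonormal basis, which is
  indexed by all of \<open>nat\<close>. Indices start at 0 instead of 1 throughout.
\<close>

definition orthonormal_basis :: "(nat \<Rightarrow> 'h::real_inner) \<Rightarrow> bool" where
  "orthonormal_basis e \<longleftrightarrow>
     (\<forall>i j. e i \<bullet> e j = (if i = j then 1 else 0)) \<and> closure (span (range e)) = UNIV"


section \<open>Random overlap structures\<close>

definition matrix_space :: "(nat \<times> nat \<Rightarrow> real) measure" where
  "matrix_space = (\<Pi>\<^sub>M p\<in>UNIV. borel)"

definition overlap_matrix :: "(nat \<times> nat \<Rightarrow> real) \<Rightarrow> bool" where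
  "overlap_matrix q \<longleftrightarrow>
     (\<forall>i j. q (i, j) = q (j, i)) \<and>
     (\<forall>n x. (\<Sum>i<n. \<Sum>j<n. x i * x j * q (i, j)) \<ge> 0) \<and>
     (\<forall>i. q (i, i) = 1)"

text \<open>
  Below, \<open>\<pi>\<close> ranges over the finitary permutations; the conjugate of \<open>q\<close> by the matrix of such a
  permutation has the entries \<open>q (\<pi> i, \<pi> j)\<close>, up to replacing \<open>\<pi>\<close> by its inverse.
\<close>

definition ROSt_law :: "(nat \<times> nat \<Rightarrow> real) measure \<Rightarrow> bool" where
  "ROSt_law P \<longleftrightarrow>
     P \<in> space (prob_algebra matrix_space) \<and>
     (AE q in P. overlap_matrix q) \<and>
     (\<forall>\<pi>. bij \<pi> \<and> finite {i. \<pi> i \<noteq> i} \<longrightarrow>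
        distr P matrix_space (\<lambda>q (i, j). q (\<pi> i, \<pi> j)) = P)"


section \<open>Sampling measures\<close>

text \<open>
  \<open>prob_algebra unit_ball\<close> is \<open>\<M>(\<B>)\<close> with the \<open>\<sigma>\<close>-algebra generated by the evaluations
  \<open>m \<mapsto> m A\<close>, which is the Borel \<open>\<sigma>\<close>-algebra of the weak topology since \<open>\<B>\<close> is Polish.
\<close>

definition unit_ball :: "'h::real_inner measure" where
  "unit_ball = restrict_space borel (cball 0 1)"

definition gram_matrix :: "(nat \<Rightarrow> 'h::real_inner) \<Rightarrow> nat \<times> nat \<Rightarrow> real" where
  "gram_matrix v = (\<lambda>(i, j). if i = j then 1 else v i \<bullet> v j)"

definition gram_law :: "'h::real_inner measure \<Rightarrow> (nat \<times> nat \<Rightarrow> real) measure" where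
  "gram_law m = distr (\<Pi>\<^sub>M i\<in>(UNIV::nat set). m) matrix_space gram_matrix"

text \<open>
  \<open>\<mu>\<close> is a sampling measure of the random matrix \<open>Q\<close>: \<open>gram_law (\<mu> \<omega>)\<close> is the regular conditional
  law of \<open>Q\<close> given \<open>\<mu>\<close>. As \<open>Q\<close> has unit diagonal almost surely, the whole matrix is used in place of
  its off-diagonal part.
\<close>

definition sampling_measure ::
    "'w measure \<Rightarrow> ('w \<Rightarrow> nat \<times> nat \<Rightarrow> real) \<Rightarrow> ('w \<Rightarrow> 'h::real_inner measure) \<Rightarrow> bool" where
  "sampling_measure M Q \<mu> \<longleftrightarrow>
     \<mu> \<in> M \<rightarrow>\<^sub>M prob_algebra unit_ball \<and>
     (\<forall>A\<in>sets (prob_algebra unit_ball). \<forall>C\<in>sets matrix_space.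
        emeasure M {\<omega>\<in>space M. \<mu> \<omega> \<in> A \<and> Q \<omega> \<in> C} =
        (\<integral>\<^sup>+\<omega>. indicator A (\<mu> \<omega>) * emeasure (gram_law (\<mu> \<omega>)) C \<partial>M))"

text \<open>The law of the ROSt constructed from a random sampling measure of law \<open>L\<close>.\<close>

definition ROSt_of :: "'h::real_inner measure measure \<Rightarrow> (nat \<times> nat \<Rightarrow> real) measure" where
  "ROSt_of L = L \<bind> gram_law"

definition sampling_law :: "(nat \<times> nat \<Rightarrow> real) measure \<Rightarrow> 'h::real_inner measure measure \<Rightarrow> bool" where
  "sampling_law P L \<longleftrightarrow> L \<in> space (prob_algebra (prob_algebra unit_ball)) \<and> ROSt_of L = P"


section \<open>The cavity mapping\<close>

definition gauss_law :: "(nat \<Rightarrow> real) measure" where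
  "gauss_law = (\<Pi>\<^sub>M i\<in>UNIV. std_normal_distribution)"

text \<open>The parameter \<open>\<lambda>\<close> of the cavity mapping is written \<open>c\<close>. For each \<open>v\<close> the series below converges
  for \<open>gauss_law\<close>-almost every \<open>l\<close>.\<close>

definition cavity_field :: "(nat \<Rightarrow> 'h::real_inner) \<Rightarrow> (nat \<Rightarrow> real) \<Rightarrow> 'h \<Rightarrow> real" where
  "cavity_field e l v = (\<Sum>i. l i * (v \<bullet> e i))"

definition cavity_weight ::
    "(nat \<Rightarrow> 'h::real_inner) \<Rightarrow> real \<Rightarrow> (nat \<Rightarrow> real) \<Rightarrow> 'h \<Rightarrow> real" where
  "cavity_weight e c l v = exp (c * cavity_field e l v - c\<^sup>2 / 2 * (norm v)\<^sup>2)"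

text \<open>
  The normalisation is positive, and for each \<open>m\<close> it is finite for \<open>gauss_law\<close>-almost every \<open>l\<close> because
  its mean is 1. The value \<open>m\<close> on the remaining null set only makes the function total.
\<close>

definition cavity ::
    "(nat \<Rightarrow> 'h::real_inner) \<Rightarrow> real \<Rightarrow> (nat \<Rightarrow> real) \<Rightarrow> 'h measure \<Rightarrow> 'h measure" where
  "cavity e c l m =
     (let Z = (\<integral>\<^sup>+w. ennreal (cavity_weight e c l w) \<partial>m)
      in if Z = \<infinity> then m else density m (\<lambda>v. ennreal (cavity_weight e c l v) / Z))"

definition cavity_law ::
    "(nat \<Rightarrow> 'h::real_inner) \<Rightarrow> real \<Rightarrow> 'h measure measure \<Rightarrow> 'h measure measure" where
  "cavity_law e c L =
     distr (L \<Otimes>\<^sub>M gauss_law) (prob_algebra unit_ball) (\<lambda>(m, l). cavity e c l m)"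

text \<open>
  The cavity mapping on laws of ROSt's. The choice of the sampling measure is immaterial, since the
  image law does not depend on it.
\<close>

definition cavity_map ::
    "(nat \<Rightarrow> 'h::real_inner) \<Rightarrow> real \<Rightarrow> (nat \<times> nat \<Rightarrow> real) measure \<Rightarrow>
     (nat \<times> nat \<Rightarrow> real) measure" where
  "cavity_map e c P = ROSt_of (cavity_law e c (SOME L. sampling_law P L))"

definition cavity_invariant ::
    "(nat \<Rightarrow> 'h::real_inner) \<Rightarrow> real \<Rightarrow> (nat \<times> nat \<Rightarrow> real) measure \<Rightarrow> bool" where
  "cavity_invariant e c P \<longleftrightarrow> cavity_map e c P = P"


section \<open>The dimension of a measure\<close>

definition cov_op :: "'h::{real_inner, banach, second_countable_topology} measure \<Rightarrow> 'h \<Rightarrow> 'h" where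
  "cov_op m = (THE C. \<forall>x y. x \<bullet> C y = (\<integral>v. (x \<bullet> v) * (v \<bullet> y) \<partial>m))"

text \<open>
  The dimension of a subspace, with value \<open>\<infinity>\<close> where the library's \<open>dim\<close> would return 0.
\<close>

definition edim :: "'h::real_vector set \<Rightarrow> enat" where
  "edim S = (SUP B\<in>{B. B \<subseteq> S \<and> finite B \<and> independent B}. enat (card B))"

text \<open>
  The number of non-zero eigenvalues of \<open>cov_op m\<close> with multiplicity: the sum, over all reals
  \<open>a \<noteq> 0\<close>, of the dimension of the \<open>a\<close>-eigenspace, as a supremum of finite partial sums.
\<close>

definition mdim :: "'h::{real_inner, banach, second_countable_topology} measure \<Rightarrow> enat" where
  "mdim m = (SUP A\<in>{A. finite A \<and> 0 \<notin> A}. \<Sum>a\<in>A. edim {x. cov_op m x = a *\<^sub>R x})"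


section \<open>Well-definedness\<close>

lemma sets_unit_ball_space:
  assumes "m \<in> space (prob_algebra unit_ball)"
  shows "sets m = sets unit_ball" "prob_space m" "space m = cball 0 1"
proof -
  show 1: "sets m = sets unit_ball" and "prob_space m"
    using assms by (auto simp: space_prob_algebra)
  show "space m = cball 0 1"
    using sets_eq_imp_space_eq[OF 1] by (simp add: unit_ball_def space_restrict_space)
qed

lemma measurable_ident_unit_ball: "(\<lambda>v. v) \<in> borel_measurable unit_ball"
  unfolding unit_ball_def by (intro measurable_restrict_space1) simp

lemma cov_op_exists:
  fixes m :: "'h::{real_inner, banach, second_countable_topology} measure"
  assumes m: "m \<in> space (prob_algebra unit_ball)"
  shows "\<exists>!C. \<forall>x y. x \<bullet> C y = (\<integral>v. (x \<bullet> v) * (v \<bullet> y) \<partial>m)"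
proof -
  interpret prob_space m using sets_unit_ball_space(2)[OF m] .
  have [measurable]: "(\<lambda>v. v) \<in> borel_measurable m"
    using measurable_ident_unit_ball sets_unit_ball_space(1)[OF m] by (simp cong: measurable_cong_sets)
  have i: "integrable m (\<lambda>v. (v \<bullet> y) *\<^sub>R v)" for y :: 'h
  proof (rule integrable_const_bound[where B = "norm y"])
    show "AE v in m. norm ((v \<bullet> y) *\<^sub>R v) \<le> norm y"
    proof (rule AE_I2)
      fix v assume "v \<in> space m"
      then have v: "norm v \<le> 1" using sets_unit_ball_space(3)[OF m] by simp
      have "norm ((v \<bullet> y) *\<^sub>R v) \<le> (norm v * norm y) * norm v"
        by (simp add: Cauchy_Schwarz_ineq2 mult_right_mono)
      also have "\<dots> \<le> (1 * norm y) * 1"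
        using v by (intro mult_mono) auto
      finally show "norm ((v \<bullet> y) *\<^sub>R v) \<le> norm y" by simp
    qed
  qed measurable
  show ?thesis
  proof (rule ex1I[where a = "\<lambda>y. \<integral>v. (v \<bullet> y) *\<^sub>R v \<partial>m"])
    have *: "x \<bullet> (\<integral>v. (v \<bullet> y) *\<^sub>R v \<partial>m) = (\<integral>v. (x \<bullet> v) * (v \<bullet> y) \<partial>m)" for x y
      using integral_inner_right[OF i[of y], where c = x] by (simp add: mult.commute)
    then show "\<forall>x y. x \<bullet> (\<integral>v. (v \<bullet> y) *\<^sub>R v \<partial>m) = (\<integral>v. (x \<bullet> v) * (v \<bullet> y) \<partial>m)" by blast
    fix C :: "'h \<Rightarrow> 'h" assume C: "\<forall>x y. x \<bullet> C y = (\<integral>v. (x \<bullet> v) * (v \<bullet> y) \<partial>m)"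
    show "C = (\<lambda>y. \<integral>v. (v \<bullet> y) *\<^sub>R v \<partial>m)"
    proof
      fix y
      have "\<forall>x. x \<bullet> C y = x \<bullet> (\<integral>v. (v \<bullet> y) *\<^sub>R v \<partial>m)"
        unfolding * using C by simp
      then show "C y = (\<integral>v. (v \<bullet> y) *\<^sub>R v \<partial>m)"
        by (simp only: vector_eq_ldot)
    qed
  qed
qed

lemma measurable_gram_matrix:
  fixes m :: "'h::{real_inner, banach, second_countable_topology} measure"
  assumes m: "sets m = sets unit_ball"
  shows "gram_matrix \<in> (\<Pi>\<^sub>M i\<in>(UNIV::nat set). m) \<rightarrow>\<^sub>M matrix_space"
  unfolding matrix_space_def
proof (rule measurable_PiM_single')
  have [measurable]: "(\<lambda>v. v) \<in> borel_measurable m"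
    using measurable_ident_unit_ball m by (simp cong: measurable_cong_sets)
  have [measurable]: "(\<lambda>v. v i) \<in> borel_measurable (\<Pi>\<^sub>M i\<in>(UNIV::nat set). m)" for i
    by (rule measurable_compose[of "\<lambda>v. v i" _ m]) measurable
  fix p :: "nat \<times> nat"
  show "(\<lambda>v. gram_matrix v p) \<in> borel_measurable (\<Pi>\<^sub>M i\<in>(UNIV::nat set). m)"
    by (cases p) (auto simp: gram_matrix_def)
qed (auto simp: space_PiM)

lemma measurable_gram_law:
  "gram_law \<in> prob_algebra (unit_ball :: 'h::{real_inner, banach, second_countable_topology} measure)
     \<rightarrow>\<^sub>M prob_algebra matrix_space"
proof -
  let ?B = "unit_ball :: 'h measure"
  have "(\<lambda>m. \<Pi>\<^sub>M i\<in>(UNIV::nat set). m) \<in> prob_algebra ?B \<rightarrow>\<^sub>M prob_algebra (\<Pi>\<^sub>M i\<in>UNIV. ?B)"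
  proof (rule measurable_prob_algebra_generated[OF sets_PiM Int_stable_prod_algebra prod_algebra_sets_into_space])
    fix m assume m: "m \<in> space (prob_algebra ?B)"
    show "prob_space (\<Pi>\<^sub>M i\<in>(UNIV::nat set). m)"
      by (intro prob_space_PiM sets_unit_ball_space(2)[OF m])
    show "sets (\<Pi>\<^sub>M i\<in>(UNIV::nat set). m) = sets (\<Pi>\<^sub>M i\<in>(UNIV::nat set). ?B)"
      by (intro sets_PiM_cong) (auto simp: sets_unit_ball_space(1)[OF m])
  next
    fix A assume "A \<in> prod_algebra (UNIV::nat set) (\<lambda>_. ?B)"
    then obtain J E where A: "A = prod_emb UNIV (\<lambda>_. ?B) J (\<Pi>\<^sub>E j\<in>J. E j)"
      and J: "finite J" and E: "\<And>j. j \<in> J \<Longrightarrow> E j \<in> sets ?B"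
      by (auto elim!: prod_algebraE)
    have "emeasure (\<Pi>\<^sub>M i\<in>UNIV. m) A = (\<Prod>j\<in>J. emeasure m (E j))"
      if m: "m \<in> space (prob_algebra ?B)" for m
    proof -
      have "A = prod_emb UNIV (\<lambda>_. m) J (\<Pi>\<^sub>E j\<in>J. E j)"
        unfolding A prod_emb_def
        using sets_eq_imp_space_eq[OF sets_unit_ball_space(1)[OF m]] by simp
      then show ?thesis
        using J E sets_unit_ball_space[OF m] by (auto intro!: emeasure_PiM_emb)
    qed
    moreover have "(\<lambda>m. \<Prod>j\<in>J. emeasure m (E j)) \<in> borel_measurable (prob_algebra ?B)"
      using E unfolding prob_algebra_def
      by (intro borel_measurable_prod measurable_restrict_space1 measurable_emeasure_subprob_algebra) auto
    ultimately show "(\<lambda>m. emeasure (\<Pi>\<^sub>M i\<in>UNIV. m) A) \<in> borel_measurable (prob_algebra ?B)"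
      by (simp cong: measurable_cong)
  qed
  from measurable_compose[OF this measurable_distr_prob_space[OF measurable_gram_matrix[OF refl]]]
  show ?thesis by (simp add: gram_law_def[abs_def])
qed

lemma measurable_cavity_weight:
  fixes e :: "nat \<Rightarrow> 'h::{real_inner, banach, second_countable_topology}"
  shows "(\<lambda>(l, v). cavity_weight e c l v) \<in> borel_measurable (gauss_law \<Otimes>\<^sub>M unit_ball)"
proof -
  have [measurable]: "(\<lambda>v. v) \<in> borel_measurable (unit_ball :: 'h measure)"
    by (rule measurable_ident_unit_ball)
  have [measurable]: "(\<lambda>l. l i) \<in> borel_measurable gauss_law" for i
    unfolding gauss_law_def
    using measurable_component_singleton[of i UNIV "\<lambda>_. std_normal_distribution"]
    by (simp cong: measurable_cong_sets)
  show ?thesis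
    unfolding cavity_weight_def cavity_field_def by measurable
qed

lemma measurable_cavity:
  fixes e :: "nat \<Rightarrow> 'h::{real_inner, banach, second_countable_topology}"
  shows "(\<lambda>(m, l). cavity e c l m) \<in> prob_algebra unit_ball \<Otimes>\<^sub>M gauss_law \<rightarrow>\<^sub>M prob_algebra unit_ball"
proof -
  let ?B = "unit_ball :: 'h measure"
  let ?S = "prob_algebra ?B \<Otimes>\<^sub>M gauss_law"
  let ?Z = "\<lambda>p. \<integral>\<^sup>+w. ennreal (cavity_weight e c (snd p) w) \<partial>fst p"
  let ?N = "\<lambda>A p. \<integral>\<^sup>+w. ennreal (cavity_weight e c (snd p) w) * indicator A w \<partial>fst p"
  note measurable_cavity_weight[of e c, measurable]
  have K[measurable]: "(\<lambda>p. fst p) \<in> ?S \<rightarrow>\<^sub>M subprob_algebra ?B"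
    by (rule measurable_compose[OF measurable_fst]) (simp add: measurable_prob_algebraD)
  have N: "?N A \<in> borel_measurable ?S" if [measurable]: "A \<in> sets ?B" for A
    by (rule nn_integral_measurable_subprob_algebra2[OF _ K]) measurable
  have Z: "?Z \<in> borel_measurable ?S"
    by (rule nn_integral_measurable_subprob_algebra2[OF _ K]) measurable
  have m: "fst p \<in> space (prob_algebra ?B)" "snd p \<in> space gauss_law" if "p \<in> space ?S" for p
    using that by (auto simp: space_pair_measure)
  have w: "(\<lambda>w. ennreal (cavity_weight e c (snd p) w)) \<in> borel_measurable (fst p)"
    if "p \<in> space ?S" for p
  proof -
    have "(\<lambda>w. ennreal (cavity_weight e c (snd p) w)) \<in> borel_measurable ?B"
      using m(2)[OF that] by measurable
    then show ?thesis
      using sets_unit_ball_space(1)[OF m(1)[OF that]] by (simp cong: measurable_cong_sets)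
  qed
  have em: "emeasure (cavity e c (snd p) (fst p)) A =
      (if ?Z p = \<infinity> then emeasure (fst p) A else ?N A p / ?Z p)"
    if p: "p \<in> space ?S" and A: "A \<in> sets ?B" for p A
  proof -
    have [measurable]: "A \<in> sets (fst p)"
      using A sets_unit_ball_space(1)[OF m(1)[OF p]] by simp
    note w[OF p, measurable]
    have "emeasure (density (fst p) (\<lambda>v. ennreal (cavity_weight e c (snd p) v) / ?Z p)) A =
        (\<integral>\<^sup>+v. ennreal (cavity_weight e c (snd p) v) / ?Z p * indicator A v \<partial>fst p)"
      by (rule emeasure_density) measurable
    also have "\<dots> = (\<integral>\<^sup>+v. (ennreal (cavity_weight e c (snd p) v) * indicator A v) / ?Z p \<partial>fst p)"
      by (simp add: divide_ennreal_def mult.assoc mult.commute mult.left_commute)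
    also have "\<dots> = ?N A p / ?Z p"
      by (rule nn_integral_divide) measurable
    finally show ?thesis by (simp add: cavity_def Let_def)
  qed
  have s: "sets (case p of (m, l) \<Rightarrow> cavity e c l m) = sets ?B" if p: "p \<in> space ?S" for p
    using sets_unit_ball_space(1)[OF m(1)[OF p]] by (simp add: cavity_def Let_def case_prod_beta)
  have ps: "prob_space (case p of (m, l) \<Rightarrow> cavity e c l m)" if p: "p \<in> space ?S" for p
  proof
    interpret prob_space "fst p" by (rule sets_unit_ball_space(2)[OF m(1)[OF p]])
    have sp: "space (fst p) = space ?B"
      using sets_eq_imp_space_eq[OF sets_unit_ball_space(1)[OF m(1)[OF p]]] .
    note w[OF p, measurable]
    have "?Z p \<noteq> 0"
    proof
      assume "?Z p = 0"
      then have "AE w in fst p. ennreal (cavity_weight e c (snd p) w) = 0"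
        by (subst (asm) nn_integral_0_iff_AE) measurable
      then have "AE w in fst p. False"
        by eventually_elim (simp add: cavity_weight_def)
      then show False by simp
    qed
    moreover have "?N (space ?B) p = ?Z p"
      by (rule nn_integral_cong) (simp add: sp)
    ultimately have "emeasure (cavity e c (snd p) (fst p)) (space ?B) = 1"
      unfolding em[OF p sets.top] using emeasure_space_1
      by (cases "?Z p = \<infinity>") (simp_all only: sp if_True if_False infinity_ennreal_def
          ennreal_divide_self top.not_eq_extremum if_cancel simp_thms)
    moreover have "space (case p of (m, l) \<Rightarrow> cavity e c l m) = space ?B"
      by (rule sets_eq_imp_space_eq[OF s[OF p]])
    ultimately show "emeasure (case p of (m, l) \<Rightarrow> cavity e c l m)
        (space (case p of (m, l) \<Rightarrow> cavity e c l m)) = 1"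
      by (simp add: case_prod_beta)
  qed
  show ?thesis
  proof (rule measurable_prob_algebra_generated[where G = "sets ?B" and \<Omega> = "space ?B"])
    fix A assume A: "A \<in> sets ?B"
    have [measurable]: "(\<lambda>p. emeasure (fst p) A) \<in> borel_measurable ?S"
      by (rule measurable_compose[OF K measurable_emeasure_subprob_algebra[OF A]])
    note Z[measurable] N[OF A, measurable]
    have "(\<lambda>p. if ?Z p = \<infinity> then emeasure (fst p) A else ?N A p / ?Z p) \<in> borel_measurable ?S"
      by measurable
    then show "(\<lambda>p. emeasure (case p of (m, l) \<Rightarrow> cavity e c l m) A) \<in> borel_measurable ?S"
      by (rule measurable_cong[THEN iffD1, rotated]) (simp add: em A case_prod_beta)
  qed (use s ps in \<open>simp_all add: sets.sigma_sets_eq sets.Int_stable sets.space_closed\<close>)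
qed

end

theory Submission
  imports Defs "HOL-Real_Asymp.Real_Asymp"
begin

text \<open>
  Composing the cavity mapping with itself \<open>n\<close> times gives the cavity mapping with parameter
  \<open>sqrt n * c\<close>, so an invariant law is invariant under all of these. Let \<open>m\<close> be carried by a
  subspace of dimension \<open>d\<close>, and let \<open>m'\<close> be its image under the cavity mapping with parameter \<open>c\<close>.
  Integration by parts in the coordinate \<open>l\<^sub>i\<close> of the field gives
  \<open>c * E (\<Sum>i. Var (v \<bullet> e\<^sub>i)) = E (\<Sum>i. l\<^sub>i * mean (v \<bullet> e\<^sub>i))\<close>
  for the variances and means under \<open>m'\<close>. The right-hand side is at most a multiple of \<open>d\<close>, so the
  expected variance of \<open>m'\<close> is \<open>O(d / c)\<close>. With \<open>sqrt n * c\<close> in place of \<open>c\<close> and \<open>n \<rightarrow> \<infinity>\<close>,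
  invariance forces \<open>q\<^sub>i\<^sub>j = q\<^sub>i\<^sub>k\<close> almost surely on the event that the sampling measure is
  finite-dimensional, and then the measure is a Dirac mass.

  Invariance is a statement about laws of overlaps, whereas this argument iterates a mapping of
  measures. Two facts bridge the gap: the law of the overlaps determines the law of the overlaps
  after the cavity mapping, and finite-dimensionality can be read off the overlaps of an infinite
  sample.
\<close>

section \<open>Gaussian series\<close>

text \<open>Overlaps determine a sampling measure only up to isometry, and \<open>cavity_map\<close>
  picks one by choice, so even a single application of the hypothesis compares two unrelated laws of
  measures with equal overlap law. The obstacle is that the cavity weight contains the squared norm
  of \<open>v\<close>, which the unit diagonal of the matrix hides. Probabilities of the tilted
  sample are ratios of an average over N weighted replicas to the N-th power of a normalisation.
  Further powers of the normalisation add replicas to the numerator, so the mixed moments of the two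
  are means over ordinary overlaps, provided that the diagonal drops out when the field is averaged.
  The sum in the identity by parts is the mean of the field under \<open>m'\<close>, hence at most
  its maximum on the unit ball of a d-dimensional space, and the expectation of that maximum does
  not involve \<open>c\<close>. In infinite dimension it is infinite and nothing follows. The bound
  \<open>O(d / c)\<close> is used for each measure separately, since d may have infinite mean; this
  is why the restriction to finite dimension is built into a bounded function of the
  overlaps.\<close>

lemma sequence_space_prob_space: "prob_space M \<Longrightarrow> sequence_space M"
  unfolding sequence_space_def product_prob_space_def product_prob_space_axioms_def
    product_sigma_finite_def
  by (auto intro: prob_space_imp_sigma_finite)

lemma prob_space_std_normal: "prob_space std_normal_distribution"
  by (rule prob_space_normal_density) simp

lemma sets_gauss_law: "sets gauss_law = sets (\<Pi>\<^sub>M i\<in>UNIV. borel)"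
  unfolding gauss_law_def by (intro sets_PiM_cong) auto

lemma space_gauss_law [simp]: "space gauss_law = UNIV"
  by (simp add: gauss_law_def space_PiM)

lemma prob_space_gauss_law: "prob_space gauss_law"
  unfolding gauss_law_def by (intro prob_space_PiM prob_space_std_normal)

lemma measurable_gauss_law_component: "(\<lambda>l. l i) \<in> borel_measurable gauss_law"
  unfolding gauss_law_def
  using measurable_component_singleton[of i UNIV "\<lambda>_. std_normal_distribution"]
  by (simp cong: measurable_cong_sets)

declare measurable_gauss_law_component [measurable]

text \<open>One induction step of the maximal inequality: \<open>b\<close> carries the variance of
  the coordinates still to come, and the vanishing first moment removes the cross term.\<close>

lemma nn_integral_std_normal_quadratic:
  "(\<integral>\<^sup>+s. ennreal ((x + s * a)\<^sup>2 + b) \<partial>std_normal_distribution) = ennreal (x\<^sup>2 + a\<^sup>2 + b)"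
  if "0 \<le> b" for a b x :: real
proof -
  have i1: "has_bochner_integral lborel (\<lambda>s. std_normal_density s * s) 0"
    using std_normal_moment_odd[of 0] by simp
  have i2: "has_bochner_integral lborel (\<lambda>s. std_normal_density s * s^2) 1"
    using std_normal_moment_even[of 1] by simp
  have i0: "has_bochner_integral lborel (\<lambda>s. std_normal_density s) 1"
    using std_normal_moment_even[of 0] by simp
  have "has_bochner_integral lborel (\<lambda>s. (x^2 + b) * std_normal_density s + (2*x*a) *
      (std_normal_density s * s)
      + a^2 * (std_normal_density s * s^2)) ((x^2+b) * 1 + (2*x*a) * 0 + a^2 * 1)"
    by (intro has_bochner_integral_add has_bochner_integral_mult_right i0 i1 i2)
  then have *: "has_bochner_integral lborel (\<lambda>s. std_normal_density s * ((x + s * a)\<^sup>2 + b)) (x\<^sup>2 + a\<^sup>2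
      + b)"
    by (simp add: algebra_simps power2_eq_square)
  have "(\<integral>\<^sup>+s. ennreal ((x + s * a)\<^sup>2 + b) \<partial>std_normal_distribution)
      = (\<integral>\<^sup>+s. ennreal (std_normal_density s * ((x + s * a)\<^sup>2 + b)) \<partial>lborel)"
    using that by (subst nn_integral_density) (auto simp: ennreal_mult')
  also have "\<dots> = ennreal (x\<^sup>2 + a\<^sup>2 + b)"
    using * that by (subst nn_integral_eq_integral) (auto simp: has_bochner_integral_iff)
  finally show ?thesis .
qed

lemma gauss_law_iter:
  "distr (std_normal_distribution \<Otimes>\<^sub>M gauss_law) gauss_law (\<lambda>(s, l). case_nat s l) = gauss_law"
  unfolding gauss_law_def
  by (rule sequence_space.PiM_iter[OF sequence_space_prob_space[OF prob_space_std_normal]])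

lemma measurable_case_nat_gauss_law:
  "(\<lambda>(s, l). case_nat s l) \<in> std_normal_distribution \<Otimes>\<^sub>M gauss_law \<rightarrow>\<^sub>M gauss_law"
  unfolding gauss_law_def by measurable

text \<open>Kolmogorov's maximal inequality, by peeling off the first coordinate.\<close>

lemma gauss_law_maximal:
  fixes a :: "nat \<Rightarrow> real"
  assumes \<epsilon>: "\<epsilon> > 0"
  shows "emeasure gauss_law {l. \<exists>k\<le>n. \<epsilon> \<le> \<bar>x + (\<Sum>i<k. l i * a i)\<bar>}
    \<le> ennreal ((x\<^sup>2 + (\<Sum>i<n. (a i)\<^sup>2)) / \<epsilon>\<^sup>2)"
proof (induction n arbitrary: x a)
  case 0
  interpret prob_space gauss_law by (rule prob_space_gauss_law)
  show ?case
  proof (cases "\<epsilon> \<le> \<bar>x\<bar>")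
    case True
    then have "1 \<le> x\<^sup>2 / \<epsilon>\<^sup>2"
      using \<epsilon> by (simp add: abs_le_square_iff[symmetric])
    then have "1 \<le> ennreal (x\<^sup>2 / \<epsilon>\<^sup>2)" by simp
    then show ?thesis using True emeasure_space_1 by (simp add: space_gauss_law)
  qed simp
next
  case (Suc n)
  interpret prob_space gauss_law by (rule prob_space_gauss_law)
  let ?S = "{l. \<exists>k\<le>Suc n. \<epsilon> \<le> \<bar>x + (\<Sum>i<k. l i * a i)\<bar>}"
  let ?D = "\<lambda>s. Pair s -` ((\<lambda>(s, l). case_nat s l) -` ?S \<inter> space (std_normal_distribution \<Otimes>\<^sub>M
      gauss_law))"
  show ?case
  proof (cases "\<epsilon> \<le> \<bar>x\<bar>")
    case True
    then have "\<epsilon>\<^sup>2 \<le> x\<^sup>2" using \<epsilon> by (simp add: abs_le_square_iff[symmetric])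
    also have "\<dots> \<le> x\<^sup>2 + (\<Sum>i<Suc n. (a i)\<^sup>2)" by (simp add: sum_nonneg)
    finally have "1 \<le> (x\<^sup>2 + (\<Sum>i<Suc n. (a i)\<^sup>2)) / \<epsilon>\<^sup>2"
      using \<epsilon> by simp
    then have "1 \<le> ennreal ((x\<^sup>2 + (\<Sum>i<Suc n. (a i)\<^sup>2)) / \<epsilon>\<^sup>2)" by simp
    then show ?thesis using emeasure_le_1 order_trans by blast
  next
    case False
    have S: "?S \<in> sets gauss_law"
    proof -
      have "{l\<in>space gauss_law. \<exists>k\<in>{..Suc n}. \<epsilon> \<le> \<bar>x + (\<Sum>i<k. l i * a i)\<bar>} \<in> sets gauss_law"
        by measurable
      then show ?thesis by (simp add: Bex_def)
    qed
    have sl: "emeasure gauss_law (?D s)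
       \<le> ennreal (((x + s * a 0)\<^sup>2 + (\<Sum>i<n. (a (Suc i))\<^sup>2)) / \<epsilon>\<^sup>2)" for s
    proof -
      \<comment> \<open>As \<open>\<bar>x\<bar> < \<epsilon>\<close>, the index \<open>k = 0\<close>
        never reaches the level, so the event for the sequence \<open>s\<close> followed by
        \<open>l\<close> is the event for \<open>l\<close> started at
        \<open>x + s * a 0\<close>.\<close>
      have "?D s
          = {l. \<exists>k\<le>n. \<epsilon> \<le> \<bar>(x + s * a 0) + (\<Sum>i<k. l i * a (Suc i))\<bar>}"
      proof (intro set_eqI iffI; clarsimp simp: space_pair_measure)
        fix l k assume k: "k \<le> Suc n" "\<epsilon> \<le> \<bar>x + (\<Sum>i<k. (case i of 0 \<Rightarrow> s | Suc i' \<Rightarrow> l i') * a i)\<bar>"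
        then obtain k' where k': "k = Suc k'" using False by (cases k) auto
        show "\<exists>k\<le>n. \<epsilon> \<le> \<bar>x + s * a 0 + (\<Sum>i<k. l i * a (Suc i))\<bar>"
          using k unfolding k' by (intro exI[of _ k']) (simp add: sum.lessThan_Suc_shift add.assoc
              del: sum.lessThan_Suc)
      next
        fix l k assume k: "k \<le> n" "\<epsilon> \<le> \<bar>x + s * a 0 + (\<Sum>i<k. l i * a (Suc i))\<bar>"
        show "\<exists>k\<le>Suc n. \<epsilon> \<le> \<bar>x + (\<Sum>i<k. (case i of 0 \<Rightarrow> s | Suc i' \<Rightarrow> l i') * a i)\<bar>"
          using k by (intro exI[of _ "Suc k"]) (simp add: sum.lessThan_Suc_shift add.assoc del:
              sum.lessThan_Suc)
      qed
      then show ?thesis using Suc.IH[of "x + s * a 0" "\<lambda>i. a (Suc i)"] by simp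
    qed
    have "emeasure gauss_law ?S = emeasure (distr (std_normal_distribution \<Otimes>\<^sub>M gauss_law) gauss_law
        (\<lambda>(s, l). case_nat s l)) ?S"
      by (simp add: gauss_law_iter)
    also have "\<dots> = emeasure (std_normal_distribution \<Otimes>\<^sub>M gauss_law) ((\<lambda>(s, l). case_nat s l) -` ?S \<inter>
        space (std_normal_distribution \<Otimes>\<^sub>M gauss_law))"
      by (rule emeasure_distr[OF measurable_case_nat_gauss_law S])
    also have "\<dots> = (\<integral>\<^sup>+s. emeasure gauss_law (?D s) \<partial>std_normal_distribution)"
      by (rule emeasure_pair_measure_alt) (rule measurable_sets[OF measurable_case_nat_gauss_law S])
    also have "\<dots> \<le> (\<integral>\<^sup>+s. ennreal (((x + s * a 0)\<^sup>2 + (\<Sum>i<n. (a (Suc i))\<^sup>2)) / \<epsilon>\<^sup>2)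
        \<partial>std_normal_distribution)"
      by (intro nn_integral_mono sl)
    also have "\<dots> = (\<integral>\<^sup>+s. ennreal ((x/\<epsilon> + s * (a 0/\<epsilon>))\<^sup>2 + (\<Sum>i<n. (a (Suc i))\<^sup>2)/ \<epsilon>\<^sup>2)
        \<partial>std_normal_distribution)"
      by (intro nn_integral_cong arg_cong[where f=ennreal]) (simp add: add_divide_distrib
          power_divide[symmetric])
    also have "\<dots> = ennreal ((x/\<epsilon>)\<^sup>2 + (a 0/\<epsilon>)\<^sup>2 + (\<Sum>i<n. (a (Suc i))\<^sup>2)/ \<epsilon>\<^sup>2)"
      by (rule nn_integral_std_normal_quadratic) (simp add: sum_nonneg)
    also have "(x/\<epsilon>)\<^sup>2 + (a 0/\<epsilon>)\<^sup>2 + (\<Sum>i<n. (a (Suc i))\<^sup>2)/ \<epsilon>\<^sup>2 = (x\<^sup>2 + (\<Sum>i<Suc n. (a i)\<^sup>2)) / \<epsilon>\<^sup>2"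
      unfolding sum.lessThan_Suc_shift by (simp add: power_divide add_divide_distrib)
    finally show ?thesis .
  qed
qed

text \<open>By the maximal inequality, some block of terms starting at \<open>n\<close> exceeds
  \<epsilon> with probability at most the tail of the variances divided by the square of \<epsilon>.
  Letting \<open>n\<close> grow, almost surely some \<open>n\<close> has only small blocks, for
  every \<epsilon> in a null sequence, and the partial sums are Cauchy.\<close>

lemma AE_gauss_law_summable:
  fixes a :: "nat \<Rightarrow> real"
  assumes a: "summable (\<lambda>i. (a i)\<^sup>2)"
  shows "AE l in gauss_law. summable (\<lambda>i. l i * a i)"
proof -
  interpret prob_space gauss_law by (rule prob_space_gauss_law)
  define B where "B \<epsilon> n N = {l. \<exists>k\<le>N. \<epsilon> \<le> \<bar>\<Sum>i\<in>{n..<k}. l i * a i\<bar>}" for \<epsilon> n N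
  have Bm: "B \<epsilon> n N \<in> sets gauss_law" for \<epsilon> n N
  proof -
    have "{l\<in>space gauss_law. \<exists>k\<in>{..N}. \<epsilon> \<le> \<bar>\<Sum>i\<in>{n..<k}. l i * a i\<bar>} \<in> sets gauss_law"
      by measurable
    then show ?thesis by (simp add: Bex_def B_def)
  qed
  have B: "emeasure gauss_law (B \<epsilon> n N) \<le> ennreal ((\<Sum>i. (a (i + n))\<^sup>2) / \<epsilon>\<^sup>2)" if \<epsilon>: "\<epsilon> > 0" for \<epsilon> n N
  proof -
    \<comment> \<open>Zeroing the first \<open>n\<close> coefficients turns blocks starting at
      \<open>n\<close> into initial sums, the form required by the maximal inequality.\<close>
    let ?a = "\<lambda>i. if i < n then 0 else a i"
    have *: "(\<Sum>i<k. l i * ?a i) = (\<Sum>i\<in>{n..<k}. l i * a i)" for k and l :: "nat \<Rightarrow> real"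
      by (rule sum.mono_neutral_cong_right) auto
    have "emeasure gauss_law (B \<epsilon> n N) \<le> ennreal ((\<Sum>i<N. (?a i)\<^sup>2) / \<epsilon>\<^sup>2)"
      using gauss_law_maximal[OF \<epsilon>, of N 0 ?a] unfolding * B_def by simp
    also have "\<dots> \<le> ennreal ((\<Sum>i. (a (i + n))\<^sup>2) / \<epsilon>\<^sup>2)"
    proof -
      have "(\<Sum>i<N. (?a i)\<^sup>2) \<le> (\<Sum>i<N + n. (?a i)\<^sup>2)"
        by (rule sum_mono2) auto
      also have "\<dots> = (\<Sum>i<N. (a (i + n))\<^sup>2)"
        by (subst sum.mono_neutral_cong_right[of _ "{n..<N+n}" _ "\<lambda>i. (a i)\<^sup>2"])
          (auto simp: sum.shift_bounds_nat_ivl[of _ 0 n N, simplified] lessThan_atLeast0)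
      also have "\<dots> \<le> (\<Sum>i. (a (i + n))\<^sup>2)"
        using a by (intro sum_le_suminf) (auto simp: summable_iff_shift[of "\<lambda>i. (a i)\<^sup>2"])
      finally show ?thesis using \<epsilon> by (intro ennreal_leI divide_right_mono) auto
    qed
    finally show ?thesis .
  qed
  have null: "(\<Inter>n. \<Union>N. B \<epsilon> n N) \<in> null_sets gauss_law" if \<epsilon>: "\<epsilon> > 0" for \<epsilon>
  proof -
    have m: "(\<Inter>n. \<Union>N. B \<epsilon> n N) \<in> sets gauss_law" using Bm by blast
    have le: "emeasure gauss_law (\<Inter>n. \<Union>N. B \<epsilon> n N) \<le> ennreal ((\<Sum>i. (a (i + n))\<^sup>2) / \<epsilon>\<^sup>2)" for n
    proof -
      have "emeasure gauss_law (\<Inter>n. \<Union>N. B \<epsilon> n N) \<le> emeasure gauss_law (\<Union>N. B \<epsilon> n N)"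
        using Bm by (intro emeasure_mono) blast+
      also have "\<dots> = (SUP N. emeasure gauss_law (B \<epsilon> n N))"
        using Bm by (intro SUP_emeasure_incseq[symmetric]) (auto simp: B_def incseq_def intro:
            order_trans)
      also have "\<dots> \<le> ennreal ((\<Sum>i. (a (i + n))\<^sup>2) / \<epsilon>\<^sup>2)"
        using B[OF \<epsilon>] by (intro SUP_least)
      finally show ?thesis .
    qed
    have "(\<lambda>n. ennreal ((\<Sum>i. (a (i + n))\<^sup>2) / \<epsilon>\<^sup>2)) \<longlonglongrightarrow> ennreal (0 / \<epsilon>\<^sup>2)"
      using suminf_exist_split2[OF a] \<epsilon> by (intro tendsto_ennrealI tendsto_divide tendsto_const)
          auto
    then have "emeasure gauss_law (\<Inter>n. \<Union>N. B \<epsilon> n N) \<le> 0"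
      using le by (intro LIMSEQ_le_const) auto
    then show ?thesis using m by auto
  qed
  have "AE l in gauss_law. \<forall>j. l \<notin> (\<Inter>n. \<Union>N. B (1 / Suc j) n N)"
    unfolding AE_all_countable by (intro allI AE_not_in null) simp
  then show ?thesis
  proof eventually_elim
    case (elim l)
    show ?case unfolding summable_Cauchy
    proof (intro allI impI)
      fix \<epsilon> :: real assume "\<epsilon> > 0"
      \<comment> \<open>Half of \<epsilon>, because a block from \<open>m\<close> to
        \<open>k\<close> is the difference of two blocks that start at \<open>n\<close>.\<close>
      then obtain j where j: "1 / real (Suc j) < \<epsilon> / 2"
        using reals_Archimedean[of "\<epsilon>/2"] by (auto simp: inverse_eq_divide)
      from elim obtain n where n: "\<And>N. l \<notin> B (1 / Suc j) n N" by auto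
      then have n': "\<bar>\<Sum>i\<in>{n..<k}. l i * a i\<bar> < \<epsilon> / 2" for k
      proof -
        have "\<not> 1 / real (Suc j) \<le> \<bar>\<Sum>i\<in>{n..<k}. l i * a i\<bar>"
          using n[of k] unfolding B_def by blast
        then show ?thesis using j by linarith
      qed
      show "\<exists>N. \<forall>m\<ge>N. \<forall>k. norm (\<Sum>i\<in>{m..<k}. l i * a i) < \<epsilon>"
      proof (intro exI[of _ n] allI impI)
        fix m k assume m: "m \<ge> n"
        show "norm (\<Sum>i\<in>{m..<k}. l i * a i) < \<epsilon>"
        proof (cases "m \<le> k")
          case True
          have "(\<Sum>i\<in>{n..<k}. l i * a i) = (\<Sum>i\<in>{n..<m}. l i * a i) + (\<Sum>i\<in>{m..<k}. l i * a i)"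
            using m True by (simp add: sum.atLeastLessThan_concat)
          then show ?thesis using n'[of k] n'[of m] unfolding real_norm_def by linarith
        qed (use \<open>\<epsilon> > 0\<close> in auto)
      qed
    qed
  qed
qed

section \<open>Product functionals and exponential moments of Gaussian sequences\<close>

lemma (in product_prob_space) nn_integral_PiM_prod:
  assumes "finite J" "J \<subseteq> I" "\<And>i. i \<in> J \<Longrightarrow> f i \<in> borel_measurable (M i)"
  shows "(\<integral>\<^sup>+x. (\<Prod>i\<in>J. f i (x i)) \<partial>PiM I M) = (\<Prod>i\<in>J. integral\<^sup>N (M i) (f i))"
proof -
  have [measurable]: "\<And>i. i \<in> J \<Longrightarrow> f i \<in> borel_measurable (M i)" by fact
  have "(\<Prod>i\<in>J. integral\<^sup>N (M i) (f i)) = (\<integral>\<^sup>+x. (\<Prod>i\<in>J. f i (x i)) \<partial>PiM J M)"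
    using assms by (subst product_nn_integral_prod) auto
  also have "\<dots> = (\<integral>\<^sup>+x. (\<Prod>i\<in>J. f i (x i)) \<partial>distr (PiM I M) (PiM J M) (\<lambda>x. restrict x J))"
    using assms by (simp add: distr_PiM_restrict_finite)
  also have "\<dots> = (\<integral>\<^sup>+x. (\<Prod>i\<in>J. f i (restrict x J i)) \<partial>PiM I M)"
    using assms by (subst nn_integral_distr) (auto intro!: measurable_restrict_subset)
  finally show ?thesis by (simp cong: prod.cong)
qed

lemma (in product_prob_space) integral_PiM_prod:
  fixes f :: "'i \<Rightarrow> 'a \<Rightarrow> 'c::{real_normed_field, banach, second_countable_topology}"
  assumes "finite J" "J \<subseteq> I" "\<And>i. i \<in> J \<Longrightarrow> integrable (M i) (f i)"
  shows "(\<integral>x. (\<Prod>i\<in>J. f i (x i)) \<partial>PiM I M) = (\<Prod>i\<in>J. integral\<^sup>L (M i) (f i))"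
proof -
  have [measurable]: "\<And>i. i \<in> J \<Longrightarrow> f i \<in> borel_measurable (M i)" using assms(3) by auto
  have "(\<Prod>i\<in>J. integral\<^sup>L (M i) (f i)) = (\<integral>x. (\<Prod>i\<in>J. f i (x i)) \<partial>PiM J M)"
    using assms by (subst product_integral_prod) auto
  also have "\<dots> = (\<integral>x. (\<Prod>i\<in>J. f i (x i)) \<partial>distr (PiM I M) (PiM J M) (\<lambda>x. restrict x J))"
    using assms by (simp add: distr_PiM_restrict_finite)
  also have "\<dots> = (\<integral>x. (\<Prod>i\<in>J. f i (restrict x J i)) \<partial>PiM I M)"
    using assms by (subst integral_distr) (auto intro!: measurable_restrict_subset)
  finally show ?thesis by (simp cong: prod.cong)
qed

text \<open>Completing the square: \<open>exp (t * s)\<close> shifts the mean of the density to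
  \<open>t\<close> and leaves the factor \<open>exp (t\<^sup>2 / 2)\<close>.\<close>

lemma nn_integral_exp_std_normal:
  "(\<integral>\<^sup>+s. ennreal (exp (t * s)) \<partial>std_normal_distribution) = ennreal (exp (t\<^sup>2 / 2))"
proof -
  have "(\<integral>\<^sup>+s. ennreal (exp (t * s)) \<partial>std_normal_distribution)
      = (\<integral>\<^sup>+s. ennreal (exp (t\<^sup>2/2)) * ennreal (normal_density t 1 s) \<partial>lborel)"
    by (subst nn_integral_density)
      (auto intro!: nn_integral_cong simp: ennreal_mult'[symmetric] normal_density_def
        exp_add[symmetric] power2_eq_square field_simps)
  also have "\<dots> = ennreal (exp (t\<^sup>2/2)) * emeasure (density lborel (normal_density t 1)) UNIV"
    by (subst nn_integral_cmult) (auto simp: emeasure_density)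
  also have "emeasure (density lborel (normal_density t 1)) UNIV = 1"
    using prob_space.emeasure_space_1[OF prob_space_normal_density[of 1 t]] by simp
  finally show ?thesis by simp
qed

lemma product_prob_space_gauss: "product_prob_space (\<lambda>_::nat. std_normal_distribution)"
  using sequence_space_prob_space[OF prob_space_std_normal] by (simp add: sequence_space_def)

lemma nn_integral_gauss_law_exp:
  "(\<integral>\<^sup>+l. ennreal (exp (\<Sum>i<n. l i * a i)) \<partial>gauss_law) = ennreal (exp ((\<Sum>i<n. (a i)\<^sup>2) / 2))"
proof -
  interpret product_prob_space "\<lambda>_::nat. std_normal_distribution" UNIV
      by (rule product_prob_space_gauss)
  have "(\<integral>\<^sup>+l. ennreal (exp (\<Sum>i<n. l i * a i)) \<partial>gauss_law)
     = (\<integral>\<^sup>+l. (\<Prod>i<n. ennreal (exp (a i * l i))) \<partial>gauss_law)"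
    by (intro nn_integral_cong) (simp add: exp_sum prod_ennreal mult.commute)
  also have "\<dots> = (\<Prod>i<n. ennreal (exp ((a i)\<^sup>2 / 2)))"
    unfolding gauss_law_def by (subst nn_integral_PiM_prod) (auto simp: nn_integral_exp_std_normal)
  finally show ?thesis by (simp add: prod_ennreal exp_sum[symmetric] sum_divide_distrib)
qed

lemma integral_gauss_law_iexp:
  "(\<integral>l. iexp (\<Sum>i<n. l i * a i) \<partial>gauss_law) = exp (- (\<Sum>i<n. (a i)\<^sup>2) / 2)"
proof -
  interpret product_prob_space "\<lambda>_::nat. std_normal_distribution" UNIV
      by (rule product_prob_space_gauss)
  have i: "integrable std_normal_distribution (\<lambda>s. iexp (t * s))" for t
    by (rule finite_measure.integrable_const_bound[OF prob_space.finite_measure[OF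
        prob_space_std_normal], of _ 1]) auto
  have "(\<integral>l. iexp (\<Sum>i<n. l i * a i) \<partial>gauss_law) = (\<integral>l. (\<Prod>i<n. iexp (a i * l i)) \<partial>gauss_law)"
    by (intro Bochner_Integration.integral_cong) (simp_all add: exp_sum sum_distrib_left
        mult.commute)
  also have "\<dots> = (\<Prod>i<n. complex_of_real (exp (- (a i)\<^sup>2 / 2)))"
    unfolding gauss_law_def
  proof (subst integral_PiM_prod)
    show "(\<Prod>i<n. CLINT x|std_normal_distribution. iexp (a i * x))
        = (\<Prod>i<n. complex_of_real (exp (- (a i)\<^sup>2 / 2)))"
      using char_std_normal_distribution by (simp add: char_def fun_eq_iff)
  qed (use i in auto)
  finally show ?thesis by (simp add: exp_sum[symmetric] sum_divide_distrib sum_negf[symmetric] flip: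
      of_real_prod)
qed

section \<open>The cavity field\<close>

context
  fixes e :: "nat \<Rightarrow> 'h::{real_inner, banach, second_countable_topology}"
  assumes onb: "orthonormal_basis e"
begin

lemma orthonormal_basis_inner: "e i \<bullet> e j = (if i = j then 1 else 0)"
  using onb by (simp add: orthonormal_basis_def)

lemma norm_basis_expansion_diff:
  "(norm (x - (\<Sum>i<n. (x \<bullet> e i) *\<^sub>R e i)))\<^sup>2 = (norm x)\<^sup>2 - (\<Sum>i<n. (x \<bullet> e i)\<^sup>2)"
proof -
  let ?p = "\<Sum>i<n. (x \<bullet> e i) *\<^sub>R e i"
  have xp: "x \<bullet> ?p = (\<Sum>i<n. (x \<bullet> e i)\<^sup>2)"
    by (simp add: inner_sum_right power2_eq_square)
  have pe: "?p \<bullet> e j = x \<bullet> e j" if "j < n" for j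
    using that by (simp add: inner_sum_left orthonormal_basis_inner if_distrib cong: if_cong)
  have pp: "?p \<bullet> ?p = (\<Sum>i<n. (x \<bullet> e i)\<^sup>2)"
    by (simp only: inner_sum_right inner_scaleR_right) (simp add: pe power2_eq_square)
  show ?thesis
    unfolding power2_norm_eq_inner using xp pp
    by (simp add: inner_diff_left inner_diff_right inner_commute)
qed

lemma basis_expansion_span:
  assumes "y \<in> span (range e)"
  shows "\<exists>n. y = (\<Sum>i<n. (y \<bullet> e i) *\<^sub>R e i)"
proof -
  let ?p = "\<lambda>n y. (\<Sum>i<n. (y \<bullet> e i) *\<^sub>R e i)"
  \<comment> \<open>Equality is demanded for all late sections; a single section would not be stable
    under addition.\<close>
  let ?S = "{y. \<exists>n. \<forall>m\<ge>n. ?p m y = y}"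
  have "subspace ?S"
  proof (rule subspaceI)
    show "0 \<in> ?S" by simp
    fix x y assume "x \<in> ?S" "y \<in> ?S"
    then obtain a b where "\<forall>m\<ge>a. ?p m x = x" "\<forall>m\<ge>b. ?p m y = y" by auto
    then have "\<forall>m\<ge>max a b. ?p m (x + y) = x + y"
      by (auto simp: inner_add_left scaleR_add_left sum.distrib)
    then show "x + y \<in> ?S" by blast
  next
    fix c x assume "x \<in> ?S"
    then obtain a where a: "\<forall>m\<ge>a. ?p m x = x" by auto
    have "?p m (c *\<^sub>R x) = c *\<^sub>R ?p m x" for m
      by (simp add: scaleR_sum_right)
    then show "c *\<^sub>R x \<in> ?S" using a by auto
  qed
  moreover have "range e \<subseteq> ?S"
  proof clarify
    fix j
    have "\<forall>m\<ge>Suc j. ?p m (e j) = e j"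
      by (auto simp: orthonormal_basis_inner if_distrib[of "\<lambda>c. c *\<^sub>R _"] cong: if_cong)
    then show "\<exists>n. \<forall>m\<ge>n. ?p m (e j) = e j" by blast
  qed
  ultimately have "span (range e) \<subseteq> ?S" by (rule span_minimal[rotated])
  then have "y \<in> ?S" using assms by blast
  then obtain n where "?p n y = y" by blast
  then show ?thesis by metis
qed

text \<open>Bessel's inequality bounds the partial sums, and density of the span gives the limit:
  subtracting an approximant \<open>y\<close> that equals its n-th section does not change the
  residue of \<open>x\<close>, which is therefore no longer than \<open>x - y\<close>.\<close>

lemma parseval: "(\<lambda>i. (x \<bullet> e i)\<^sup>2) sums (norm x)\<^sup>2"
proof -
  let ?p = "\<lambda>n y. (\<Sum>i<n. (y \<bullet> e i) *\<^sub>R e i)"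
  let ?s = "\<lambda>n y. (\<Sum>i<n. (y \<bullet> e i)\<^sup>2)"
  have le: "?s n y \<le> (norm y)\<^sup>2" for n y
    using norm_basis_expansion_diff[of y n] zero_le_power2[of "norm (y - ?p n y)"] by linarith
  show ?thesis unfolding sums_def
  proof (rule LIMSEQ_I)
    fix r :: real assume r: "r > 0"
    have "x \<in> closure (span (range e))" using onb by (simp add: orthonormal_basis_def)
    then obtain y where y: "y \<in> span (range e)" "dist y x < sqrt r"
      unfolding closure_approachable using r by (meson real_sqrt_gt_zero)
    then obtain n where n: "y = ?p n y" using basis_expansion_span by blast
    have "x - ?p n x = (x - y) - ?p n (x - y)"
      using n by (simp add: inner_diff_left scaleR_diff_left sum_subtractf)
    then have "(norm (x - ?p n x))\<^sup>2 = (norm (x - y))\<^sup>2 - ?s n (x - y)"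
      by (simp only: norm_basis_expansion_diff)
    also have "\<dots> \<le> (norm (x - y))\<^sup>2" by (simp add: sum_nonneg)
    also have "\<dots> < (sqrt r)\<^sup>2"
      using y(2) by (intro power_strict_mono) (auto simp: dist_norm norm_minus_commute)
    finally have *: "(norm x)\<^sup>2 - ?s n x < r" using r by (simp add: norm_basis_expansion_diff)
    show "\<exists>no. \<forall>n\<ge>no. norm (?s n x - (norm x)\<^sup>2) < r"
    proof (intro exI allI impI)
      fix k assume "k \<ge> n"
      then have "?s n x \<le> ?s k x" by (intro sum_mono2) auto
      then show "norm (?s k x - (norm x)\<^sup>2) < r" using * le[where n = k and y = x]
          by (simp add: abs_if)
    qed
  qed
qed

lemma AE_cavity_field_summable: "AE l in gauss_law. summable (\<lambda>i. l i * (x \<bullet> e i))"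
  using parseval[of x] by (intro AE_gauss_law_summable) (rule sums_summable)

lemma measurable_cavity_field [measurable]: "(\<lambda>l. cavity_field e l x) \<in> borel_measurable gauss_law"
  unfolding cavity_field_def by measurable

lemma cavity_field_tendsto:
  assumes "summable (\<lambda>i. l i * (x \<bullet> e i))"
  shows "(\<lambda>n. \<Sum>i<n. l i * (x \<bullet> e i)) \<longlonglongrightarrow> cavity_field e l x"
  using assms unfolding cavity_field_def by (rule summable_LIMSEQ)

lemma integral_iexp_cavity_field:
  "(\<integral>l. iexp (cavity_field e l x) \<partial>gauss_law) = exp (- (norm x)\<^sup>2 / 2)"
proof -
  interpret prob_space gauss_law by (rule prob_space_gauss_law)
  have "(\<lambda>n. \<integral>l. iexp (\<Sum>i<n. l i * (x \<bullet> e i)) \<partial>gauss_law) \<longlonglongrightarrow> (\<integral>l. iexp (cavity_field e l x)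
      \<partial>gauss_law)"
  proof (rule integral_dominated_convergence[where w = "\<lambda>_. 1"])
    show "AE l in gauss_law. (\<lambda>n. iexp (\<Sum>i<n. l i * (x \<bullet> e i))) \<longlonglongrightarrow> iexp (cavity_field e l x)"
      using AE_cavity_field_summable[of x]
    proof eventually_elim
      case (elim l)
      have "isCont (\<lambda>t. iexp t) (cavity_field e l x)" by (intro continuous_intros)
      from isCont_tendsto_compose[OF this cavity_field_tendsto[OF elim]] show ?case .
    qed
  qed auto
  moreover have "(\<lambda>n. complex_of_real (exp (- (\<Sum>i<n. (x \<bullet> e i)\<^sup>2) / 2)))
      \<longlonglongrightarrow> complex_of_real (exp (- (norm x)\<^sup>2 / 2))"
    using parseval[of x] unfolding sums_def by (intro tendsto_intros) auto
  ultimately show ?thesis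
    unfolding integral_gauss_law_iexp using LIMSEQ_unique by blast
qed

text \<open>Fatou's lemma along the partial sums. An upper bound suffices, as the estimate serves to
  show that normalisations are finite.\<close>

lemma nn_integral_exp_cavity_field:
  "(\<integral>\<^sup>+l. ennreal (exp (t * cavity_field e l x)) \<partial>gauss_law) \<le> ennreal (exp (t\<^sup>2 * (norm x)\<^sup>2 / 2))"
proof -
  let ?S = "\<lambda>n l. \<Sum>i<n. l i * (t * (x \<bullet> e i))"
  have "(\<integral>\<^sup>+l. ennreal (exp (t * cavity_field e l x)) \<partial>gauss_law)
      = (\<integral>\<^sup>+l. liminf (\<lambda>n. ennreal (exp (?S n l))) \<partial>gauss_law)"
  proof (rule nn_integral_cong_AE)
    show "AE l in gauss_law. ennreal (exp (t * cavity_field e l x))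
        = liminf (\<lambda>n. ennreal (exp (?S n l)))"
      using AE_cavity_field_summable[of x]
    proof eventually_elim
      case (elim l)
      have "(\<lambda>n. t * (\<Sum>i<n. l i * (x \<bullet> e i))) \<longlonglongrightarrow> t * cavity_field e l x"
        using cavity_field_tendsto[OF elim] by (intro tendsto_intros)
      then have "(\<lambda>n. ?S n l) \<longlonglongrightarrow> t * cavity_field e l x"
        by (simp add: sum_distrib_left mult.left_commute)
      then have "(\<lambda>n. ennreal (exp (?S n l))) \<longlonglongrightarrow> ennreal (exp (t * cavity_field e l x))"
        by (intro tendsto_ennrealI tendsto_exp)
      then show ?case by (intro lim_imp_Liminf[symmetric]) auto
    qed
  qed
  also have "\<dots> \<le> liminf (\<lambda>n. \<integral>\<^sup>+l. ennreal (exp (?S n l)) \<partial>gauss_law)"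
    by (rule nn_integral_liminf) measurable
  also have "\<dots> = liminf (\<lambda>n. ennreal (exp ((\<Sum>i<n. (t * (x \<bullet> e i))\<^sup>2) / 2)))"
    by (simp only: nn_integral_gauss_law_exp)
  also have "\<dots> = ennreal (exp (t\<^sup>2 * (norm x)\<^sup>2 / 2))"
  proof (intro lim_imp_Liminf tendsto_ennrealI tendsto_intros)
    have "(\<lambda>n. t\<^sup>2 * (\<Sum>i<n. (x \<bullet> e i)\<^sup>2)) \<longlonglongrightarrow> t\<^sup>2 * (norm x)\<^sup>2"
      using parseval[of x] unfolding sums_def by (intro tendsto_intros)
    then show "(\<lambda>n. \<Sum>i<n. (t * (x \<bullet> e i))\<^sup>2) \<longlonglongrightarrow> t\<^sup>2 * (norm x)\<^sup>2"
      by (simp add: sum_distrib_left power_mult_distrib)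
  qed auto
  finally show ?thesis .
qed

text \<open>The value of \<open>suminf\<close> on a divergent series is unspecified, so linearity is
  claimed only at those \<open>l\<close> where all series involved converge.\<close>

lemma cavity_field_sum:
  assumes "finite J" "\<And>j. j \<in> J \<Longrightarrow> summable (\<lambda>i. l i * (v j \<bullet> e i))"
  shows "cavity_field e l (\<Sum>j\<in>J. s j *\<^sub>R v j) = (\<Sum>j\<in>J. s j * cavity_field e l (v j))"
proof -
  have "cavity_field e l (\<Sum>j\<in>J. s j *\<^sub>R v j) = (\<Sum>i. \<Sum>j\<in>J. s j * (l i * (v j \<bullet> e i)))"
    unfolding cavity_field_def
    by (intro suminf_cong) (simp add: inner_sum_left sum_distrib_left mult.left_commute)
  also have "\<dots> = (\<Sum>j\<in>J. \<Sum>i. s j * (l i * (v j \<bullet> e i)))"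
    using assms by (subst suminf_sum) (auto intro: summable_mult)
  also have "\<dots> = (\<Sum>j\<in>J. s j * cavity_field e l (v j))"
    unfolding cavity_field_def using assms by (intro sum.cong refl suminf_mult) auto
  finally show ?thesis .
qed

text \<open>The fields at finitely many vectors are jointly Gaussian with the inner products as
  covariances: almost surely their combination is the field at the combined vector.\<close>

lemma integral_iexp_sum_cavity_field:
  fixes v :: "'i \<Rightarrow> 'h"
  assumes "finite J"
  shows "(\<integral>l. iexp (\<Sum>j\<in>J. s j * cavity_field e l (v j)) \<partial>gauss_law)
    = exp (- (norm (\<Sum>j\<in>J. s j *\<^sub>R v j))\<^sup>2 / 2)"
proof -
  have "AE l in gauss_law. \<forall>j\<in>J. summable (\<lambda>i. l i * (v j \<bullet> e i))"
    using assms AE_cavity_field_summable by (subst AE_finite_all) auto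
  then have "(\<integral>l. iexp (\<Sum>j\<in>J. s j * cavity_field e l (v j)) \<partial>gauss_law)
     = (\<integral>l. iexp (cavity_field e l (\<Sum>j\<in>J. s j *\<^sub>R v j)) \<partial>gauss_law)"
    using assms by (intro integral_cong_AE) (auto simp: cavity_field_sum elim!: eventually_mono)
  then show ?thesis by (simp add: integral_iexp_cavity_field)
qed

lemma measurable_cavity_field_pair:
  "(\<lambda>p. cavity_field e (fst p) (snd p)) \<in> borel_measurable (gauss_law \<Otimes>\<^sub>M unit_ball)"
proof -
  have [measurable]: "(\<lambda>v. v) \<in> borel_measurable (unit_ball :: 'h measure)"
    by (rule measurable_ident_unit_ball)
  show ?thesis unfolding cavity_field_def by measurable
qed

lemma sets_pair_unit_ball:
  assumes "m \<in> space (prob_algebra unit_ball)"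
  shows "sets (gauss_law \<Otimes>\<^sub>M m) = sets (gauss_law \<Otimes>\<^sub>M (unit_ball :: 'h measure))"
  using sets_unit_ball_space(1)[OF assms] by (intro sets_pair_measure_cong) auto

text \<open>The null set of divergence depends on \<open>v\<close>. Fubini exchanges the
  quantifiers: one null set of \<open>l\<close>, outside of which the series converges for almost
  every \<open>v\<close>.\<close>

lemma AE_AE_cavity_field_summable:
  assumes m: "m \<in> space (prob_algebra unit_ball)"
  shows "AE l in gauss_law. AE v in m. summable (\<lambda>i. l i * (v \<bullet> e i))"
proof -
  interpret m: prob_space m by (rule sets_unit_ball_space(2)[OF m])
  interpret g: prob_space gauss_law by (rule prob_space_gauss_law)
  interpret pair_sigma_finite gauss_law m ..
  have [measurable]: "(\<lambda>v. v) \<in> borel_measurable m"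
    using measurable_ident_unit_ball sets_unit_ball_space(1)[OF m]
        by (simp cong: measurable_cong_sets)
  have "AE v in m. AE l in gauss_law. summable (\<lambda>i. l i * (v \<bullet> e i))"
    using AE_cavity_field_summable by simp
  moreover have "Measurable.pred (gauss_law \<Otimes>\<^sub>M m) (\<lambda>p. summable (\<lambda>i. fst p i * (snd p \<bullet> e i)))"
    unfolding summable_iff_convergent Cauchy_convergent_iff[symmetric] Measurable.pred_def
    by (rule sets_Collect_Cauchy) measurable
  ultimately show ?thesis
    by (subst AE_commute) (auto simp: Measurable.pred_def)
qed

text \<open>By Tonelli the mean over \<open>l\<close> is at most
  \<open>2 * exp (t\<^sup>2 / 2)\<close>, since the bound for one \<open>v\<close> is uniform on the
  unit ball. With \<open>t\<close> a multiple of \<open>\<bar>c\<bar>\<close> this gives an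
  integrable bound for the weights.\<close>

lemma AE_nn_integral_exp_abs_cavity_field:
  assumes m: "m \<in> space (prob_algebra unit_ball)"
  shows "AE l in gauss_law. (\<integral>\<^sup>+v. ennreal (exp (t * \<bar>cavity_field e l v\<bar>)) \<partial>m) < \<infinity>"
proof -
  interpret m: prob_space m by (rule sets_unit_ball_space(2)[OF m])
  interpret g: prob_space gauss_law by (rule prob_space_gauss_law)
  interpret pair_sigma_finite gauss_law m ..
  have [measurable]: "(\<lambda>p. cavity_field e (fst p) (snd p)) \<in> borel_measurable (gauss_law \<Otimes>\<^sub>M m)"
    using measurable_cavity_field_pair sets_pair_unit_ball[OF m]
        by (simp cong: measurable_cong_sets)
  let ?f = "\<lambda>l v. ennreal (exp (t * \<bar>cavity_field e l v\<bar>))"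
  have f[measurable]: "(\<lambda>(l, v). ?f l v) \<in> borel_measurable (gauss_law \<Otimes>\<^sub>M m)"
    by (simp add: case_prod_beta)
  have "(\<integral>\<^sup>+l. \<integral>\<^sup>+v. ?f l v \<partial>m \<partial>gauss_law) = (\<integral>\<^sup>+v. \<integral>\<^sup>+l. ?f l v \<partial>gauss_law \<partial>m)"
    by (rule Fubini'[symmetric]) (rule f)
  also have "\<dots> \<le> (\<integral>\<^sup>+v. ennreal (2 * exp (t\<^sup>2 / 2)) \<partial>m)"
  proof (rule nn_integral_mono)
    fix v assume "v \<in> space m"
    then have v: "norm v \<le> 1" using sets_unit_ball_space(3)[OF m] by simp
    have "(\<integral>\<^sup>+l. ?f l v \<partial>gauss_law) \<le> (\<integral>\<^sup>+l. ennreal (exp (t * cavity_field e l v)) + ennreal (exp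
        ((-t) * cavity_field e l v)) \<partial>gauss_law)"
      by (intro nn_integral_mono) (auto simp: abs_if ennreal_plus[symmetric] simp del: ennreal_plus
          intro!: ennreal_leI)
    also have "\<dots> = (\<integral>\<^sup>+l. ennreal (exp (t * cavity_field e l v))
        \<partial>gauss_law) + (\<integral>\<^sup>+l. ennreal (exp ((-t) * cavity_field e l v)) \<partial>gauss_law)"
      by (rule nn_integral_add) measurable
    also have "\<dots> \<le> ennreal (exp (t\<^sup>2 * (norm v)\<^sup>2 / 2)) + ennreal (exp ((-t)\<^sup>2 * (norm v)\<^sup>2 / 2))"
      by (intro add_mono nn_integral_exp_cavity_field)
    also have "\<dots> \<le> ennreal (2 * exp (t\<^sup>2 / 2))"
    proof -
      have "(norm v)\<^sup>2 \<le> 1" using v by (simp add: power_le_one)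
      then have "t\<^sup>2 * (norm v)\<^sup>2 \<le> t\<^sup>2 * 1" by (intro mult_left_mono) auto
      then show ?thesis by (auto simp: ennreal_plus[symmetric] simp del: ennreal_plus intro!:
          ennreal_leI)
    qed
    finally show "(\<integral>\<^sup>+l. ?f l v \<partial>gauss_law) \<le> ennreal (2 * exp (t\<^sup>2 / 2))" .
  qed
  also have "\<dots> < \<infinity>" by (simp add: m.emeasure_space_1)
  finally have "(\<integral>\<^sup>+l. \<integral>\<^sup>+v. ?f l v \<partial>m \<partial>gauss_law) \<noteq> \<infinity>" by auto
  then have "AE l in gauss_law. (\<integral>\<^sup>+v. ?f l v \<partial>m) \<noteq> \<infinity>"
    by (intro nn_integral_PInf_AE) measurable
  then show ?thesis by (auto simp: less_top)
qed

end

declare measurable_gauss_law_component [measurable del]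

section \<open>Independent samples and moments\<close>

abbreviation iid :: "'a measure \<Rightarrow> (nat \<Rightarrow> 'a) measure" where
  "iid m \<equiv> \<Pi>\<^sub>M i\<in>(UNIV::nat set). m"

text \<open>Cylinders generate the product algebra and are stable under intersection; on a cylinder
  the product measure is a finite product of evaluations of \<open>m\<close>.\<close>

lemma measurable_iid:
  "(\<lambda>m. iid m) \<in> prob_algebra (B :: 'a measure) \<rightarrow>\<^sub>M prob_algebra (iid B)"
proof (rule measurable_prob_algebra_generated[OF sets_PiM Int_stable_prod_algebra
    prod_algebra_sets_into_space])
  fix m assume m: "m \<in> space (prob_algebra B)"
  then have m': "prob_space m" "sets m = sets B" by (auto simp: space_prob_algebra)
  show "prob_space (iid m)" by (intro prob_space_PiM m')
  show "sets (iid m) = sets (iid B)" by (intro sets_PiM_cong m') simp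
next
  fix A assume "A \<in> prod_algebra (UNIV::nat set) (\<lambda>_. B)"
  then obtain J E where A: "A = prod_emb UNIV (\<lambda>_. B) J (\<Pi>\<^sub>E j\<in>J. E j)"
    and J: "finite J" and E: "\<And>j. j \<in> J \<Longrightarrow> E j \<in> sets B"
    by (auto elim!: prod_algebraE)
  have "emeasure (iid m) A = (\<Prod>j\<in>J. emeasure m (E j))" if m: "m \<in> space (prob_algebra B)" for m
  proof -
    have m': "prob_space m" "sets m = sets B" using m by (auto simp: space_prob_algebra)
    have "A = prod_emb UNIV (\<lambda>_. m) J (\<Pi>\<^sub>E j\<in>J. E j)"
      unfolding A prod_emb_def using sets_eq_imp_space_eq[OF m'(2)] by simp
    then show ?thesis using J E m' by (auto intro!: emeasure_PiM_emb)
  qed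
  moreover have "(\<lambda>m. \<Prod>j\<in>J. emeasure m (E j)) \<in> borel_measurable (prob_algebra B)"
    using E unfolding prob_algebra_def
    by (intro borel_measurable_prod measurable_restrict_space1 measurable_emeasure_subprob_algebra)
        auto
  ultimately show "(\<lambda>m. emeasure (iid m) A) \<in> borel_measurable (prob_algebra B)"
    by (simp cong: measurable_cong)
qed

lemma nn_integral_iid_case_nat:
  assumes m: "prob_space m" and f: "f \<in> borel_measurable (iid m)"
  shows "(\<integral>\<^sup>+v. f v \<partial>iid m) = (\<integral>\<^sup>+s. \<integral>\<^sup>+v. f (case_nat s v) \<partial>iid m \<partial>m)"
proof -
  interpret sequence_space m by (rule sequence_space_prob_space[OF m])
  have [measurable]: "f \<in> borel_measurable (iid m)" by fact
  have "(\<integral>\<^sup>+v. f v \<partial>iid m) = (\<integral>\<^sup>+v. f v \<partial>distr (m \<Otimes>\<^sub>M iid m) (iid m) (\<lambda>(s, v). case_nat s v))"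
    by (simp add: PiM_iter)
  also have "\<dots> = (\<integral>\<^sup>+p. f (case_nat (fst p) (snd p)) \<partial>(m \<Otimes>\<^sub>M iid m))"
    by (subst nn_integral_distr) (auto simp: case_prod_beta)
  also have "\<dots> = (\<integral>\<^sup>+s. \<integral>\<^sup>+v. f (case_nat s v) \<partial>iid m \<partial>m)"
    by (subst P.nn_integral_fst[symmetric]) auto
  finally show ?thesis .
qed

text \<open>Cylinder functions, in a form that survives fixing the first coordinate, so that
  statements about \<open>N\<close> coordinates can be proved by induction through
  \<open>case_nat\<close>.\<close>

definition depends_on_first :: "nat \<Rightarrow> ((nat \<Rightarrow> 'a) \<Rightarrow> 'b) \<Rightarrow> bool" where
  "depends_on_first N f \<longleftrightarrow> (\<forall>v v'. (\<forall>i<N. v i = v' i) \<longrightarrow> f v = f v')"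

lemma depends_on_firstD: "depends_on_first N f \<Longrightarrow> (\<And>i. i < N \<Longrightarrow> v i = v' i) \<Longrightarrow> f v = f v'"
  unfolding depends_on_first_def by blast

lemma depends_on_first_case_nat:
  "depends_on_first (Suc N) f \<Longrightarrow> depends_on_first N (\<lambda>v. f (case_nat s v))"
  unfolding depends_on_first_def by (auto split: nat.split)

lemma measurable_case_nat_iid:
  assumes "f \<in> borel_measurable (iid m)" "s \<in> space m"
  shows "(\<lambda>v. f (case_nat s v)) \<in> borel_measurable (iid m)"
proof (rule measurable_compose[OF _ assms(1)])
  show "(\<lambda>v. case_nat s v) \<in> iid m \<rightarrow>\<^sub>M iid m" using assms(2) by measurable
qed

text \<open>Independence of the first \<open>N\<close> samples from the next \<open>k\<close>. Read
  from right to left, it turns powers of an integral over \<open>m\<close> into additional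
  samples.\<close>

lemma nn_integral_iid_mult_prod:
  fixes f :: "(nat \<Rightarrow> 'a) \<Rightarrow> ennreal"
  assumes m: "prob_space m" and f: "f \<in> borel_measurable (iid m)" "depends_on_first N f"
    and g: "g \<in> borel_measurable m"
  shows "(\<integral>\<^sup>+v. f v * (\<Prod>i<k. g (v (N + i))) \<partial>iid m) = (\<integral>\<^sup>+v. f v \<partial>iid m) * (integral\<^sup>N m g) ^ k"
  using f
proof (induction N arbitrary: f)
  case 0
  interpret sequence_space m by (rule sequence_space_prob_space[OF m])
  have [measurable]: "g \<in> borel_measurable m" by fact
  have f: "f v = f undefined" for v using 0(2) by (rule depends_on_firstD) simp
  have "(\<integral>\<^sup>+v. (\<Prod>i<k. g (v i)) \<partial>iid m) = (integral\<^sup>N m g) ^ k"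
    by (subst nn_integral_PiM_prod) auto
  then show ?case
    by (subst (1 2) f) (simp add: nn_integral_cmult P.emeasure_space_1)
next
  case (Suc N)
  interpret sequence_space m by (rule sequence_space_prob_space[OF m])
  have [measurable]: "g \<in> borel_measurable m" "f \<in> borel_measurable (iid m)" by fact+
  have "(\<integral>\<^sup>+v. f v * (\<Prod>i<k. g (v (Suc N + i))) \<partial>iid m)
      = (\<integral>\<^sup>+s. \<integral>\<^sup>+v. f (case_nat s v) * (\<Prod>i<k. g (v (N + i))) \<partial>iid m \<partial>m)"
    by (subst nn_integral_iid_case_nat[OF m]) auto
  also have "\<dots> = (\<integral>\<^sup>+s. (\<integral>\<^sup>+v. f (case_nat s v) \<partial>iid m) * (integral\<^sup>N m g) ^ k \<partial>m)"
    using Suc.prems by (intro nn_integral_cong Suc.IH measurable_case_nat_iid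
        depends_on_first_case_nat)
  also have "\<dots> = (\<integral>\<^sup>+s. (\<integral>\<^sup>+v. f (case_nat s v) \<partial>iid m) \<partial>m) * (integral\<^sup>N m g) ^ k"
    by (rule nn_integral_multc) measurable
  also have "(\<integral>\<^sup>+s. (\<integral>\<^sup>+v. f (case_nat s v) \<partial>iid m) \<partial>m) = (\<integral>\<^sup>+v. f v \<partial>iid m)"
    by (rule nn_integral_iid_case_nat[symmetric, OF m]) fact
  finally show ?case .
qed

text \<open>An infinite product of densities would be meaningless. For a function of the first
  \<open>N\<close> samples the later ones integrate to 1, and \<open>N\<close> factors
  remain.\<close>

lemma nn_integral_iid_density:
  fixes f :: "(nat \<Rightarrow> 'a) \<Rightarrow> ennreal"
  assumes m: "prob_space m" and d: "d \<in> borel_measurable m" and md: "prob_space (density m d)"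
    and f: "f \<in> borel_measurable (iid m)" "depends_on_first N f"
  shows "(\<integral>\<^sup>+v. f v \<partial>iid (density m d)) = (\<integral>\<^sup>+v. f v * (\<Prod>i<N. d (v i)) \<partial>iid m)"
  using f
proof (induction N arbitrary: f)
  case 0
  interpret sequence_space m by (rule sequence_space_prob_space[OF m])
  interpret d: sequence_space "density m d" by (rule sequence_space_prob_space[OF md])
  have f: "f = (\<lambda>_. f undefined)" using 0(2) by (intro ext) (erule depends_on_firstD, simp)
  have "integral\<^sup>N Q f = f undefined" if "prob_space Q" for Q
    using prob_space.emeasure_space_1[OF that] by (subst f) simp
  then show ?case using P.prob_space_axioms d.P.prob_space_axioms by simp
next
  case (Suc N)
  interpret sequence_space m by (rule sequence_space_prob_space[OF m])
  interpret d: sequence_space "density m d" by (rule sequence_space_prob_space[OF md])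
  have [measurable]: "d \<in> borel_measurable m" "f \<in> borel_measurable (iid m)" by fact+
  have sd: "sets (iid (density m d)) = sets (iid m)" by (intro sets_PiM_cong) auto
  have fd: "f \<in> borel_measurable (iid (density m d))"
    using Suc.prems(1) sd by (simp cong: measurable_cong_sets)
  have "(\<integral>\<^sup>+v. f v \<partial>iid (density m d)) = (\<integral>\<^sup>+s. \<integral>\<^sup>+v. f (case_nat s v) \<partial>iid (density m d)
      \<partial>density m d)"
    by (rule nn_integral_iid_case_nat[OF md fd])
  also have "\<dots> = (\<integral>\<^sup>+s. \<integral>\<^sup>+v. f (case_nat s v) * (\<Prod>i<N. d (v i)) \<partial>iid m \<partial>density m d)"
    using Suc.prems by (intro nn_integral_cong Suc.IH measurable_case_nat_iid
        depends_on_first_case_nat) auto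
  also have "\<dots> = (\<integral>\<^sup>+s. d s * (\<integral>\<^sup>+v. f (case_nat s v) * (\<Prod>i<N. d (v i)) \<partial>iid m) \<partial>m)"
    by (subst nn_integral_density) auto
  also have "\<dots> = (\<integral>\<^sup>+s. \<integral>\<^sup>+v. d s * (f (case_nat s v) * (\<Prod>i<N. d (v i))) \<partial>iid m \<partial>m)"
    by (intro nn_integral_cong nn_integral_cmult[symmetric])
      (auto intro!: borel_measurable_times measurable_case_nat_iid Suc.prems)
  also have "\<dots> = (\<integral>\<^sup>+v. f v * (\<Prod>i<Suc N. d (v i)) \<partial>iid m)"
    by (subst nn_integral_iid_case_nat[OF m])
      (auto simp: prod.lessThan_Suc_shift mult_ac simp del: prod.lessThan_Suc)
  finally show ?case .
qed

text \<open>The approximants replace \<open>1 / y\<close> on \<open>{0<..K}\<close> by the partial sums of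
  \<open>1 / K * (\<Sum>j. (1 - y / K) ^ j)\<close>, which are polynomials below \<open>1 / y\<close>.\<close>

lemma polynomial_approx_integral_ratio:
  fixes a U :: "'a \<Rightarrow> real"
  defines "p \<equiv> \<lambda>K N J. (smult (1 / K) (\<Sum>j<J. [:1, - 1 / K:] ^ j)) ^ N"
  assumes P: "prob_space P" and [measurable]: "a \<in> borel_measurable P" "U \<in> borel_measurable P"
    and U: "\<And>x. x \<in> space P \<Longrightarrow> 0 < U x \<and> U x \<le> K"
    and a: "\<And>x. x \<in> space P \<Longrightarrow> 0 \<le> a x \<and> a x \<le> U x ^ N"
  shows "(\<lambda>J. \<integral>x. a x * poly (p K N J) (U x) \<partial>P) \<longlonglongrightarrow> (\<integral>x. a x / U x ^ N \<partial>P)"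
    and "(\<integral>x. a x * poly q (U x) \<partial>P) = (\<Sum>i\<le>degree q. coeff q i * (\<integral>x. a x * U x ^ i \<partial>P))"
proof -
  interpret prob_space P by fact
  have [measurable]: "(\<lambda>x. poly q (U x)) \<in> borel_measurable P" for q
    by (rule measurable_compose[OF _ borel_measurable_continuous_onI]) (auto intro:
        continuous_intros)
  have p: "poly (p K N J) y = (1 / K * (\<Sum>j<J. (1 - y / K) ^ j)) ^ N" for J y
    unfolding p_def by (simp add: poly_power poly_sum)
  have g: "1 / K * (\<Sum>j<J. (1 - y / K) ^ j) \<le> 1 / y \<and> 0 \<le> 1 / K * (\<Sum>j<J. (1 - y / K) ^ j)"
    if y: "0 < y" "y \<le> K" for y J
  proof -
    have "1 / K * (\<Sum>j<J. (1 - y / K) ^ j) = (1 - (1 - y / K) ^ J) / y"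
      using y by (subst sum_gp_strict) auto
    moreover have "0 \<le> (1 - y / K) ^ J" using y by simp
    moreover have "(1 - y / K) ^ J \<le> 1" using y by (intro power_le_one) auto
    ultimately show ?thesis using y by (auto intro: divide_right_mono)
  qed
  have gl: "(\<lambda>J. 1 / K * (\<Sum>j<J. (1 - y / K) ^ j)) \<longlonglongrightarrow> 1 / y" if y: "0 < y" "y \<le> K" for y
  proof -
    have "(\<lambda>j. (1 - y / K) ^ j) sums (1 / (1 - (1 - y / K)))"
      using y by (intro geometric_sums) auto
    then have "(\<lambda>J. 1 / K * (\<Sum>j<J. (1 - y / K) ^ j)) \<longlonglongrightarrow> 1 / K * (1 / (1 - (1 - y / K)))"
      unfolding sums_def by (intro tendsto_intros)
    then show ?thesis using y by simp
  qed
  show "(\<lambda>J. \<integral>x. a x * poly (p K N J) (U x) \<partial>P) \<longlonglongrightarrow> (\<integral>x. a x / U x ^ N \<partial>P)"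
  proof (rule integral_dominated_convergence[where w = "\<lambda>_. 1"])
    show "AE x in P. (\<lambda>J. a x * poly (p K N J) (U x)) \<longlonglongrightarrow> a x / U x ^ N"
    proof (rule AE_I2)
      fix x assume "x \<in> space P"
      then have "(\<lambda>J. a x * (1 / K * (\<Sum>j<J. (1 - U x / K) ^ j)) ^ N) \<longlonglongrightarrow> a x * (1 / U x) ^ N"
        using U by (intro tendsto_intros gl) auto
      then show "(\<lambda>J. a x * poly (p K N J) (U x)) \<longlonglongrightarrow> a x / U x ^ N"
        unfolding p by (simp add: power_divide)
    qed
    show "AE x in P. norm (a x * poly (p K N J) (U x)) \<le> 1" for J
    proof (rule AE_I2)
      fix x assume x: "x \<in> space P"
      have le: "poly (p K N J) (U x) \<le> (1 / U x) ^ N" "0 \<le> poly (p K N J) (U x)"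
        using U[OF x] g[of "U x" J] unfolding p by (auto intro!: power_mono zero_le_power)
      \<comment> \<open>The hypothesis \<open>a x \<le> U x ^ N\<close> offsets the singularity of
        the ratio and makes 1 a dominating function.\<close>
      have "a x * poly (p K N J) (U x) \<le> U x ^ N * (1 / U x) ^ N"
        using a[OF x] le U[OF x] by (intro mult_mono) auto
      also have "\<dots> = 1" using U[OF x] by (simp add: power_divide)
      finally show "norm (a x * poly (p K N J) (U x)) \<le> 1" using a[OF x] le by simp
    qed
  qed auto
  have int: "integrable P (\<lambda>x. a x * U x ^ i)" for i
  proof (rule integrable_const_bound[where B = "K ^ N * K ^ i"])
    show "AE x in P. norm (a x * U x ^ i) \<le> K ^ N * K ^ i"
    proof (rule AE_I2)
      fix x assume x: "x \<in> space P"
      have "a x \<le> K ^ N" using a[OF x] U[OF x] power_mono[of "U x" K N] by linarith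
      then show "norm (a x * U x ^ i) \<le> K ^ N * K ^ i"
        using a[OF x] U[OF x] by (auto simp: abs_mult intro!: mult_mono power_mono)
    qed
  qed measurable
  show "(\<integral>x. a x * poly q (U x) \<partial>P) = (\<Sum>i\<le>degree q. coeff q i * (\<integral>x. a x * U x ^ i \<partial>P))"
  proof -
    have "(\<integral>x. a x * poly q (U x) \<partial>P) = (\<integral>x. (\<Sum>i\<le>degree q. coeff q i * (a x * U x ^ i)) \<partial>P)"
      by (simp add: poly_altdef sum_distrib_left mult_ac)
    also have "\<dots> = (\<Sum>i\<le>degree q. coeff q i * (\<integral>x. a x * U x ^ i \<partial>P))"
      using int by (subst Bochner_Integration.integral_sum) auto
    finally show ?thesis .
  qed
qed

text \<open>The approximating polynomials depend on \<open>K\<close>, \<open>N\<close> and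
  \<open>J\<close> but not on the probability space, and their means are determined by the moments.
  Both ratios are thus limits of the same sequence.\<close>

lemma moments_determine_ratio:
  fixes a U :: "'a \<Rightarrow> real" and a' U' :: "'b \<Rightarrow> real"
  assumes P: "prob_space P" "a \<in> borel_measurable P" "U \<in> borel_measurable P"
    "\<And>x. x \<in> space P \<Longrightarrow> 0 < U x \<and> U x \<le> K" "\<And>x. x \<in> space P \<Longrightarrow> 0 \<le> a x \<and> a x \<le> U x ^ N"
    and P': "prob_space P'" "a' \<in> borel_measurable P'" "U' \<in> borel_measurable P'"
    "\<And>x. x \<in> space P' \<Longrightarrow> 0 < U' x \<and> U' x \<le> K" "\<And>x. x \<in> space P' \<Longrightarrow> 0 \<le> a' x \<and> a' x \<le> U' x ^ N"
    and moments: "\<And>k. (\<integral>x. a x * U x ^ k \<partial>P) = (\<integral>x. a' x * U' x ^ k \<partial>P')"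
  shows "(\<integral>x. a x / U x ^ N \<partial>P) = (\<integral>x. a' x / U' x ^ N \<partial>P')"
proof -
  note L = polynomial_approx_integral_ratio[OF P]
  note R = polynomial_approx_integral_ratio[OF P']
  have "(\<integral>x. a x * poly q (U x) \<partial>P) = (\<integral>x. a' x * poly q (U' x) \<partial>P')" for q
    using L(2)[of q] R(2)[of q] moments by simp
  with L(1) show ?thesis by (intro LIMSEQ_unique[OF _ R(1)]) (simp only:)
qed

section \<open>Gaussian integrals with a quadratic exponent\<close>

lemma std_normal_density_times_exp_square:
  assumes "D > 0"
  shows "std_normal_density s * exp ((1 - D) * s\<^sup>2 / 2)
      = 1 / sqrt D * normal_density 0 (1 / sqrt D) s"
proof -
  have "exp (- s\<^sup>2 / 2) * exp ((1 - D) * s\<^sup>2 / 2) = exp (- D * s\<^sup>2 / 2)"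
    by (simp add: exp_add[symmetric] field_simps)
  then show ?thesis using assms
    by (simp add: normal_density_def power_divide real_sqrt_mult real_sqrt_divide field_simps)
qed

text \<open>The quadratic exponential changes the variance to \<open>1 / D\<close> and the mass to
  \<open>1 / sqrt D\<close>; what remains is a characteristic function at \<open>y\<close>, computed
  by the substitution \<open>s / sqrt D\<close>.\<close>

lemma integral_iexp_times_exp_square_std_normal:
  fixes y D :: real
  assumes D: "D > 0"
  shows "(\<integral>s. iexp (y * s) * complex_of_real (exp ((1 - D) * s\<^sup>2 / 2)) \<partial>std_normal_distribution)
    = complex_of_real (exp (- y\<^sup>2 / (2 * D)) / sqrt D)"
proof -
  let ?r = "1 / sqrt D"
  have r: "?r > 0" using D by simp
  note dens = std_normal_density_times_exp_square[OF D]
  have "(\<integral>s. iexp (y * s) * complex_of_real (exp ((1 - D) * s\<^sup>2 / 2)) \<partial>std_normal_distribution)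
    = (\<integral>s. std_normal_density s *\<^sub>R (iexp (y * s) * complex_of_real (exp ((1 - D) * s\<^sup>2 / 2)))
        \<partial>lborel)"
    by (subst integral_density) auto
  also have "\<dots> = (\<integral>s. ?r *\<^sub>R (normal_density 0 ?r s *\<^sub>R iexp (y * s)) \<partial>lborel)"
  proof (intro Bochner_Integration.integral_cong refl)
    fix s
    have "std_normal_density s *\<^sub>R (iexp (y * s) * complex_of_real (exp ((1 - D) * s\<^sup>2 / 2)))
        = (std_normal_density s * exp ((1 - D) * s\<^sup>2 / 2)) *\<^sub>R iexp (y * s)"
      by (simp add: scaleR_conv_of_real)
    then show "std_normal_density s *\<^sub>R (iexp (y * s) * complex_of_real (exp ((1 - D) * s\<^sup>2 / 2)))
        = ?r *\<^sub>R (normal_density 0 ?r s *\<^sub>R iexp (y * s))"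
      by (simp only: dens scaleR_scaleR)
  qed
  also have "\<dots> = ?r *\<^sub>R (\<integral>s. normal_density 0 ?r s *\<^sub>R iexp (y * s) \<partial>lborel)"
    by (simp only: scaleR_conv_of_real integral_mult_right_zero)
  also have "(\<integral>s. normal_density 0 ?r s *\<^sub>R iexp (y * s) \<partial>lborel)
     = \<bar>?r\<bar> *\<^sub>R (\<integral>s. normal_density 0 ?r (0 + ?r * s) *\<^sub>R iexp (y * (0 + ?r * s)) \<partial>lborel)"
    using r by (intro lborel_integral_real_affine) auto
  also have "\<dots> = (\<integral>s. \<bar>?r\<bar> *\<^sub>R (normal_density 0 ?r (0 + ?r * s) *\<^sub>R iexp (y * (0 + ?r * s)))
      \<partial>lborel)"
    by (simp only: scaleR_conv_of_real integral_mult_right_zero)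
  also have "\<dots> = (\<integral>s. std_normal_density s *\<^sub>R iexp ((y * ?r) * s) \<partial>lborel)"
  proof (intro Bochner_Integration.integral_cong refl)
    fix s
    have "?r * normal_density 0 ?r (?r * s) = std_normal_density s"
      using D by (simp add: normal_density_def power_divide real_sqrt_mult real_sqrt_divide
          power_mult_distrib field_simps)
    then show "\<bar>?r\<bar> *\<^sub>R (normal_density 0 ?r (0 + ?r * s) *\<^sub>R iexp (y * (0 + ?r * s)))
        = std_normal_density s *\<^sub>R iexp ((y * ?r) * s)"
      using r by (simp add: abs_of_pos mult.assoc)
  qed
  also have "\<dots> = char std_normal_distribution (y * ?r)"
    unfolding char_def by (subst integral_density) auto
  also have "\<dots> = complex_of_real (exp (- y\<^sup>2 / (2 * D)))"
    using D by (simp add: char_std_normal_distribution power_mult_distrib power_divide)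
  finally show ?thesis by (simp add: scaleR_conv_of_real)
qed

section \<open>Bounded cavity weights\<close>

text \<open>
  The cavity weight is unbounded, and its products have log-normal moments, which do not determine
  a law. \<open>trunc_weight\<close> is a bounded substitute. Up to the factor \<open>exp (c\<^sup>2 / (2 * \<delta>))\<close> it is the
  mean of \<open>iexp (s * (x - c / \<delta>)) * exp (s\<^sup>2 / 2 * (norm v)\<^sup>2)\<close>, where \<open>x\<close> is the cavity field at
  \<open>v\<close>, over a centred Gaussian \<open>s\<close> of variance \<open>\<delta>\<close>. In the mean over \<open>l\<close> of a product of such
  exponentials the squared norms cancel. Hence this mean, \<open>overlap_moment\<close>, involves only
  off-diagonal overlaps.
\<close>

definition trunc_weight ::
    "(nat \<Rightarrow> 'h::real_inner) \<Rightarrow> real \<Rightarrow> real \<Rightarrow> (nat \<Rightarrow> real) \<Rightarrow> 'h \<Rightarrow> real" where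
  "trunc_weight e c \<delta> l v =
     exp ((c * cavity_field e l v - c\<^sup>2 / 2 * (norm v)\<^sup>2 - \<delta> / 2 * (cavity_field e l v)\<^sup>2) / (1 - \<delta> *
         (norm v)\<^sup>2))
       / sqrt (1 - \<delta> * (norm v)\<^sup>2)"

definition overlap_moment :: "real \<Rightarrow> real \<Rightarrow> nat \<Rightarrow> (nat \<times> nat \<Rightarrow> real) \<Rightarrow> real" where
  "overlap_moment c \<delta> n q = exp (c\<^sup>2 / (2 * \<delta>)) ^ n *
     Re (\<integral>\<eta>. iexp (- (c / sqrt \<delta>) * (\<Sum>i<n. \<eta> i)) *
       complex_of_real (exp (- (\<delta> / 2) * (\<Sum>i<n. \<Sum>j\<in>{..<n} - {i}. \<eta> i * \<eta> j * q (i, j))))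
           \<partial>gauss_law)"

text \<open>Admitting \<delta> = 0 lets the same numerators and normalisations describe the true
  cavity mapping.\<close>

lemma trunc_weight_0: "trunc_weight e c 0 l v = cavity_weight e c l v"
  by (simp add: trunc_weight_def cavity_weight_def)

lemma one_minus_mult_norm_ge:
  assumes "0 \<le> \<delta>" "\<delta> \<le> 1/2" "norm v \<le> 1"
  shows "1/2 \<le> 1 - \<delta> * (norm v)\<^sup>2"
proof -
  have "\<delta> * (norm v)\<^sup>2 \<le> 1/2 * 1"
    using assms by (intro mult_mono) (auto simp: power_le_one)
  then show ?thesis by simp
qed

lemma trunc_weight_pos: "0 \<le> \<delta> \<Longrightarrow> \<delta> \<le> 1/2 \<Longrightarrow> norm v \<le> 1 \<Longrightarrow> 0 < trunc_weight e c \<delta> l v"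
  using one_minus_mult_norm_ge[of \<delta> v] by (simp add: trunc_weight_def)

text \<open>Division by \<open>1 - \<delta> * (norm v)\<^sup>2\<close>, which is at least 1/2, at
  most doubles a non-negative bound of the exponent; the prefactor is at most
  \<open>sqrt 2\<close>.\<close>

lemma trunc_weight_aux:
  assumes "0 \<le> \<delta>" "\<delta> \<le> 1/2" "norm v \<le> 1"
    and b: "c * cavity_field e l v - \<delta> / 2 * (cavity_field e l v)\<^sup>2 \<le> b" and "b \<ge> 0"
  shows "trunc_weight e c \<delta> l v \<le> sqrt 2 * exp (2 * b)"
proof -
  let ?D = "1 - \<delta> * (norm v)\<^sup>2"
  have D: "1/2 \<le> ?D" using assms(1-3) by (rule one_minus_mult_norm_ge)
  have "(c * cavity_field e l v - c\<^sup>2 / 2 * (norm v)\<^sup>2 - \<delta> / 2 * (cavity_field e l v)\<^sup>2) \<le> b"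
    using b by (smt (verit) mult_nonneg_nonneg zero_le_power2 half_gt_zero_iff divide_nonneg_pos)
  also have "b \<le> b * (2 * ?D)" using \<open>b \<ge> 0\<close> D by (intro mult_le_cancel_left1[THEN iffD2]) auto
  finally have le: "(c * cavity_field e l v - c\<^sup>2 / 2 * (norm v)\<^sup>2 - \<delta> / 2 * (cavity_field e l v)\<^sup>2) /
      ?D \<le> 2 * b"
    using D by (simp add: divide_le_eq mult_ac)
  have "1 / sqrt ?D = sqrt (1 / ?D)" by (simp add: real_sqrt_divide)
  also have "\<dots> \<le> sqrt 2" using D by (intro real_sqrt_le_mono) (simp add: divide_le_eq)
  finally have "1 / sqrt ?D \<le> sqrt 2" .
  then have "exp ((c * cavity_field e l v - c\<^sup>2 / 2 * (norm v)\<^sup>2 - \<delta> / 2 * (cavity_field e l v)\<^sup>2) /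
      ?D) * (1 / sqrt ?D)
      \<le> exp (2 * b) * sqrt 2"
    using le D by (intro mult_mono) auto
  then show ?thesis by (simp add: trunc_weight_def mult.commute)
qed

text \<open>Completing the square in the field. The bound is free of \<open>l\<close> but not
  uniform in \<delta>; it supplies the constant \<open>K\<close> of the moment argument at fixed
  truncation.\<close>

lemma trunc_weight_le:
  assumes "0 < \<delta>" "\<delta> \<le> 1/2" "norm v \<le> 1"
  shows "trunc_weight e c \<delta> l v \<le> sqrt 2 * exp (c\<^sup>2 / \<delta>)"
proof -
  let ?x = "cavity_field e l v"
  have "c * ?x - \<delta> / 2 * ?x\<^sup>2 \<le> c\<^sup>2 / (2 * \<delta>)"
  proof -
    have "0 \<le> (c - \<delta> * ?x)\<^sup>2 / (2 * \<delta>)" using assms by simp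
    also have "\<dots> = c\<^sup>2 / (2 * \<delta>) - (c * ?x - \<delta> / 2 * ?x\<^sup>2)"
      using assms by (simp add: field_simps power2_eq_square)
    finally show ?thesis by simp
  qed
  from trunc_weight_aux[OF _ _ _ this] show ?thesis using assms by simp
qed

text \<open>Uniform in \<delta>, at the price of depending on the field: the dominating function for
  the limit in which \<delta> tends to 0.\<close>

lemma trunc_weight_le_exp:
  assumes "0 \<le> \<delta>" "\<delta> \<le> 1/2" "norm v \<le> 1"
  shows "trunc_weight e c \<delta> l v \<le> sqrt 2 * exp (2 * \<bar>c\<bar> * \<bar>cavity_field e l v\<bar>)"
proof -
  let ?x = "cavity_field e l v"
  have "c * ?x \<le> \<bar>c\<bar> * \<bar>?x\<bar>" by (metis abs_ge_self abs_mult)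
  moreover have "0 \<le> \<delta> / 2 * ?x\<^sup>2" using assms by simp
  ultimately have "c * ?x - \<delta> / 2 * ?x\<^sup>2 \<le> \<bar>c\<bar> * \<bar>?x\<bar>" by linarith
  from trunc_weight_aux[OF assms this] show ?thesis by (simp add: mult.assoc)
qed

lemma trunc_weight_tendsto:
  assumes "d \<longlonglongrightarrow> 0"
  shows "(\<lambda>k. trunc_weight e c (d k) l v) \<longlonglongrightarrow> cavity_weight e c l v"
proof -
  have "(\<lambda>k. trunc_weight e c (d k) l v) \<longlonglongrightarrow> trunc_weight e c 0 l v"
    unfolding trunc_weight_def using assms by (intro tendsto_intros) auto
  then show ?thesis by (simp add: trunc_weight_0)
qed

lemma nn_integral_exp_square_std_normal_finite:
  assumes "b < 1"
  shows "(\<integral>\<^sup>+s. ennreal (exp (b * s\<^sup>2 / 2)) \<partial>std_normal_distribution) < \<infinity>"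
proof -
  have i: "integrable lborel (\<lambda>s. std_normal_density s * exp (b * s\<^sup>2 / 2))"
    using std_normal_density_times_exp_square[of "1 - b"] assms by simp
  have "(\<integral>\<^sup>+s. ennreal (exp (b * s\<^sup>2 / 2)) \<partial>std_normal_distribution)
      = (\<integral>\<^sup>+s. ennreal (std_normal_density s * exp (b * s\<^sup>2 / 2)) \<partial>lborel)"
    by (subst nn_integral_density) (auto simp: ennreal_mult')
  also have "\<dots> = ennreal (\<integral>s. std_normal_density s * exp (b * s\<^sup>2 / 2) \<partial>lborel)"
    using i by (rule nn_integral_eq_integral) auto
  finally show ?thesis by simp
qed

text \<open>The diagonal is split off because \<open>gram_matrix\<close> records inner products only
  outside of it.\<close>

lemma norm_sum_scaleR_square:
  fixes v :: "nat \<Rightarrow> 'h::real_inner"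
  shows "(norm (\<Sum>i<n. a i *\<^sub>R v i))\<^sup>2
    = (\<Sum>i<n. (a i)\<^sup>2 * (norm (v i))\<^sup>2) + (\<Sum>i<n. \<Sum>j\<in>{..<n} - {i}. a i * a j * (v i \<bullet> v j))"
proof -
  have "(norm (\<Sum>i<n. a i *\<^sub>R v i))\<^sup>2 = (\<Sum>i<n. \<Sum>j<n. a i * a j * (v i \<bullet> v j))"
    unfolding power2_norm_eq_inner
    by (simp add: inner_sum_left inner_sum_right sum_distrib_left mult.assoc inner_commute
        mult.left_commute)
  also have "\<dots> = (\<Sum>i<n. (a i)\<^sup>2 * (norm (v i))\<^sup>2 + (\<Sum>j\<in>{..<n} - {i}. a i * a j * (v i \<bullet> v j)))"
    by (intro sum.cong refl) (auto simp: sum.remove power2_eq_square power2_norm_eq_inner[unfolded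
        power2_eq_square])
  finally show ?thesis by (simp add: sum.distrib)
qed

context
  fixes e :: "nat \<Rightarrow> 'h::{real_inner, banach, second_countable_topology}"
  assumes onb: "orthonormal_basis e"
begin

text \<open>Linearises the quadratic term of the field by an auxiliary Gaussian, written as
  \<open>sqrt \<delta>\<close> times a standard one. The shift by \<open>c / \<delta>\<close>
  produces the linear term, and the prefactor compensates the constant left by the square.\<close>

lemma trunc_weight_eq_integral:
  assumes \<delta>: "0 < \<delta>" "\<delta> < 1" and v: "norm v \<le> 1"
  shows "complex_of_real (trunc_weight e c \<delta> l v) = complex_of_real (exp (c\<^sup>2 / (2 * \<delta>))) *
    (\<integral>s. iexp (sqrt \<delta> * (cavity_field e l v - c / \<delta>) * s) * complex_of_real (exp (\<delta> * (norm v)\<^sup>2 * s\<^sup>2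
        / 2)) \<partial>std_normal_distribution)"
proof -
  define x where "x = cavity_field e l v"
  define D where "D = 1 - \<delta> * (norm v)\<^sup>2"
  have "\<delta> * (norm v)\<^sup>2 \<le> \<delta> * 1" using assms by (intro mult_left_mono) (auto simp: power_le_one)
  then have D: "D > 0" using \<delta> unfolding D_def by linarith
  have nv: "\<delta> * (norm v)\<^sup>2 = 1 - D" by (simp add: D_def)
  have nv': "(norm v)\<^sup>2 = (1 - D) / \<delta>" using \<delta> by (simp add: D_def)
  have "c\<^sup>2 / (2 * \<delta>) + - (sqrt \<delta> * (x - c / \<delta>))\<^sup>2 / (2 * D)
      = (c * x - c\<^sup>2 / 2 * (norm v)\<^sup>2 - \<delta> / 2 * x\<^sup>2) / D"
    using \<delta> D unfolding nv' by (simp add: power_mult_distrib power2_diff power_divide field_simps)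
        (simp add: power2_eq_square algebra_simps)
  then have "exp (c\<^sup>2 / (2 * \<delta>)) * (exp (- (sqrt \<delta> * (x - c / \<delta>))\<^sup>2 / (2 * D)) / sqrt D)
      = trunc_weight e c \<delta> l v"
    by (simp add: trunc_weight_def x_def[symmetric] D_def[symmetric] exp_add[symmetric])
  then show ?thesis
    unfolding nv x_def[symmetric] integral_iexp_times_exp_square_std_normal[OF D, of "sqrt \<delta> * (x -
        c / \<delta>)"]
    by (simp only: of_real_mult[symmetric])
qed

text \<open>With one auxiliary Gaussian per vector the integrand becomes an exponential that is
  linear in the field. After Fubini the mean over \<open>l\<close> is the exponential of minus half
  the squared norm of a random combination of the \<open>v i\<close>.\<close>

lemma integral_prod_trunc_weight:
  fixes v :: "nat \<Rightarrow> 'h"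
  assumes \<delta>: "0 < \<delta>" "\<delta> < 1" and v: "\<And>i. norm (v i) \<le> 1"
  shows "(\<integral>l. (\<Prod>i<n. trunc_weight e c \<delta> l (v i)) \<partial>gauss_law) = overlap_moment c \<delta> n (gram_matrix v)"
proof -
  let ?W = "\<lambda>l. \<Prod>i<n. trunc_weight e c \<delta> l (v i)"
  let ?K = "complex_of_real (exp (c\<^sup>2 / (2 * \<delta>)) ^ n)"
  let ?phase = "\<lambda>\<eta>. iexp (- (c / sqrt \<delta>) * (\<Sum>i<n. \<eta> i))"
  let ?ov = "\<lambda>\<eta>. exp (- (\<delta> / 2) * (\<Sum>i<n. \<Sum>j\<in>{..<n} - {i}. \<eta> i * \<eta> j * gram_matrix v (i, j)))"
  let ?nm = "\<lambda>\<eta>. exp (- (norm (\<Sum>i<n. (sqrt \<delta> * \<eta> i) *\<^sub>R v i))\<^sup>2 / 2)"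
  let ?field = "\<lambda>\<eta> l. iexp (\<Sum>i<n. (sqrt \<delta> * \<eta> i) * cavity_field e l (v i))"
  interpret G: prob_space gauss_law by (rule prob_space_gauss_law)
  interpret GG: pair_sigma_finite gauss_law gauss_law ..
  interpret N: product_prob_space "\<lambda>_::nat. std_normal_distribution" UNIV
      by (rule product_prob_space_gauss)
  note measurable_gauss_law_component [measurable] measurable_cavity_field[OF onb, measurable]
  define h where "h = (\<lambda>l i s. iexp (sqrt \<delta> * (cavity_field e l (v i) - c / \<delta>) * s) *
    complex_of_real (exp (\<delta> * (norm (v i))\<^sup>2 * s\<^sup>2 / 2)))"
  define E where "E = (\<lambda>i s::real. exp (\<delta> * (norm (v i))\<^sup>2 * s\<^sup>2 / 2))"
  have nh: "norm (h l i s) = E i s" for l i s by (simp add: h_def E_def norm_mult)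
  have v2: "\<delta> * (norm (v i))\<^sup>2 < 1" for i
  proof -
    have "\<delta> * (norm (v i))\<^sup>2 \<le> \<delta> * 1" using \<delta> v by (intro mult_left_mono) (auto simp: power_le_one)
    then show ?thesis using \<delta> by linarith
  qed
  \<comment> \<open>The modulus of \<open>h\<close> does not depend on \<open>l\<close>, and its
    Gaussian mean is finite because \<open>\<delta> * (norm (v i))\<^sup>2 < 1\<close>. This is what
    permits Fubini.\<close>
  have Efin: "(\<integral>\<^sup>+s. ennreal (E i s) \<partial>std_normal_distribution) < \<infinity>" for i
    unfolding E_def using v2 by (intro nn_integral_exp_square_std_normal_finite)
  have ih: "integrable std_normal_distribution (h l i)" for l i
  proof (rule integrableI_bounded)
    show "h l i \<in> borel_measurable std_normal_distribution" by (simp add: h_def)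
    show "(\<integral>\<^sup>+x. ennreal (norm (h l i x)) \<partial>std_normal_distribution) < \<infinity>" using Efin nh by simp
  qed
  have tw: "complex_of_real (?W l) = ?K * (\<integral>\<eta>. (\<Prod>i<n. h l i (\<eta> i)) \<partial>gauss_law)" for l
  proof -
    have "complex_of_real (?W l)
       = (\<Prod>i<n. complex_of_real (exp (c\<^sup>2 / (2 * \<delta>))) * (\<integral>s. h l i s \<partial>std_normal_distribution))"
      unfolding of_real_prod h_def by (intro prod.cong refl trunc_weight_eq_integral[OF \<delta> v])
    also have "\<dots> = ?K * (\<Prod>i<n. (\<integral>s. h l i s \<partial>std_normal_distribution))"
      by (simp only: prod.distrib prod_constant card_lessThan of_real_power)
    also have "(\<Prod>i<n. (\<integral>s. h l i s \<partial>std_normal_distribution)) = (\<integral>\<eta>. (\<Prod>i<n. h l i (\<eta> i))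
        \<partial>gauss_law)"
      unfolding gauss_law_def using ih by (subst N.integral_PiM_prod) auto
    finally show ?thesis .
  qed
  have hm: "(\<lambda>p. \<Prod>i<n. h (fst p) i (snd p i)) \<in> borel_measurable (gauss_law \<Otimes>\<^sub>M gauss_law)"
    unfolding h_def by measurable
  have hint: "integrable (gauss_law \<Otimes>\<^sub>M gauss_law) (\<lambda>(l, \<eta>). \<Prod>i<n. h l i (\<eta> i))"
  proof (rule integrableI_bounded)
    show "(\<lambda>(l, \<eta>). \<Prod>i<n. h l i (\<eta> i)) \<in> borel_measurable (gauss_law \<Otimes>\<^sub>M gauss_law)"
      using hm by (simp add: case_prod_beta)
    have [measurable]: "(\<lambda>s. E i s) \<in> borel_measurable borel" for i unfolding E_def by measurable
    have "(\<integral>\<^sup>+p. ennreal (norm (case p of (l, \<eta>) \<Rightarrow> \<Prod>i<n. h l i (\<eta> i))) \<partial>(gauss_law \<Otimes>\<^sub>M gauss_law))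
       = (\<integral>\<^sup>+p. (\<Prod>i<n. ennreal (E i (snd p i))) \<partial>(gauss_law \<Otimes>\<^sub>M gauss_law))"
      by (intro nn_integral_cong) (auto simp: nh prod_norm[symmetric] prod_ennreal E_def)
    also have "\<dots> = (\<integral>\<^sup>+l. \<integral>\<^sup>+\<eta>. (\<Prod>i<n. ennreal (E i (\<eta> i))) \<partial>gauss_law \<partial>gauss_law)"
      by (subst G.nn_integral_fst[symmetric]) auto
    also have "\<dots> = (\<integral>\<^sup>+l. (\<Prod>i<n. \<integral>\<^sup>+s. ennreal (E i s) \<partial>std_normal_distribution) \<partial>gauss_law)"
      by (intro nn_integral_cong) (unfold gauss_law_def, subst N.nn_integral_PiM_prod, auto)
    also have "\<dots> < \<infinity>" using Efin by (simp add: G.emeasure_space_1 space_gauss_law[symmetric]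
        ennreal_prod_eq_top less_top[symmetric] del: space_gauss_law)
    finally show "(\<integral>\<^sup>+p. ennreal (norm (case p of (l, \<eta>) \<Rightarrow> \<Prod>i<n. h l i (\<eta> i)))
        \<partial>(gauss_law \<Otimes>\<^sub>M gauss_law)) < \<infinity>" .
  qed
  have inner: "(\<integral>l. (\<Prod>i<n. h l i (\<eta> i)) \<partial>gauss_law) = ?phase \<eta> *
       complex_of_real (?ov \<eta>)" for \<eta>
  proof -
    let ?E = "complex_of_real (\<Prod>i<n. E i (\<eta> i)) * ?phase \<eta>"
    have "(\<Prod>i<n. h l i (\<eta> i)) = ?E * ?field \<eta> l" for l
    proof -
      have "h l i (\<eta> i) = complex_of_real (E i (\<eta> i)) * iexp (- (c / sqrt \<delta>) * \<eta> i) * iexp ((sqrt \<delta>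
          * \<eta> i) * cavity_field e l (v i))" for i
      proof -
        have "sqrt \<delta> * (cavity_field e l (v i) - c / \<delta>) * \<eta> i
            = - (c / sqrt \<delta>) * \<eta> i + (sqrt \<delta> * \<eta> i) * cavity_field e l (v i)"
        proof -
          have "sqrt \<delta> * (c / \<delta>) = c / sqrt \<delta>" using \<delta> by (simp add: field_simps)
          then show ?thesis by (simp add: algebra_simps)
        qed
        then have "iexp (sqrt \<delta> * (cavity_field e l (v i) - c / \<delta>) * \<eta> i)
            = iexp (- (c / sqrt \<delta>) * \<eta> i) * iexp ((sqrt \<delta> * \<eta> i) * cavity_field e l (v i))"
          by (simp only: of_real_add distrib_left exp_add)
        then show ?thesis unfolding h_def E_def by (simp only: mult_ac)
      qed
      then have "(\<Prod>i<n. h l i (\<eta> i)) = (\<Prod>i<n. complex_of_real (E i (\<eta> i))) * (\<Prod>i<n. iexp (- (c /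
          sqrt \<delta>) * \<eta> i)) * (\<Prod>i<n. iexp ((sqrt \<delta> * \<eta> i) * cavity_field e l (v i)))"
        by (simp only: prod.distrib)
      also have "(\<Prod>i<n. iexp (- (c / sqrt \<delta>) * \<eta> i)) = ?phase \<eta>"
        by (simp only: exp_sum[symmetric] finite_lessThan of_real_sum sum_distrib_left)
      also have "(\<Prod>i<n. iexp ((sqrt \<delta> * \<eta> i) * cavity_field e l (v i))) = ?field \<eta> l"
        by (simp only: exp_sum[symmetric] finite_lessThan of_real_sum sum_distrib_left)
      finally show ?thesis by (simp only: of_real_prod)
    qed
    then have "(\<integral>l. (\<Prod>i<n. h l i (\<eta> i)) \<partial>gauss_law) = (\<integral>l. ?E * ?field \<eta> l \<partial>gauss_law)"
      by (simp only:)
    also have "\<dots> = ?E * (\<integral>l. ?field \<eta> l \<partial>gauss_law)"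
      by (rule integral_mult_right_zero)
    also have "(\<integral>l. ?field \<eta> l \<partial>gauss_law) = ?nm \<eta>"
      by (rule integral_iexp_sum_cavity_field[OF onb]) simp
    also have "?E * ?nm \<eta> = ?phase \<eta> *
        complex_of_real ((\<Prod>i<n. E i (\<eta> i)) * ?nm \<eta>)"
      by (simp only: of_real_mult mult_ac)
    \<comment> \<open>The diagonal part of the squared norm cancels against the factors
      \<open>E i\<close>; only off-diagonal overlaps are left.\<close>
    also have "(\<Prod>i<n. E i (\<eta> i)) * ?nm \<eta>
        = ?ov \<eta>"
    proof -
      have g: "(\<Sum>i<n. \<Sum>j\<in>{..<n} - {i}. (sqrt \<delta> * \<eta> i) * (sqrt \<delta> * \<eta> j) * (v i \<bullet> v j))
          = \<delta> * (\<Sum>i<n. \<Sum>j\<in>{..<n} - {i}. \<eta> i * \<eta> j * gram_matrix v (i, j))"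
        unfolding sum_distrib_left
      proof (intro sum.cong refl)
        fix i j assume "j \<in> {..<n} - {i}"
        have "sqrt \<delta> * sqrt \<delta> = \<delta>" using \<delta> by simp
        moreover have "(sqrt \<delta> * \<eta> i) * (sqrt \<delta> * \<eta> j) * (v i \<bullet> v j)
            = (sqrt \<delta> * sqrt \<delta>) * (\<eta> i * \<eta> j * (v i \<bullet> v j))"
          by (simp only: mult_ac)
        moreover have "v i \<bullet> v j = gram_matrix v (i, j)"
          using \<open>j \<in> {..<n} - {i}\<close> by (simp add: gram_matrix_def)
        ultimately show "(sqrt \<delta> * \<eta> i) * (sqrt \<delta> * \<eta> j) * (v i \<bullet> v j)
            = \<delta> * (\<eta> i * \<eta> j * gram_matrix v (i, j))"
          by (simp only:)
      qed
      have "(\<Prod>i<n. E i (\<eta> i)) = exp (\<Sum>i<n. (sqrt \<delta> * \<eta> i)\<^sup>2 * (norm (v i))\<^sup>2 / 2)"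
        unfolding E_def exp_sum[OF finite_lessThan, symmetric] using \<delta>
        by (intro arg_cong[where f = exp] sum.cong refl) (simp add: power_mult_distrib mult_ac)
      then show ?thesis
        unfolding norm_sum_scaleR_square g by (simp add: exp_add[symmetric]
            sum_divide_distrib[symmetric])
          (simp add: field_simps)
    qed
    finally show ?thesis .
  qed
  have "complex_of_real (\<integral>l. (?W l) \<partial>gauss_law)
     = (\<integral>l. complex_of_real (?W l) \<partial>gauss_law)"
    by (rule integral_complex_of_real[symmetric])
  also have "\<dots> = (\<integral>l. ?K * (\<integral>\<eta>. (\<Prod>i<n. h l i (\<eta> i)) \<partial>gauss_law) \<partial>gauss_law)"
    unfolding tw ..
  also have "\<dots> = ?K * (\<integral>l. (\<integral>\<eta>. (\<Prod>i<n. h l i (\<eta> i)) \<partial>gauss_law) \<partial>gauss_law)"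
    by (rule integral_mult_right_zero)
  also have "(\<integral>l. (\<integral>\<eta>. (\<Prod>i<n. h l i (\<eta> i)) \<partial>gauss_law) \<partial>gauss_law) = (\<integral>\<eta>. (\<integral>l. (\<Prod>i<n. h l i (\<eta> i))
      \<partial>gauss_law) \<partial>gauss_law)"
    by (rule GG.Fubini_integral[OF hint, symmetric])
  finally have "complex_of_real (\<integral>l. (?W l) \<partial>gauss_law) =
     ?K * (\<integral>\<eta>. ?phase \<eta> *
       complex_of_real (?ov \<eta>) \<partial>gauss_law)"
    unfolding inner .
  from arg_cong[OF this, of Re] show ?thesis
    unfolding overlap_moment_def by (simp only: Re_complex_of_real times_complex.sel(1)
        Im_complex_of_real)
qed

end

lemma measurable_overlap_moment: "overlap_moment c \<delta> n \<in> borel_measurable matrix_space"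
proof -
  interpret G: prob_space gauss_law by (rule prob_space_gauss_law)
  note measurable_gauss_law_component [measurable]
  have [measurable]: "(\<lambda>q. q p) \<in> borel_measurable matrix_space" for p
    unfolding matrix_space_def by measurable
  show ?thesis
    unfolding overlap_moment_def by measurable
qed

section \<open>Weighted sample averages and their moments\<close>

definition sample_numerator ::
    "(nat \<Rightarrow> 'h::real_inner) \<Rightarrow> real \<Rightarrow> real \<Rightarrow> nat \<Rightarrow> (nat \<times> nat \<Rightarrow> real) set \<Rightarrow> 'h measure \<Rightarrow> (nat \<Rightarrow> real)
        \<Rightarrow> ennreal"
  where "sample_numerator e c \<delta> N C m l =
    (\<integral>\<^sup>+v. indicator C (gram_matrix v) * (\<Prod>i<N. ennreal (trunc_weight e c \<delta> l (v i))) \<partial>iid m)"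

text \<open>At \<delta> = 0, if this normalisation is finite and \<open>C\<close> depends on the
  first \<open>N\<close> samples, \<open>sample_numerator\<close> divided by its N-th power is the
  probability of \<open>C\<close> under the tilted sample.\<close>

definition sample_denominator ::
    "(nat \<Rightarrow> 'h::real_inner) \<Rightarrow> real \<Rightarrow> real \<Rightarrow> 'h measure \<Rightarrow> (nat \<Rightarrow> real) \<Rightarrow> ennreal"
  where "sample_denominator e c \<delta> m l = (\<integral>\<^sup>+v. ennreal (trunc_weight e c \<delta> l v) \<partial>m)"

lemma measurable_gram_matrix_unit_ball:
  "gram_matrix \<in> iid (unit_ball :: 'h::{real_inner, banach, second_countable_topology} measure) \<rightarrow>\<^sub>M
      matrix_space"
  by (rule measurable_gram_matrix) simp

lemma norm_le_1_iid:
  assumes "m \<in> space (prob_algebra unit_ball)" "v \<in> space (iid m)"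
  shows "norm (v i) \<le> 1"
  using assms(2) sets_unit_ball_space(3)[OF assms(1)] by (auto simp: space_PiM PiE_iff)

lemma sets_iid_unit_ball:
  "m \<in> space (prob_algebra (unit_ball :: 'h::{real_inner, banach, second_countable_topology}
      measure)) \<Longrightarrow> sets (iid m) = sets (iid (unit_ball :: 'h measure))"
  using sets_unit_ball_space(1) by (intro sets_PiM_cong) auto

lemma measurable_indicator_gram_matrix:
  assumes "m \<in> space (prob_algebra (unit_ball :: 'h::{real_inner, banach, second_countable_topology}
      measure))" "C \<in> sets matrix_space"
  shows "(\<lambda>v. indicator C (gram_matrix v) :: ennreal) \<in> borel_measurable (iid m)"
proof -
  note assms(2)[measurable]
  note measurable_gram_matrix[OF sets_unit_ball_space(1)[OF assms(1)], measurable]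
  show ?thesis by measurable
qed

context
  fixes e :: "nat \<Rightarrow> 'h::{real_inner, banach, second_countable_topology}"
  assumes onb: "orthonormal_basis e"
begin

lemma measurable_trunc_weight:
  "(\<lambda>p. trunc_weight e c \<delta> (fst p) (snd p)) \<in> borel_measurable (gauss_law \<Otimes>\<^sub>M unit_ball)"
proof -
  have [measurable]: "(\<lambda>v. v) \<in> borel_measurable (unit_ball :: 'h measure)"
    by (rule measurable_ident_unit_ball)
  note measurable_cavity_field_pair[OF onb, measurable]
  show ?thesis unfolding trunc_weight_def by measurable
qed

lemma measurable_trunc_weight_compose:
  assumes "f \<in> X \<rightarrow>\<^sub>M gauss_law" "g \<in> X \<rightarrow>\<^sub>M unit_ball"
  shows "(\<lambda>x. trunc_weight e c \<delta> (f x) (g x)) \<in> borel_measurable X"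
  using measurable_compose[OF measurable_Pair[OF assms] measurable_trunc_weight[of c \<delta>]] by simp

lemma measurable_sample_denominator:
  "(\<lambda>p. sample_denominator e c \<delta> (fst p) (snd p))
      \<in> borel_measurable (prob_algebra unit_ball \<Otimes>\<^sub>M gauss_law)"
  unfolding sample_denominator_def
proof (rule nn_integral_measurable_subprob_algebra2)
  show "(\<lambda>p. fst p) \<in> prob_algebra unit_ball \<Otimes>\<^sub>M gauss_law \<rightarrow>\<^sub>M subprob_algebra (unit_ball :: 'h
      measure)"
    by (rule measurable_compose[OF measurable_fst]) (simp add: measurable_prob_algebraD)
  show "(\<lambda>(x, y). ennreal (trunc_weight e c \<delta> (snd x) y))
      \<in> borel_measurable ((prob_algebra unit_ball \<Otimes>\<^sub>M gauss_law) \<Otimes>\<^sub>M unit_ball)"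
    unfolding case_prod_beta by (intro measurable_compose[OF _ measurable_ennreal]
        measurable_trunc_weight_compose) auto
qed

lemma measurable_sample_numerator:
  assumes [measurable]: "C \<in> sets matrix_space"
  shows "(\<lambda>p. sample_numerator e c \<delta> N C (fst p) (snd p))
      \<in> borel_measurable (prob_algebra unit_ball \<Otimes>\<^sub>M gauss_law)"
  unfolding sample_numerator_def
proof (rule nn_integral_measurable_subprob_algebra2)
  show "(\<lambda>p. iid (fst p)) \<in> prob_algebra unit_ball \<Otimes>\<^sub>M gauss_law \<rightarrow>\<^sub>M subprob_algebra (iid (unit_ball
      :: 'h measure))"
    by (rule measurable_prob_algebraD, rule measurable_compose[OF measurable_fst measurable_iid])
  note measurable_gram_matrix_unit_ball[measurable]
  have [measurable]: "(\<lambda>x. trunc_weight e c \<delta> (snd (fst x)) (snd x i))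
      \<in> borel_measurable ((prob_algebra unit_ball \<Otimes>\<^sub>M gauss_law) \<Otimes>\<^sub>M iid unit_ball)" for i
    by (rule measurable_trunc_weight_compose) measurable
  show "(\<lambda>(x, y). indicator C (gram_matrix y) * (\<Prod>i<N. ennreal (trunc_weight e c \<delta> (snd x) (y i))))
    \<in> borel_measurable ((prob_algebra unit_ball \<Otimes>\<^sub>M gauss_law) \<Otimes>\<^sub>M iid (unit_ball :: 'h measure))"
    unfolding case_prod_beta by measurable
qed

lemma measurable_trunc_weight_fixed:
  assumes "m \<in> space (prob_algebra unit_ball)"
  shows "(\<lambda>v. trunc_weight e c \<delta> l v) \<in> borel_measurable m"
proof -
  have "(\<lambda>v. trunc_weight e c \<delta> l v) \<in> borel_measurable unit_ball"
    by (rule measurable_trunc_weight_compose) auto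
  then show ?thesis using sets_unit_ball_space(1)[OF assms] by (simp cong: measurable_cong_sets)
qed

text \<open>Each factor of the normalisation is one more independent sample, with its own weight,
  that \<open>C\<close> does not see.\<close>

lemma sample_numerator_times_denominator:
  assumes m: "m \<in> space (prob_algebra unit_ball)" and C: "C \<in> sets matrix_space"
    and dep: "depends_on_first N (\<lambda>v::nat \<Rightarrow> 'h. gram_matrix v \<in> C)"
  shows "sample_numerator e c \<delta> N C m l * sample_denominator e c \<delta> m l ^ k =
    (\<integral>\<^sup>+v. indicator C (gram_matrix v) * (\<Prod>i<N+k. ennreal (trunc_weight e c \<delta> l (v i))) \<partial>iid m)"
proof -
  let ?t = "\<lambda>v. ennreal (trunc_weight e c \<delta> l v)"
  let ?f = "\<lambda>v. indicator C (gram_matrix v) * (\<Prod>i<N. ?t (v i))"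
  note measurable_trunc_weight_fixed[OF m, measurable] measurable_indicator_gram_matrix[OF m C,
      measurable]
  have "(\<integral>\<^sup>+v. ?f v * (\<Prod>i<k. ?t (v (N + i))) \<partial>iid m) = (\<integral>\<^sup>+v. ?f v \<partial>iid m) * (integral\<^sup>N m ?t) ^ k"
  proof (rule nn_integral_iid_mult_prod[OF sets_unit_ball_space(2)[OF m]])
    show "depends_on_first N ?f"
      unfolding depends_on_first_def
    proof (intro allI impI)
      fix v v' :: "nat \<Rightarrow> 'h" assume eq: "\<forall>i<N. v i = v' i"
      then have "gram_matrix v \<in> C \<longleftrightarrow> gram_matrix v' \<in> C" using depends_on_firstD[OF dep] by blast
      then show "?f v = ?f v'" using eq by (auto simp: indicator_def)
    qed
  qed measurable
  moreover have "(\<Prod>i<N. ?t (v i)) * (\<Prod>i<k. ?t (v (N + i))) = (\<Prod>i<N+k. ?t (v i))" for v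
    by (induction k) (auto simp: mult.assoc[symmetric])
  ultimately show ?thesis
    by (simp add: sample_numerator_def sample_denominator_def mult.assoc)
qed

text \<open>Averaging over the field eliminates the weights in favour of
  \<open>overlap_moment\<close>. The result depends on \<open>m\<close> only through
  \<open>gram_law m\<close>, although the integrand involves the norms.\<close>

lemma nn_integral_sample_numerator_times_denominator:
  assumes \<delta>: "0 < \<delta>" "\<delta> \<le> 1/2"
    and m: "m \<in> space (prob_algebra unit_ball)" and C: "C \<in> sets matrix_space"
    and dep: "depends_on_first N (\<lambda>v::nat \<Rightarrow> 'h. gram_matrix v \<in> C)"
  shows "(\<integral>\<^sup>+l. sample_numerator e c \<delta> N C m l * sample_denominator e c \<delta> m l ^ k \<partial>gauss_law)
    = (\<integral>\<^sup>+q. indicator C q * ennreal (overlap_moment c \<delta> (N + k) q) \<partial>gram_law m)"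
proof -
  let ?w = "\<lambda>l v. \<Prod>i<N+k. trunc_weight e c \<delta> l (v i)"
  let ?B = "(sqrt 2 * exp (c\<^sup>2 / \<delta>)) ^ (N + k)"
  let ?g = "\<lambda>q. ennreal (overlap_moment c \<delta> (N + k) q)"
  let ?t = "\<lambda>l v. ennreal (trunc_weight e c \<delta> l v)"
  interpret G: prob_space gauss_law by (rule prob_space_gauss_law)
  interpret I: prob_space "iid m" by (intro prob_space_PiM sets_unit_ball_space(2)[OF m])
  interpret IG: pair_sigma_finite gauss_law "iid m" ..
  have pos: "0 < trunc_weight e c \<delta> l w" "trunc_weight e c \<delta> l w \<le> sqrt 2 * exp (c\<^sup>2 / \<delta>)"
      if "norm w \<le> 1" for l w
    using \<delta> that by (auto intro: trunc_weight_pos trunc_weight_le)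
  have tm[measurable]: "(\<lambda>x. trunc_weight e c \<delta> (fst x) (snd x i))
      \<in> borel_measurable (gauss_law \<Otimes>\<^sub>M iid m)" for i
  proof -
    have "(\<lambda>x. trunc_weight e c \<delta> (fst x) (snd x i))
        \<in> borel_measurable (gauss_law \<Otimes>\<^sub>M iid unit_ball)"
      by (rule measurable_trunc_weight_compose) measurable
    moreover have "sets (gauss_law \<Otimes>\<^sub>M iid m) = sets (gauss_law \<Otimes>\<^sub>M iid (unit_ball :: 'h measure))"
      by (intro sets_pair_measure_cong refl sets_iid_unit_ball[OF m])
    ultimately show ?thesis by (simp cong: measurable_cong_sets)
  qed
  have tl[measurable]: "(\<lambda>l. trunc_weight e c \<delta> l v) \<in> borel_measurable gauss_law" if "norm v \<le> 1"
      for v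
    by (rule measurable_trunc_weight_compose) (use that in \<open>auto simp: unit_ball_def
        space_restrict_space\<close>)
  note measurable_indicator_gram_matrix[OF m C, measurable]
  have "(\<integral>\<^sup>+l. sample_numerator e c \<delta> N C m l * sample_denominator e c \<delta> m l ^ k \<partial>gauss_law)
     = (\<integral>\<^sup>+l. \<integral>\<^sup>+v. indicator C (gram_matrix v) * (\<Prod>i<N+k. ?t l (v i)) \<partial>iid m \<partial>gauss_law)"
    using sample_numerator_times_denominator[OF m C dep] by simp
  also have "\<dots> = (\<integral>\<^sup>+v. \<integral>\<^sup>+l. indicator C (gram_matrix v) * (\<Prod>i<N+k. ?t l (v i)) \<partial>gauss_law \<partial>iid m)"
    by (rule IG.Fubini'[symmetric]) (simp add: case_prod_beta)
  also have "\<dots> = (\<integral>\<^sup>+v. indicator C (gram_matrix v) * ?g (gram_matrix v) \<partial>iid m)"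
  proof (rule nn_integral_cong)
    fix v assume "v \<in> space (iid m)"
    then have v: "norm (v i) \<le> 1" for i using norm_le_1_iid[OF m] by blast
    \<comment> \<open>The deterministic bound on the weights lets the non-negative integral be
      evaluated as the real one of \<open>integral_prod_trunc_weight\<close>.\<close>
    have "integrable gauss_law (\<lambda>l. ?w l v)"
    proof (rule G.integrable_const_bound[where B = "?B"])
      show "AE l in gauss_law. norm (?w l v) \<le> ?B"
      proof (rule AE_I2)
        fix l
        have "norm (?w l v) = (?w l v)"
          using pos v by (simp add: abs_prod abs_of_pos)
        also have "\<dots> \<le> (\<Prod>i<N+k. sqrt 2 * exp (c\<^sup>2 / \<delta>))"
          using pos v by (intro prod_mono) (auto intro: less_imp_le)
        finally show "norm (?w l v) \<le> ?B" by simp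
      qed
    qed (use tl v in measurable)
    then have "(\<integral>\<^sup>+l. ennreal (?w l v) \<partial>gauss_law)
        = ennreal (\<integral>l. (?w l v) \<partial>gauss_law)"
      using pos v by (intro nn_integral_eq_integral) (auto intro!: AE_I2 prod_pos less_imp_le)
    also have "\<dots> = ?g (gram_matrix v)"
      using integral_prod_trunc_weight[OF onb _ _ v, of \<delta>] \<delta> by simp
    finally have "(\<integral>\<^sup>+l. (\<Prod>i<N+k. ?t l (v i)) \<partial>gauss_law) = ?g (gram_matrix v)"
      using pos v by (subst prod_ennreal) (auto intro!: less_imp_le)
    then show "(\<integral>\<^sup>+l. indicator C (gram_matrix v) * (\<Prod>i<N+k. ?t l (v i)) \<partial>gauss_law)
        = indicator C (gram_matrix v) * ?g (gram_matrix v)"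
      using tl v by (subst nn_integral_cmult) auto
  qed
  also have "\<dots> = (\<integral>\<^sup>+q. indicator C q * ?g q \<partial>gram_law m)"
    unfolding gram_law_def
    using measurable_overlap_moment[of c \<delta> "N+k"] C
    by (subst nn_integral_distr[OF measurable_gram_matrix[OF sets_unit_ball_space(1)[OF m]]]) auto
  finally show ?thesis .
qed

lemma sample_denominator_pos:
  assumes \<delta>: "0 \<le> \<delta>" "\<delta> \<le> 1/2" and m: "m \<in> space (prob_algebra unit_ball)"
  shows "0 < sample_denominator e c \<delta> m l"
proof -
  interpret prob_space m by (rule sets_unit_ball_space(2)[OF m])
  have pos: "0 < trunc_weight e c \<delta> l w" if "w \<in> space m" for w
    using \<delta> that sets_unit_ball_space(3)[OF m] by (intro trunc_weight_pos) auto
  note measurable_trunc_weight_fixed[OF m, measurable]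
  have "sample_denominator e c \<delta> m l \<noteq> 0"
  proof
    assume "sample_denominator e c \<delta> m l = 0"
    then have "AE v in m. ennreal (trunc_weight e c \<delta> l v) = 0"
      unfolding sample_denominator_def by (subst (asm) nn_integral_0_iff_AE) measurable
    moreover have "AE v in m. 0 < trunc_weight e c \<delta> l v" using pos by (intro AE_I2) auto
    ultimately have "AE v in m. False" by eventually_elim auto
    then show False by simp
  qed
  then show ?thesis by (simp add: zero_less_iff_neq_zero)
qed

lemma sample_denominator_le:
  assumes \<delta>: "0 < \<delta>" "\<delta> \<le> 1/2" and m: "m \<in> space (prob_algebra unit_ball)"
  shows "sample_denominator e c \<delta> m l \<le> ennreal (sqrt 2 * exp (c\<^sup>2 / \<delta>))"
proof -
  interpret prob_space m by (rule sets_unit_ball_space(2)[OF m])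
  have "sample_denominator e c \<delta> m l \<le> (\<integral>\<^sup>+v. ennreal (sqrt 2 * exp (c\<^sup>2 / \<delta>)) \<partial>m)"
    unfolding sample_denominator_def using \<delta> sets_unit_ball_space(3)[OF m]
    by (intro nn_integral_mono ennreal_leI trunc_weight_le) auto
  then show ?thesis by (simp add: emeasure_space_1)
qed

text \<open>Dropping the indicator leaves a product of independent factors. This is the inequality
  that keeps the ratio at most 1.\<close>

lemma sample_numerator_le:
  assumes m: "m \<in> space (prob_algebra unit_ball)"
  shows "sample_numerator e c \<delta> N C m l \<le> sample_denominator e c \<delta> m l ^ N"
proof -
  interpret sequence_space m by (rule sequence_space_prob_space[OF sets_unit_ball_space(2)[OF m]])
  note measurable_trunc_weight_fixed[OF m, measurable]
  have "sample_numerator e c \<delta> N C m l \<le> (\<integral>\<^sup>+v. (\<Prod>i<N. ennreal (trunc_weight e c \<delta> l (v i))) \<partial>iid m)"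
    unfolding sample_numerator_def by (intro nn_integral_mono) (simp add: indicator_def)
  also have "\<dots> = sample_denominator e c \<delta> m l ^ N"
    unfolding sample_denominator_def by (subst nn_integral_PiM_prod) auto
  finally show ?thesis .
qed

end

section \<open>Independence of the choice of the sampling measure\<close>

definition sample_ratio ::
    "(nat \<Rightarrow> 'h::real_inner) \<Rightarrow> real \<Rightarrow> real \<Rightarrow> nat \<Rightarrow> (nat \<times> nat \<Rightarrow> real) set \<Rightarrow> 'h measure \<Rightarrow> (nat \<Rightarrow> real)
        \<Rightarrow> real"
  where "sample_ratio e c \<delta> N C m l =
    enn2real (sample_numerator e c \<delta> N C m l) / enn2real (sample_denominator e c \<delta> m l) ^ N"

lemma measurable_cavity_fst_snd:
  fixes e :: "nat \<Rightarrow> 'h::{real_inner, banach, second_countable_topology}"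
  shows "(\<lambda>p. cavity e c (snd p) (fst p)) \<in> prob_algebra unit_ball \<Otimes>\<^sub>M gauss_law \<rightarrow>\<^sub>M prob_algebra
      unit_ball"
  using measurable_cavity[of e c] by (simp add: case_prod_beta')

lemma cavity_in_prob_algebra:
  fixes e :: "nat \<Rightarrow> 'h::{real_inner, banach, second_countable_topology}"
  assumes "m \<in> space (prob_algebra unit_ball)"
  shows "cavity e c l m \<in> space (prob_algebra unit_ball)"
  using measurable_space[OF measurable_cavity_fst_snd[of e c], of "(m, l)"] assms
      by (simp add: space_pair_measure)

lemma measurable_emeasure_prob_algebra:
  assumes f: "f \<in> X \<rightarrow>\<^sub>M prob_algebra Y" and A: "A \<in> sets Y"
  shows "(\<lambda>x. emeasure (f x) A) \<in> borel_measurable X"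
  using measurable_compose[OF measurable_prob_algebraD[OF f] measurable_emeasure_subprob_algebra[OF
      A]] by simp

lemma sampling_lawD:
  assumes "L \<in> space (prob_algebra (prob_algebra unit_ball))"
  shows "sets L = sets (prob_algebra unit_ball)" "space L
      = space (prob_algebra unit_ball)" "prob_space L"
  using assms by (auto simp: space_prob_algebra dest: sets_eq_imp_space_eq)

lemma gram_law_kernel:
  assumes "L \<in> space (prob_algebra (prob_algebra (unit_ball :: 'h::{real_inner, banach,
      second_countable_topology} measure)))"
  shows "gram_law \<in> L \<rightarrow>\<^sub>M subprob_algebra matrix_space"
  using measurable_prob_algebraD[OF measurable_gram_law[where 'h = 'h]] sampling_lawD(1)[OF assms]
  by (simp cong: measurable_cong_sets)

lemma ROSt_of_in_prob_algebra:
  assumes L: "L \<in> space (prob_algebra (prob_algebra (unit_ball :: 'h::{real_inner, banach,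
      second_countable_topology} measure)))"
  shows "prob_space (ROSt_of L)" "sets (ROSt_of L) = sets matrix_space"
proof -
  interpret L: prob_space L by (rule sampling_lawD(3)[OF L])
  have "L \<bind> gram_law \<in> space (prob_algebra matrix_space)"
    using measurable_space[OF measurable_bind_prob_space[OF measurable_ident measurable_gram_law] L]
        by simp
  then show "prob_space (ROSt_of L)" "sets (ROSt_of L) = sets matrix_space"
    by (auto simp: ROSt_of_def space_prob_algebra)
qed

lemma nn_integral_ROSt_of:
  assumes L: "L \<in> space (prob_algebra (prob_algebra (unit_ball :: 'h::{real_inner, banach,
      second_countable_topology} measure)))"
    and f: "f \<in> borel_measurable matrix_space"
  shows "(\<integral>\<^sup>+q. f q \<partial>ROSt_of L) = (\<integral>\<^sup>+m. \<integral>\<^sup>+q. f q \<partial>gram_law m \<partial>L)"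
  unfolding ROSt_of_def by (rule nn_integral_bind[OF f gram_law_kernel[OF L]])

lemma cavity_law_in_prob_algebra:
  fixes e :: "nat \<Rightarrow> 'h::{real_inner, banach, second_countable_topology}"
  assumes L: "L \<in> space (prob_algebra (prob_algebra unit_ball))"
  shows "cavity_law e c L \<in> space (prob_algebra (prob_algebra unit_ball))"
    and "f \<in> borel_measurable (prob_algebra unit_ball) \<Longrightarrow>
      (\<integral>\<^sup>+m. f m \<partial>cavity_law e c L) = (\<integral>\<^sup>+m. \<integral>\<^sup>+l. f (cavity e c l m) \<partial>gauss_law \<partial>L)"
proof -
  interpret L: prob_space L by (rule sampling_lawD(3)[OF L])
  interpret G: prob_space gauss_law by (rule prob_space_gauss_law)
  interpret LG: pair_prob_space L gauss_law ..
  have s: "sets (L \<Otimes>\<^sub>M gauss_law) = sets (prob_algebra unit_ball \<Otimes>\<^sub>M gauss_law)"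
    by (intro sets_pair_measure_cong sampling_lawD(1)[OF L] refl)
  have k: "(\<lambda>(m, l). cavity e c l m) \<in> L \<Otimes>\<^sub>M gauss_law \<rightarrow>\<^sub>M prob_algebra unit_ball"
    using measurable_cavity[of e c] s by (simp cong: measurable_cong_sets)
  show "cavity_law e c L \<in> space (prob_algebra (prob_algebra unit_ball))"
    unfolding cavity_law_def space_prob_algebra using LG.prob_space_distr[OF k] by simp
  assume f: "f \<in> borel_measurable (prob_algebra unit_ball)"
  have "(\<integral>\<^sup>+m. f m \<partial>cavity_law e c L) = (\<integral>\<^sup>+p. f (cavity e c (snd p) (fst p)) \<partial>(L \<Otimes>\<^sub>M gauss_law))"
    unfolding cavity_law_def using k f by (subst nn_integral_distr) (auto simp: case_prod_beta)
  also have "\<dots> = (\<integral>\<^sup>+m. \<integral>\<^sup>+l. f (cavity e c l m) \<partial>gauss_law \<partial>L)"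
    using measurable_compose[OF k f] by (subst G.nn_integral_fst[symmetric]) (auto simp:
        case_prod_beta)
  finally show "(\<integral>\<^sup>+m. f m \<partial>cavity_law e c L) = (\<integral>\<^sup>+m. \<integral>\<^sup>+l. f (cavity e c l m) \<partial>gauss_law \<partial>L)" .
qed

context
  fixes e :: "nat \<Rightarrow> 'h::{real_inner, banach, second_countable_topology}"
  assumes onb: "orthonormal_basis e"
begin

text \<open>Collects what \<open>moments_determine_ratio\<close> requires of numerator and
  normalisation at each point, with \<open>K = sqrt 2 * exp (c\<^sup>2 / \<delta>)\<close>.\<close>

lemma sample_ratio_bounds:
  fixes c \<delta> :: real and m :: "'h measure" and l :: "nat \<Rightarrow> real" and N :: nat
      and C :: "(nat \<times> nat \<Rightarrow> real) set"
  assumes \<delta>: "0 < \<delta>" "\<delta> \<le> 1/2" and m: "m \<in> space (prob_algebra unit_ball)"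
  defines "U \<equiv> enn2real (sample_denominator e c \<delta> m l)"
    and "A \<equiv> enn2real (sample_numerator e c \<delta> N C m l)"
  shows "0 < U \<and> U \<le> sqrt 2 * exp (c\<^sup>2 / \<delta>)" "0 \<le> A \<and> A \<le> U ^ N"
    "sample_denominator e c \<delta> m l = ennreal U" "sample_numerator e c \<delta> N C m l = ennreal A"
    "0 \<le> A / U ^ N \<and> A / U ^ N \<le> 1"
proof -
  have U: "0 < sample_denominator e c \<delta> m l" "sample_denominator e c \<delta> m l
      \<le> ennreal (sqrt 2 * exp (c\<^sup>2 / \<delta>))"
    using sample_denominator_pos[OF onb _ \<delta>(2) m] sample_denominator_le[OF onb \<delta> m] \<delta>(1) by auto
  have Ut: "sample_denominator e c \<delta> m l < \<infinity>" using U(2) by (rule le_less_trans) simp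
  then show Ue: "sample_denominator e c \<delta> m l = ennreal U" by (simp add: U_def)
  have U0: "0 < U" using U(1) unfolding Ue by simp
  then show U1: "0 < U \<and> U \<le> sqrt 2 * exp (c\<^sup>2 / \<delta>)" using U(2) unfolding Ue by simp
  have A: "sample_numerator e c \<delta> N C m l \<le> ennreal (U ^ N)"
    using sample_numerator_le[OF onb m, of c \<delta> N C l] U0 unfolding Ue by (simp add: ennreal_power)
  then have "sample_numerator e c \<delta> N C m l < \<infinity>" by (rule le_less_trans) simp
  then show Ae: "sample_numerator e c \<delta> N C m l = ennreal A" by (simp add: A_def)
  show A': "0 \<le> A \<and> A \<le> U ^ N" using A U0 unfolding Ae by (simp add: A_def)
  then show "0 \<le> A / U ^ N \<and> A / U ^ N \<le> 1" using U0 by simp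
qed

text \<open>The identity for fixed \<open>m\<close>, averaged over \<open>L\<close>. The right-hand
  side knows \<open>L\<close> only through \<open>ROSt_of L\<close>.\<close>

lemma integral_sample_moment:
  assumes \<delta>: "0 < \<delta>" "\<delta> \<le> 1/2" and L: "L \<in> space (prob_algebra (prob_algebra unit_ball))"
    and C: "C \<in> sets matrix_space"
    and dep: "depends_on_first N (\<lambda>v::nat \<Rightarrow> 'h. gram_matrix v \<in> C)"
  shows "(\<integral>p. enn2real (sample_numerator e c \<delta> N C (fst p) (snd p)) * enn2real (sample_denominator e
      c \<delta> (fst p) (snd p)) ^ k \<partial>(L \<Otimes>\<^sub>M gauss_law))
    = enn2real (\<integral>\<^sup>+q. indicator C q * ennreal (overlap_moment c \<delta> (N + k) q) \<partial>ROSt_of L)"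
proof -
  let ?a = "\<lambda>p. sample_numerator e c \<delta> N C (fst p) (snd p)"
  let ?u = "\<lambda>p. sample_denominator e c \<delta> (fst p) (snd p)"
  let ?P = "L \<Otimes>\<^sub>M gauss_law"
  let ?o = "\<lambda>q. indicator C q * ennreal (overlap_moment c \<delta> (N + k) q)"
  interpret L: prob_space L by (rule sampling_lawD(3)[OF L])
  interpret G: prob_space gauss_law by (rule prob_space_gauss_law)
  have s: "sets ?P = sets (prob_algebra unit_ball \<Otimes>\<^sub>M gauss_law)"
    by (intro sets_pair_measure_cong sampling_lawD(1)[OF L] refl)
  have [measurable]: "(\<lambda>p. ?u p) \<in> borel_measurable ?P"
    "(\<lambda>p. ?a p) \<in> borel_measurable ?P"
    using measurable_sample_denominator[OF onb] measurable_sample_numerator[OF onb C] s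
    by (simp_all cong: measurable_cong_sets)
  have "(\<integral>p. enn2real (?a p) * enn2real (?u p) ^ k \<partial>?P)
    = enn2real (\<integral>\<^sup>+p. ennreal (enn2real (?a p) * enn2real (?u p) ^ k) \<partial>?P)"
    by (rule integral_eq_nn_integral) auto
  also have "(\<integral>\<^sup>+p. ennreal (enn2real (?a p) * enn2real (?u p) ^ k) \<partial>?P)
    = (\<integral>\<^sup>+p. ?a p * ?u p ^ k \<partial>?P)"
  proof (rule nn_integral_cong)
    fix p assume "p \<in> space ?P"
    then have m: "fst p \<in> space (prob_algebra unit_ball)"
      by (simp only: space_pair_measure mem_Times_iff sampling_lawD(2)[OF L])
    show "ennreal (enn2real (?a p) * enn2real (?u p) ^ k)
       = ?a p * ?u p ^ k"
      using sample_ratio_bounds(3)[OF \<delta> m, where c = c and l = "snd p"]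
        sample_ratio_bounds(4)[OF \<delta> m, where c = c and l = "snd p" and N = N and C = C]
      by (simp only: ennreal_mult' ennreal_power[symmetric] enn2real_nonneg)
  qed
  also have "\<dots> = (\<integral>\<^sup>+m. \<integral>\<^sup>+l. sample_numerator e c \<delta> N C m l * sample_denominator e c \<delta> m l ^ k
      \<partial>gauss_law \<partial>L)"
    by (subst G.nn_integral_fst[symmetric]) auto
  also have "\<dots> = (\<integral>\<^sup>+m. \<integral>\<^sup>+q. ?o q \<partial>gram_law m \<partial>L)"
    using nn_integral_sample_numerator_times_denominator[OF onb \<delta> _ C dep] sampling_lawD(2)[OF L]
    by (intro nn_integral_cong) simp
  also have "\<dots> = (\<integral>\<^sup>+q. ?o q \<partial>ROSt_of L)"
  proof (rule nn_integral_ROSt_of[OF L, symmetric])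
    note measurable_overlap_moment[of c \<delta> "N + k", measurable] C[measurable]
    show "(\<lambda>q. ?o q) \<in> borel_measurable matrix_space"
      by measurable
  qed
  finally show ?thesis .
qed

lemma nn_integral_sample_ratio_cong:
  assumes \<delta>: "0 < \<delta>" "\<delta> \<le> 1/2" and L: "L \<in> space (prob_algebra (prob_algebra unit_ball))"
    and L': "L' \<in> space (prob_algebra (prob_algebra (unit_ball :: 'h measure)))"
    and eq: "ROSt_of L = ROSt_of L'"
    and C: "C \<in> sets matrix_space"
    and dep: "depends_on_first N (\<lambda>v::nat \<Rightarrow> 'h. gram_matrix v \<in> C)"
  shows "(\<integral>\<^sup>+m. \<integral>\<^sup>+l. ennreal (sample_ratio e c \<delta> N C m l) \<partial>gauss_law \<partial>L)
      = (\<integral>\<^sup>+m. \<integral>\<^sup>+l. ennreal (sample_ratio e c \<delta> N C m l) \<partial>gauss_law \<partial>L')"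
proof -
  let ?R = "\<lambda>X. \<integral>\<^sup>+m. \<integral>\<^sup>+l. ennreal (sample_ratio e c \<delta> N C m l) \<partial>gauss_law \<partial>X"
  let ?P = "\<lambda>X. X \<Otimes>\<^sub>M gauss_law"
  let ?a = "\<lambda>p. enn2real (sample_numerator e c \<delta> N C (fst p) (snd p))"
  let ?u = "\<lambda>p. enn2real (sample_denominator e c \<delta> (fst p) (snd p))"
  interpret G: prob_space gauss_law by (rule prob_space_gauss_law)
  have P: "prob_space (?P X)"
    and am: "?a \<in> borel_measurable (?P X)" and um: "?u \<in> borel_measurable (?P X)"
    and ub: "\<And>p. p \<in> space (?P X) \<Longrightarrow> 0 < ?u p \<and> ?u p \<le> sqrt 2 * exp (c\<^sup>2 / \<delta>)"
    and ab: "\<And>p. p \<in> space (?P X) \<Longrightarrow> 0 \<le> ?a p \<and> ?a p \<le> ?u p ^ N"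
    and it: "?R X = ennreal (\<integral>p. ?a p / ?u p ^ N \<partial>(?P X))"
    if X: "X \<in> space (prob_algebra (prob_algebra unit_ball))" for X
  proof -
    interpret X: prob_space X by (rule sampling_lawD(3)[OF X])
    interpret XG: pair_prob_space X gauss_law ..
    have s: "sets (?P X) = sets (prob_algebra unit_ball \<Otimes>\<^sub>M gauss_law)"
      by (intro sets_pair_measure_cong sampling_lawD(1)[OF X] refl)
    show "prob_space (?P X)" by (rule XG.P.prob_space_axioms)
    show am[measurable]: "?a \<in> borel_measurable (?P X)"
        and um[measurable]: "?u \<in> borel_measurable (?P X)"
      using measurable_sample_denominator[OF onb] measurable_sample_numerator[OF onb C] s
      by (simp_all cong: measurable_cong_sets)
    have m: "fst p \<in> space (prob_algebra unit_ball)" if "p \<in> space (?P X)" for p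
      using that by (simp only: space_pair_measure mem_Times_iff sampling_lawD(2)[OF X])
    show "0 < ?u p \<and> ?u p \<le> sqrt 2 * exp (c\<^sup>2 / \<delta>)" "0 \<le> ?a p \<and> ?a p \<le> ?u p ^ N"
        if "p \<in> space (?P X)" for p
      using sample_ratio_bounds(1,2)[OF \<delta> m[OF that]] by auto
    have r: "0 \<le> ?a p / ?u p ^ N \<and> ?a p / ?u p ^ N \<le> 1" if "p \<in> space (?P X)" for p
      using sample_ratio_bounds(5)[OF \<delta> m[OF that]] by auto
    have "?R X = (\<integral>\<^sup>+p. ennreal (?a p / ?u p ^ N) \<partial>(?P X))"
      unfolding sample_ratio_def by (subst G.nn_integral_fst[symmetric]) auto
    also have "\<dots> = ennreal (\<integral>p. ?a p / ?u p ^ N \<partial>(?P X))"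
    proof (rule nn_integral_eq_integral)
      show "integrable (?P X) (\<lambda>p. ?a p / ?u p ^ N)"
        using r by (intro XG.integrable_const_bound[where B = 1] AE_I2) auto
    qed (use r in \<open>auto intro!: AE_I2\<close>)
    finally show "?R X = ennreal (\<integral>p. ?a p / ?u p ^ N \<partial>(?P X))" .
  qed
  have "(\<integral>p. ?a p / ?u p ^ N \<partial>(?P L)) = (\<integral>p. ?a p / ?u p ^ N \<partial>(?P L'))"
  proof (rule moments_determine_ratio)
    show "(\<integral>p. ?a p * ?u p ^ k \<partial>(?P L)) = (\<integral>p. ?a p * ?u p ^ k \<partial>(?P L'))" for k
      unfolding integral_sample_moment[OF \<delta> L C dep] integral_sample_moment[OF \<delta> L' C dep] eq ..
  qed (fact P[OF L] P[OF L'] am[OF L] am[OF L'] um[OF L] um[OF L'] ub[OF L] ub[OF L'] ab[OF L] ab[OF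
      L'])+
  then show ?thesis by (simp add: it L L')
qed

text \<open>Each of the first \<open>N\<close> samples contributes its density; the later ones
  integrate to 1 because \<open>C\<close> ignores them.\<close>

lemma emeasure_gram_law_cavity:
  assumes m: "m \<in> space (prob_algebra unit_ball)" and C: "C \<in> sets matrix_space"
    and dep: "depends_on_first N (\<lambda>v::nat \<Rightarrow> 'h. gram_matrix v \<in> C)"
    and fin: "sample_denominator e c 0 m l < \<infinity>"
  shows "emeasure (gram_law (cavity e c l m)) C
      = sample_numerator e c 0 N C m l / sample_denominator e c 0 m l ^ N"
proof -
  let ?w = "\<lambda>v. ennreal (cavity_weight e c l v)"
  let ?Z = "sample_denominator e c 0 m l"
  have Z: "?Z = (\<integral>\<^sup>+w. ?w w \<partial>m)" by (simp add: sample_denominator_def trunc_weight_0)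
  have cav: "cavity e c l m = density m (\<lambda>v. ?w v / ?Z)"
    using fin unfolding cavity_def Let_def Z by auto
  have wm[measurable]: "?w \<in> borel_measurable m"
    using measurable_trunc_weight_fixed[OF onb m, of c 0 l] by (simp add: trunc_weight_0)
  have cp: "cavity e c l m \<in> space (prob_algebra unit_ball)" by (rule cavity_in_prob_algebra[OF m])
  note measurable_indicator_gram_matrix[OF m C, measurable]
  have mg: "gram_matrix \<in> iid (cavity e c l m) \<rightarrow>\<^sub>M matrix_space"
    by (rule measurable_gram_matrix[OF sets_unit_ball_space(1)[OF cp]])
  have "emeasure (gram_law (cavity e c l m)) C = (\<integral>\<^sup>+q. indicator C q \<partial>gram_law (cavity e c l m))"
    using C by (simp add: gram_law_def)
  also have "\<dots> = (\<integral>\<^sup>+v. indicator C (gram_matrix v) \<partial>iid (cavity e c l m))"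
    unfolding gram_law_def using C by (subst nn_integral_distr[OF mg]) auto
  also have "\<dots> = (\<integral>\<^sup>+v. indicator C (gram_matrix v) * (\<Prod>i<N. ?w (v i) / ?Z) \<partial>iid m)"
    unfolding cav
  proof (rule nn_integral_iid_density[OF sets_unit_ball_space(2)[OF m]])
    show "prob_space (density m (\<lambda>v. ?w v / ?Z))" using sets_unit_ball_space(2)[OF cp] cav by simp
    show "depends_on_first N (\<lambda>v::nat \<Rightarrow> 'h. indicator C (gram_matrix v) :: ennreal)"
      using dep unfolding depends_on_first_def indicator_def by auto
  qed measurable
  also have "\<dots> = (\<integral>\<^sup>+v. (indicator C (gram_matrix v) * (\<Prod>i<N. ?w (v i))) * inverse ?Z ^ N \<partial>iid m)"
    by (simp add: divide_ennreal_def prod.distrib mult.assoc)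
  also have "\<dots> = sample_numerator e c 0 N C m l * inverse ?Z ^ N"
    unfolding sample_numerator_def trunc_weight_0
    by (rule nn_integral_multc) measurable
  finally show ?thesis
    by (simp add: divide_ennreal_def ennreal_inverse_power)
qed

text \<open>Dominated convergence for fixed \<open>l\<close>, in the numerator by a product of
  \<open>N\<close> exponential bounds. The quotient converges because the limiting normalisation is
  finite and positive.\<close>

lemma sample_ratio_tendsto:
  assumes m: "m \<in> space (prob_algebra unit_ball)" and C: "C \<in> sets matrix_space"
    and dep: "depends_on_first N (\<lambda>v::nat \<Rightarrow> 'h. gram_matrix v \<in> C)"
    and fin: "(\<integral>\<^sup>+v. ennreal (exp (2 * \<bar>c\<bar> * \<bar>cavity_field e l v\<bar>)) \<partial>m) < \<infinity>"
    and d: "d \<longlonglongrightarrow> 0" "\<And>k::nat. 0 < d k \<and> d k \<le> 1/2"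
  shows "(\<lambda>k. ennreal (sample_ratio e c (d k) N C m l)) \<longlonglongrightarrow> emeasure (gram_law (cavity e c l m)) C"
proof -
  let ?t = "\<lambda>\<delta> v. ennreal (trunc_weight e c \<delta> l v)"
  let ?f = "\<lambda>\<delta> v. indicator C (gram_matrix v) * (\<Prod>i<N. ?t \<delta> (v i))"
  let ?w = "\<lambda>\<delta> v. \<Prod>i<N. trunc_weight e c \<delta> l (v i)"
  interpret sequence_space m by (rule sequence_space_prob_space[OF sets_unit_ball_space(2)[OF m]])
  let ?b = "\<lambda>v. ennreal (sqrt 2 * exp (2 * \<bar>c\<bar> * \<bar>cavity_field e l v\<bar>))"
  note measurable_trunc_weight_fixed[OF onb m, measurable] measurable_indicator_gram_matrix[OF m C,
      measurable]
  have nv: "norm v \<le> 1" if "v \<in> space m" for v using that sets_unit_ball_space(3)[OF m] by simp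
  have tb: "?t \<delta> v \<le> ?b v" if "v \<in> space m" "0 \<le> \<delta>" "\<delta> \<le> 1/2" for v \<delta>
    using trunc_weight_le_exp[of \<delta> v e c l] that nv by (intro ennreal_leI) auto
  have cfm[measurable]: "(\<lambda>v. cavity_field e l v) \<in> borel_measurable m"
  proof -
    have "(\<lambda>v. cavity_field e l v) \<in> borel_measurable (unit_ball :: 'h measure)"
      using measurable_compose[OF measurable_Pair1' measurable_cavity_field_pair[OF onb]] by simp
    then show ?thesis using sets_unit_ball_space(1)[OF m] by (simp cong: measurable_cong_sets)
  qed
  have bfin: "(\<integral>\<^sup>+v. ?b v \<partial>m) < \<infinity>"
    using fin by (simp add: ennreal_mult' nn_integral_cmult ennreal_mult_less_top)
  have den: "(\<lambda>k. sample_denominator e c (d k) m l) \<longlonglongrightarrow> sample_denominator e c 0 m l"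
    unfolding sample_denominator_def
  proof (rule nn_integral_dominated_convergence[where w = ?b])
    show "AE v in m. (\<lambda>k. ?t (d k) v) \<longlonglongrightarrow> ?t 0 v"
      using trunc_weight_tendsto[OF d(1)] by (intro AE_I2 tendsto_ennrealI) (simp add:
          trunc_weight_0)
  qed (use tb d(2) bfin in \<open>auto intro!: AE_I2 simp: less_imp_le\<close>)
  have num: "(\<lambda>k. sample_numerator e c (d k) N C m l) \<longlonglongrightarrow> sample_numerator e c 0 N C m l"
    unfolding sample_numerator_def
  proof (rule nn_integral_dominated_convergence[where w = "\<lambda>v. \<Prod>i<N. ?b (v i)"])
    show "AE v in iid m. ?f (d k) v \<le> (\<Prod>i<N. ?b (v i))" for k
    proof (rule AE_I2)
      fix v assume "v \<in> space (iid m)"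
      then have v: "v i \<in> space m" for i by (auto simp: space_PiM)
      have "?t (d k) (v i) \<le> ?b (v i)" for i
        using tb[OF v] d(2)[of k] by simp
      then have "(\<Prod>i<N. ?t (d k) (v i)) \<le> (\<Prod>i<N. ?b (v i))"
        by (induction N) (auto intro: mult_mono)
      then have "?f (d k) v \<le> 1 * (\<Prod>i<N. ?b (v i))"
        by (intro mult_mono) (auto simp: indicator_def)
      then show "?f (d k) v \<le> (\<Prod>i<N. ?b (v i))" by simp
    qed
    have "(\<integral>\<^sup>+v. (\<Prod>i<N. ?b (v i)) \<partial>iid m) = (\<integral>\<^sup>+v. ?b v \<partial>m) ^ N"
      by (subst nn_integral_PiM_prod) auto
    also have "\<dots> < \<infinity>" using bfin by (simp add: power_less_top_ennreal)
    finally show "(\<integral>\<^sup>+v. (\<Prod>i<N. ?b (v i)) \<partial>iid m) < \<infinity>" .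
    show "AE v in iid m. (\<lambda>k. ?f (d k) v)
        \<longlonglongrightarrow> ?f 0 v"
    proof (rule AE_I2)
      fix v assume "v \<in> space (iid m)"
      then have v: "norm (v i) \<le> 1" for i by (rule norm_le_1_iid[OF m])
      have "(\<lambda>k. ennreal (?w (d k) v)) \<longlonglongrightarrow> ennreal (?w 0 v)"
        using trunc_weight_tendsto[OF d(1)] by (intro tendsto_ennrealI tendsto_prod) (simp add:
            trunc_weight_0)
      moreover have "ennreal (?w \<delta> v) = (\<Prod>i<N. ?t \<delta> (v i))"
        if "0 \<le> \<delta>" "\<delta> \<le> 1/2" for \<delta>
        using trunc_weight_pos[OF that v] by (subst prod_ennreal) (auto intro: less_imp_le)
      ultimately have "(\<lambda>k. (\<Prod>i<N. ?t (d k) (v i))) \<longlonglongrightarrow> (\<Prod>i<N. ?t 0 (v i))"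
        using d(2) by (simp add: less_imp_le)
      then show "(\<lambda>k. ?f (d k) v)
        \<longlonglongrightarrow> ?f 0 v"
        by (auto simp: indicator_def)
    qed
  qed auto
  have den0: "sample_denominator e c 0 m l < \<infinity>"
  proof -
    have "sample_denominator e c 0 m l \<le> (\<integral>\<^sup>+v. ?b v \<partial>m)"
      unfolding sample_denominator_def using tb by (intro nn_integral_mono) auto
    then show ?thesis using bfin by (rule le_less_trans)
  qed
  have num0: "sample_numerator e c 0 N C m l < \<infinity>"
    using den0 by (intro le_less_trans[OF sample_numerator_le[OF onb m]]) (simp add:
        power_less_top_ennreal)
  have pos: "0 < sample_denominator e c 0 m l" by (rule sample_denominator_pos[OF onb _ _ m]) auto
  define A Z where "A = enn2real (sample_numerator e c 0 N C m l)"
      and "Z = enn2real (sample_denominator e c 0 m l)"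
  have AZ: "sample_numerator e c 0 N C m l = ennreal A" "sample_denominator e c 0 m l
      = ennreal Z" "0 \<le> A" "0 < Z"
    using num0 den0 pos by (auto simp: A_def Z_def enn2real_positive_iff)
  have "(\<lambda>k. sample_ratio e c (d k) N C m l) \<longlonglongrightarrow> A / Z ^ N"
    unfolding sample_ratio_def A_def Z_def
    using num0 den0 num den AZ(4) by (intro tendsto_divide tendsto_power tendsto_enn2real) (auto
        simp: Z_def)
  then have "(\<lambda>k. ennreal (sample_ratio e c (d k) N C m l)) \<longlonglongrightarrow> ennreal (A / Z ^ N)"
    by (rule tendsto_ennrealI)
  also have "ennreal (A / Z ^ N) = emeasure (gram_law (cavity e c l m)) C"
    unfolding emeasure_gram_law_cavity[OF m C dep den0] AZ(1,2) using AZ(3,4)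
    by (simp add: ennreal_power divide_ennreal)
  finally show ?thesis .
qed

text \<open>The ratios never exceed 1, so the limit passes through the integrals over
  \<open>l\<close> and over \<open>m\<close>.\<close>

lemma nn_integral_sample_ratio_tendsto:
  assumes L: "L \<in> space (prob_algebra (prob_algebra unit_ball))"
    and C: "C \<in> sets matrix_space"
    and dep: "depends_on_first N (\<lambda>v::nat \<Rightarrow> 'h. gram_matrix v \<in> C)"
    and d: "d \<longlonglongrightarrow> 0" "\<And>k::nat. 0 < d k \<and> d k \<le> 1/2"
  shows "(\<lambda>k. \<integral>\<^sup>+m. \<integral>\<^sup>+l. ennreal (sample_ratio e c (d k) N C m l) \<partial>gauss_law \<partial>L)
      \<longlonglongrightarrow> emeasure (ROSt_of (cavity_law e c L)) C"
proof -
  interpret L: prob_space L by (rule sampling_lawD(3)[OF L])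
  interpret G: prob_space gauss_law by (rule prob_space_gauss_law)
  have s: "sets (L \<Otimes>\<^sub>M gauss_law) = sets (prob_algebra unit_ball \<Otimes>\<^sub>M gauss_law)"
    by (intro sets_pair_measure_cong sampling_lawD(1)[OF L] refl)
  let ?r = "\<lambda>k m l. ennreal (sample_ratio e c (d k) N C m l)"
  let ?g = "\<lambda>m l. emeasure (gram_law (cavity e c l m)) C"
  have r1: "?r k m l \<le> 1" if "m \<in> space L" for k m l
    using sample_ratio_bounds(5)[where \<delta> = "d k" and m = m and c = c and l = l and N = N
        and C = C] d(2)[of k] that sampling_lawD(2)[OF L]
    by (simp add: sample_ratio_def)
  have rm: "(\<lambda>p. ?r k (fst p) (snd p)) \<in> borel_measurable (L \<Otimes>\<^sub>M gauss_law)" for k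
    using measurable_sample_denominator[OF onb] measurable_sample_numerator[OF onb C] s
    unfolding sample_ratio_def by (simp cong: measurable_cong_sets)
  have gm: "(\<lambda>p. ?g (fst p) (snd p)) \<in> borel_measurable (L \<Otimes>\<^sub>M gauss_law)"
    using measurable_emeasure_prob_algebra[OF measurable_compose[OF measurable_cavity_fst_snd[of e
        c] measurable_gram_law] C] s
    by (simp cong: measurable_cong_sets)
  have rml: "?r k m \<in> borel_measurable gauss_law" if "m \<in> space L" for k m
    using measurable_compose[OF measurable_Pair1'[OF that] rm[of k]] by simp
  have gml: "?g m \<in> borel_measurable gauss_law" if "m \<in> space L" for m
    using measurable_compose[OF measurable_Pair1'[OF that] gm] by simp
  have one: "(\<integral>\<^sup>+l. 1 \<partial>gauss_law) < (\<infinity>::ennreal)" using G.emeasure_space_1 by simp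
  have inner: "(\<lambda>k. \<integral>\<^sup>+l. ?r k m l \<partial>gauss_law) \<longlonglongrightarrow> (\<integral>\<^sup>+l. ?g m l \<partial>gauss_law)" if m: "m \<in> space L" for m
  proof (rule nn_integral_dominated_convergence[where w = "\<lambda>_. 1"])
    have m': "m \<in> space (prob_algebra unit_ball)" using m sampling_lawD(2)[OF L] by simp
    show "AE l in gauss_law. (\<lambda>k. ?r k m l) \<longlonglongrightarrow> ?g m l"
      using AE_nn_integral_exp_abs_cavity_field[OF onb m', of "2 * \<bar>c\<bar>"]
      by eventually_elim (rule sample_ratio_tendsto[OF m' C dep _ d])
  qed (use rml[OF m] gml[OF m] r1[OF m] one in auto)
  have "(\<lambda>k. \<integral>\<^sup>+m. \<integral>\<^sup>+l. ?r k m l \<partial>gauss_law \<partial>L) \<longlonglongrightarrow> (\<integral>\<^sup>+m. \<integral>\<^sup>+l. ?g m l \<partial>gauss_law \<partial>L)"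
  proof (rule nn_integral_dominated_convergence[where w = "\<lambda>_. 1"])
    show "AE m in L. (\<integral>\<^sup>+l. ?r k m l \<partial>gauss_law) \<le> 1" for k
    proof (rule AE_I2)
      fix m assume m: "m \<in> space L"
      have "(\<integral>\<^sup>+l. ?r k m l \<partial>gauss_law) \<le> (\<integral>\<^sup>+l. 1 \<partial>gauss_law)"
        using r1[OF m] by (intro nn_integral_mono)
      then show "(\<integral>\<^sup>+l. ?r k m l \<partial>gauss_law) \<le> 1" using G.emeasure_space_1 by simp
    qed
    show "(\<lambda>m. \<integral>\<^sup>+l. ?r k m l \<partial>gauss_law) \<in> borel_measurable L" for k
      using G.borel_measurable_nn_integral_fst[OF rm[of k]] by simp
    show "(\<lambda>m. \<integral>\<^sup>+l. ?g m l \<partial>gauss_law) \<in> borel_measurable L"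
      using G.borel_measurable_nn_integral_fst[OF gm] by simp
  qed (use inner in \<open>auto simp: L.emeasure_space_1 intro!: AE_I2\<close>)
  also have "(\<integral>\<^sup>+m. \<integral>\<^sup>+l. ?g m l \<partial>gauss_law \<partial>L) = (\<integral>\<^sup>+m. emeasure (gram_law m) C \<partial>cavity_law e c L)"
    by (rule cavity_law_in_prob_algebra(2)[OF L, symmetric])
      (rule measurable_emeasure_prob_algebra[OF measurable_gram_law C])
  also have "\<dots> = emeasure (ROSt_of (cavity_law e c L)) C"
  proof -
    note cL = cavity_law_in_prob_algebra(1)[OF L, of e c]
    have "space (cavity_law e c L) \<noteq> {}" using sampling_lawD(3)[OF cL]
        by (rule prob_space.not_empty)
    then show ?thesis unfolding ROSt_of_def by (rule emeasure_bind[OF _ gram_law_kernel[OF cL] C,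
        symmetric])
  qed
  finally show ?thesis .
qed

text \<open>A finite-dimensional cylinder constrains finitely many overlaps and hence depends on
  finitely many samples. Its two probabilities are limits, as the truncation is removed, of averages
  that agree at every truncation level.\<close>

theorem ROSt_of_cavity_law_cong:
  assumes L: "L \<in> space (prob_algebra (prob_algebra unit_ball))"
    and L': "L' \<in> space (prob_algebra (prob_algebra (unit_ball :: 'h measure)))"
    and eq: "ROSt_of L = ROSt_of L'"
  shows "ROSt_of (cavity_law e c L) = ROSt_of (cavity_law e c L')"
proof (rule measure_eqI_PiM_infinite[where I = UNIV and M = "\<lambda>_. borel"])
  note cL = cavity_law_in_prob_algebra(1)[OF L, of e c]
      and cL' = cavity_law_in_prob_algebra(1)[OF L', of e c]
  show "sets (ROSt_of (cavity_law e c L)) = sets (Pi\<^sub>M UNIV (\<lambda>_. borel))"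
    "sets (ROSt_of (cavity_law e c L')) = sets (Pi\<^sub>M UNIV (\<lambda>_. borel))"
    using ROSt_of_in_prob_algebra(2)[OF cL] ROSt_of_in_prob_algebra(2)[OF cL']
        by (simp_all add: matrix_space_def)
  show "finite_measure (ROSt_of (cavity_law e c L))"
    using ROSt_of_in_prob_algebra(1)[OF cL] by (rule prob_space.finite_measure)
  fix A :: "nat \<times> nat \<Rightarrow> real set" and J
  assume J: "finite J" "J \<subseteq> UNIV" and A: "\<And>i. i \<in> J \<Longrightarrow> A i \<in> sets borel"
  let ?C = "prod_emb UNIV (\<lambda>_. borel :: real measure) J (Pi\<^sub>E J A)"
  have C: "?C \<in> sets matrix_space"
    unfolding matrix_space_def using J A by (intro sets_PiM_I) auto
  have memC: "q \<in> ?C \<longleftrightarrow> (\<forall>p\<in>J. q p \<in> A p)" for q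
    by (auto simp: prod_emb_def PiE_iff)
  obtain N where N: "\<And>p. p \<in> J \<Longrightarrow> fst p < N \<and> snd p < N"
  proof
    fix p assume "p \<in> J"
    then show "fst p < Suc (Max (fst ` J \<union> snd ` J)) \<and> snd p < Suc (Max (fst ` J \<union> snd ` J))"
      using J by (auto simp: less_Suc_eq_le intro!: Max_ge)
  qed
  have dep: "depends_on_first N (\<lambda>v::nat \<Rightarrow> 'h. gram_matrix v \<in> ?C)"
    unfolding depends_on_first_def memC
  proof (intro allI impI ball_cong refl)
    fix v v' :: "nat \<Rightarrow> 'h" and p assume "\<forall>i<N. v i = v' i" "p \<in> J"
    then have "gram_matrix v p = gram_matrix v' p"
      using N[of p] by (auto simp: gram_matrix_def case_prod_beta)
    then show "(gram_matrix v p \<in> A p) = (gram_matrix v' p \<in> A p)" by simp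
  qed
  \<comment> \<open>Offset 2, so that all levels are at most 1/2.\<close>
  define d where "d k = 1 / real (k + 2)" for k :: nat
  have d: "d \<longlonglongrightarrow> 0" "\<And>k. 0 < d k \<and> d k \<le> 1/2"
  proof -
    show "d \<longlonglongrightarrow> 0" unfolding d_def by (rule LIMSEQ_ignore_initial_segment[OF lim_1_over_n])
  qed (auto simp: d_def field_simps)
  have eqk: "(\<integral>\<^sup>+m. \<integral>\<^sup>+l. ennreal (sample_ratio e c (d k) N ?C m l) \<partial>gauss_law \<partial>L)
      = (\<integral>\<^sup>+m. \<integral>\<^sup>+l. ennreal (sample_ratio e c (d k) N ?C m l) \<partial>gauss_law \<partial>L')" for k
    using d(2)[of k] by (intro nn_integral_sample_ratio_cong[OF _ _ L L' eq C dep]) auto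
  show "emeasure (ROSt_of (cavity_law e c L)) ?C = emeasure (ROSt_of (cavity_law e c L')) ?C"
    using nn_integral_sample_ratio_tendsto[OF L C dep d, of c] nn_integral_sample_ratio_tendsto[OF
        L' C dep d, of c]
    unfolding eqk by (rule LIMSEQ_unique)
qed

end

section \<open>Composition of cavity mappings\<close>

text \<open>The characteristic function factorises, and
  \<open>s\<^sup>2 = a\<^sup>2 + b\<^sup>2\<close> makes the exponents add up to that of the
  standard law.\<close>

lemma distr_std_normal_combination:
  fixes a b s :: real
  assumes s: "s > 0" "s\<^sup>2 = a\<^sup>2 + b\<^sup>2"
  shows "distr (std_normal_distribution \<Otimes>\<^sub>M std_normal_distribution) borel (\<lambda>p. (b * fst p + a * snd
      p) / s) = std_normal_distribution"
proof (rule Levy_uniqueness)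
  let ?N = std_normal_distribution
  interpret N: prob_space ?N by (rule prob_space_std_normal)
  interpret NN: pair_prob_space ?N ?N ..
  have m: "(\<lambda>p. (b * fst p + a * snd p) / s) \<in> borel_measurable (?N \<Otimes>\<^sub>M ?N)" by measurable
  show "real_distribution (distr (?N \<Otimes>\<^sub>M ?N) borel (\<lambda>p. (b * fst p + a * snd p) / s))"
    by (rule NN.P.real_distribution_distr[OF m])
  show "real_distribution ?N" by (rule real_dist_normal_dist)
  show "char (distr (?N \<Otimes>\<^sub>M ?N) borel (\<lambda>p. (b * fst p + a * snd p) / s)) = char ?N"
  proof
    fix t
    have i: "integrable (?N \<Otimes>\<^sub>M ?N) (\<lambda>p. iexp (t * ((b * fst p + a * snd p) / s)))"
      by (rule NN.P.integrable_const_bound[where B = 1]) auto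
    have "char (distr (?N \<Otimes>\<^sub>M ?N) borel (\<lambda>p. (b * fst p + a * snd p) / s)) t
       = (\<integral>p. iexp (t * ((b * fst p + a * snd p) / s)) \<partial>(?N \<Otimes>\<^sub>M ?N))"
      unfolding char_def using m by (subst integral_distr) auto
    also have "\<dots> = (\<integral>x. \<integral>y. iexp (t * ((b * x + a * y) / s)) \<partial>?N \<partial>?N)"
      using NN.integral_fst'[OF i] by simp
    also have "\<dots> = (\<integral>x. \<integral>y. iexp ((t * b / s) * x) * iexp ((t * a / s) * y) \<partial>?N \<partial>?N)"
    proof (intro Bochner_Integration.integral_cong refl)
      fix x y
      have "t * ((b * x + a * y) / s) = (t * b / s) * x + (t * a / s) * y"
        by (simp add: add_divide_distrib algebra_simps)
      then show "iexp (t * ((b * x + a * y) / s)) = iexp ((t * b / s) * x) * iexp ((t * a / s) * y)"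
        by (simp only: of_real_add distrib_left exp_add)
    qed
    also have "\<dots> = (\<integral>x. iexp ((t * b / s) * x) * char ?N (t * a / s) \<partial>?N)"
      unfolding char_def by (simp only: integral_mult_right_zero)
    also have "\<dots> = char ?N (t * b / s) * char ?N (t * a / s)"
      unfolding char_def by (simp only: integral_mult_left_zero)
    also have "\<dots> = complex_of_real (exp (- (t * b / s)\<^sup>2 / 2) * exp (- (t * a / s)\<^sup>2 / 2))"
      by (simp add: char_std_normal_distribution)
    also have "exp (- (t * b / s)\<^sup>2 / 2) * exp (- (t * a / s)\<^sup>2 / 2) = exp (- t\<^sup>2 / 2)"
    proof -
      have "(t * b / s)\<^sup>2 + (t * a / s)\<^sup>2 = t\<^sup>2 * (s\<^sup>2 / s\<^sup>2)"
        unfolding power_divide power_mult_distrib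
            by (subst (3) s(2)) (simp add: add_divide_distrib[symmetric] algebra_simps)
      also have "\<dots> = t\<^sup>2" using s(1) by simp
      finally have "- (t * b / s)\<^sup>2 / 2 + - (t * a / s)\<^sup>2 / 2 = - t\<^sup>2 / 2" by linarith
      then show ?thesis by (simp only: exp_add[symmetric])
    qed
    finally show "char (distr (?N \<Otimes>\<^sub>M ?N) borel (\<lambda>p. (b * fst p + a * snd p) / s)) t = char ?N t"
      by (simp add: char_std_normal_distribution)
  qed
qed

lemma measurable_gauss_law_combination:
  "(\<lambda>p i. (b * fst p i + a * snd p i) / s) \<in> gauss_law \<Otimes>\<^sub>M gauss_law \<rightarrow>\<^sub>M gauss_law"
proof -
  note measurable_gauss_law_component[measurable]
  have "(\<lambda>p i. (b * fst p i + a * snd p i) / s) \<in> gauss_law \<Otimes>\<^sub>M gauss_law \<rightarrow>\<^sub>M (\<Pi>\<^sub>M i\<in>UNIV. borel)"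
    by (rule measurable_PiM_single') auto
  then show ?thesis using sets_gauss_law by (simp cong: measurable_cong_sets)
qed

lemma distr_gauss_law_combination:
  fixes a b s :: real
  assumes s: "s > 0" "s\<^sup>2 = a\<^sup>2 + b\<^sup>2"
  shows "distr (gauss_law \<Otimes>\<^sub>M gauss_law) gauss_law (\<lambda>p i. (b * fst p i + a * snd p i) / s)
      = gauss_law"
proof (rule measure_eqI_PiM_infinite[where I = UNIV and M = "\<lambda>_. std_normal_distribution"])
  let ?N = std_normal_distribution
  let ?f = "\<lambda>p i. (b * fst p i + a * snd p i) / s"
  interpret G: prob_space gauss_law by (rule prob_space_gauss_law)
  interpret N: product_prob_space "\<lambda>_::nat. ?N" UNIV by (rule product_prob_space_gauss)
  interpret GG: pair_prob_space gauss_law gauss_law ..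
  note measurable_gauss_law_component[measurable]
  show "sets (distr (gauss_law \<Otimes>\<^sub>M gauss_law) gauss_law ?f) = sets (Pi\<^sub>M UNIV (\<lambda>_. ?N))"
    "sets gauss_law = sets (Pi\<^sub>M UNIV (\<lambda>_. ?N))" by (simp_all add: gauss_law_def)
  show "finite_measure (distr (gauss_law \<Otimes>\<^sub>M gauss_law) gauss_law ?f)"
    using GG.P.prob_space_distr[OF measurable_gauss_law_combination]
        by (rule prob_space.finite_measure)
  fix A :: "nat \<Rightarrow> real set" and J
  assume J: "finite J" "J \<subseteq> UNIV" and A: "\<And>i. i \<in> J \<Longrightarrow> A i \<in> sets ?N"
  let ?C = "prod_emb UNIV (\<lambda>_. ?N) J (Pi\<^sub>E J A)"
  have A'[measurable]: "i \<in> J \<Longrightarrow> A i \<in> sets borel" for i using A by simp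
  have C: "?C \<in> sets gauss_law" unfolding gauss_law_def using J A by (intro sets_PiM_I) auto
  have ind: "indicator ?C q = (\<Prod>j\<in>J. indicator (A j) (q j) :: ennreal)" for q
    using J(1) by (auto simp: prod_emb_def PiE_iff indicator_def prod_zero_iff)
  have fm: "(\<lambda>p. \<Prod>j\<in>J. indicator (A j) (?f p j) :: ennreal)
      \<in> borel_measurable (gauss_law \<Otimes>\<^sub>M gauss_law)"
    by measurable
  have "emeasure (distr (gauss_law \<Otimes>\<^sub>M gauss_law) gauss_law ?f) ?C
      = (\<integral>\<^sup>+p. (\<Prod>j\<in>J. indicator (A j) (?f p j)) \<partial>(gauss_law \<Otimes>\<^sub>M gauss_law))"
    using C measurable_gauss_law_combination[of b a s]
    by (simp add: nn_integral_indicator[symmetric] nn_integral_distr ind del: nn_integral_indicator)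
  also have "\<dots> = (\<integral>\<^sup>+l. \<integral>\<^sup>+l'. (\<Prod>j\<in>J. indicator (A j) ((b * l j + a * l' j) / s)) \<partial>gauss_law
      \<partial>gauss_law)"
    using fm by (subst G.nn_integral_fst[symmetric]) auto
  also have "\<dots> = (\<integral>\<^sup>+l. (\<Prod>j\<in>J. \<integral>\<^sup>+y. indicator (A j) ((b * l j + a * y) / s) \<partial>?N) \<partial>gauss_law)"
    unfolding gauss_law_def using J by (intro nn_integral_cong N.nn_integral_PiM_prod) auto
  also have "\<dots> = (\<Prod>j\<in>J. \<integral>\<^sup>+x. \<integral>\<^sup>+y. indicator (A j) ((b * x + a * y) / s) \<partial>?N \<partial>?N)"
    unfolding gauss_law_def using J by (intro N.nn_integral_PiM_prod) auto
  also have "\<dots> = (\<Prod>j\<in>J. emeasure ?N (A j))"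
  proof (intro prod.cong refl)
    fix j assume j: "j \<in> J"
    have "emeasure ?N (A j) = emeasure (distr (?N \<Otimes>\<^sub>M ?N) borel (\<lambda>p. (b * fst p + a * snd p) / s)) (A
        j)"
      by (simp only: distr_std_normal_combination[OF s])
    also have "\<dots> = (\<integral>\<^sup>+p. indicator (A j) ((b * fst p + a * snd p) / s) \<partial>(?N \<Otimes>\<^sub>M ?N))"
      using A'[OF j] by (simp add: nn_integral_indicator[symmetric] nn_integral_distr del:
          nn_integral_indicator)
    also have "\<dots> = (\<integral>\<^sup>+x. \<integral>\<^sup>+y. indicator (A j) ((b * x + a * y) / s) \<partial>?N \<partial>?N)"
      using A'[OF j] by (subst sigma_finite_measure.nn_integral_fst[OF
          prob_space_imp_sigma_finite[OF prob_space_std_normal], symmetric]) auto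
    finally show "(\<integral>\<^sup>+x. \<integral>\<^sup>+y. indicator (A j) ((b * x + a * y) / s) \<partial>?N \<partial>?N) = emeasure ?N (A j)"
        by simp
  qed
  also have "\<dots> = emeasure gauss_law ?C"
    unfolding gauss_law_def using J A by (subst N.emeasure_PiM_emb) auto
  finally show "emeasure (distr (gauss_law \<Otimes>\<^sub>M gauss_law) gauss_law ?f) ?C = emeasure gauss_law ?C" .
qed

context
  fixes e :: "nat \<Rightarrow> 'h::{real_inner, banach, second_countable_topology}"
  assumes onb: "orthonormal_basis e"
begin

lemma measurable_cavity_weight_fixed:
  assumes "m \<in> space (prob_algebra unit_ball)"
  shows "(\<lambda>v. cavity_weight e c l v) \<in> borel_measurable m"
  using measurable_trunc_weight_fixed[OF onb assms, of c 0 l] by (simp add: trunc_weight_0)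

lemma nn_integral_cavity_weight_pos:
  assumes "m \<in> space (prob_algebra unit_ball)"
  shows "0 < (\<integral>\<^sup>+v. ennreal (cavity_weight e c l v) \<partial>m)"
  using sample_denominator_pos[OF onb _ _ assms, of 0 c l]
      by (simp add: sample_denominator_def trunc_weight_0)

lemma AE_nn_integral_cavity_weight_finite:
  assumes m: "m \<in> space (prob_algebra unit_ball)"
  shows "AE l in gauss_law. (\<integral>\<^sup>+v. ennreal (cavity_weight e c l v) \<partial>m) < \<infinity>"
  using AE_nn_integral_exp_abs_cavity_field[OF onb m, of "\<bar>c\<bar>"]
proof eventually_elim
  case (elim l)
  have "cavity_weight e c l v \<le> exp (\<bar>c\<bar> * \<bar>cavity_field e l v\<bar>)" for v
  proof -
    have "c * cavity_field e l v \<le> \<bar>c\<bar> * \<bar>cavity_field e l v\<bar>" by (metis abs_ge_self abs_mult)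
    moreover have "0 \<le> c\<^sup>2 / 2 * (norm v)\<^sup>2" by simp
    ultimately show ?thesis unfolding cavity_weight_def by (subst exp_le_cancel_iff) linarith
  qed
  then have "(\<integral>\<^sup>+v. ennreal (cavity_weight e c l v) \<partial>m)
      \<le> (\<integral>\<^sup>+v. ennreal (exp (\<bar>c\<bar> * \<bar>cavity_field e l v\<bar>)) \<partial>m)"
    by (intro nn_integral_mono ennreal_leI)
  then show ?case using elim by (rule le_less_trans)
qed

text \<open>Wherever the series converge the fields combine linearly, and
  \<open>s\<^sup>2 = a\<^sup>2 + b\<^sup>2\<close> makes the norm corrections add up. So the weights
  multiply and the normalisations telescope.\<close>

lemma cavity_cavity:
  assumes m: "m \<in> space (prob_algebra unit_ball)"
    and s: "s > 0" "s\<^sup>2 = a\<^sup>2 + b\<^sup>2"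
    and l: "AE v in m. summable (\<lambda>i. l i * (v \<bullet> e i))" "AE v in m. summable (\<lambda>i. l' i * (v \<bullet> e i))"
    and fin: "(\<integral>\<^sup>+v. ennreal (cavity_weight e b l v) \<partial>m) < \<infinity>"
      "(\<integral>\<^sup>+v. ennreal (cavity_weight e s (\<lambda>i. (b * l i + a * l' i) / s) v) \<partial>m) < \<infinity>"
  shows "cavity e a l' (cavity e b l m) = cavity e s (\<lambda>i. (b * l i + a * l' i) / s) m"
proof -
  let ?l = "\<lambda>i. (b * l i + a * l' i) / s"
  let ?wb = "\<lambda>v. ennreal (cavity_weight e b l v)" and ?wa = "\<lambda>v. ennreal (cavity_weight e a l' v)"
    and ?ws = "\<lambda>v. ennreal (cavity_weight e s ?l v)"
  let ?Zb = "\<integral>\<^sup>+v. ?wb v \<partial>m" and ?Zs = "\<integral>\<^sup>+v. ?ws v \<partial>m"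
  note measurable_cavity_weight_fixed[OF m, measurable]
  have Zb: "0 < ?Zb" and Zs: "0 < ?Zs" by (rule nn_integral_cavity_weight_pos[OF m])+
  have w: "AE v in m. ?wb v * ?wa v = ?ws v"
    using l
  proof eventually_elim
    case (elim v)
    have "s * cavity_field e ?l v = b * cavity_field e l v + a * cavity_field e l' v"
    proof -
      have 1: "(\<lambda>i. b * (l i * (v \<bullet> e i))) sums (b * cavity_field e l v)"
        unfolding cavity_field_def using elim(1) by (intro sums_mult summable_sums)
      have 2: "(\<lambda>i. a * (l' i * (v \<bullet> e i))) sums (a * cavity_field e l' v)"
        unfolding cavity_field_def using elim(2) by (intro sums_mult summable_sums)
      have "(\<lambda>i. ?l i * (v \<bullet> e i)) sums ((b * cavity_field e l v + a * cavity_field e l' v) / s)"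
        using sums_divide[OF sums_add[OF 1 2], of s] by (simp add: algebra_simps)
      then have "cavity_field e ?l v = (b * cavity_field e l v + a * cavity_field e l' v) / s"
        unfolding cavity_field_def by (rule sums_unique[symmetric])
      then show ?thesis using s(1) by simp
    qed
    then have "cavity_weight e b l v * cavity_weight e a l' v = cavity_weight e s ?l v"
      unfolding cavity_weight_def s(2) exp_add[symmetric]
      by (intro arg_cong[where f = exp]) (simp add: algebra_simps add_divide_distrib)
    then show ?case by (simp add: cavity_weight_def ennreal_mult'[symmetric])
  qed
  have cb: "cavity e b l m = density m (\<lambda>v. ?wb v / ?Zb)"
    using fin(1) unfolding cavity_def Let_def by auto
  have "(\<integral>\<^sup>+v. ?wa v \<partial>cavity e b l m) = (\<integral>\<^sup>+v. (?wb v / ?Zb) * ?wa v \<partial>m)"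
    unfolding cb by (rule nn_integral_density) measurable
  also have "\<dots> = (\<integral>\<^sup>+v. ?ws v / ?Zb \<partial>m)"
  proof (rule nn_integral_cong_AE)
    show "AE v in m. ?wb v / ?Zb * ?wa v = ?ws v / ?Zb"
      using w
    proof eventually_elim
      case (elim v)
      show ?case unfolding elim[symmetric] divide_ennreal_def by (simp only: mult_ac)
    qed
  qed
  also have "\<dots> = ?Zs / ?Zb" by (rule nn_integral_divide) measurable
  finally have Za: "(\<integral>\<^sup>+v. ?wa v \<partial>cavity e b l m) = ?Zs / ?Zb" .
  \<comment> \<open>Excludes the fallback branch of the outer \<open>cavity\<close>.\<close>
  have Za_fin: "?Zs / ?Zb \<noteq> \<infinity>"
    using fin(2) Zb by (auto simp: divide_ennreal_def ennreal_mult_eq_top_iff)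
  have "cavity e a l' (cavity e b l m) = density (cavity e b l m) (\<lambda>v. ?wa v / (?Zs / ?Zb))"
    using Za_fin unfolding cavity_def[of e a] Let_def Za by auto
  also have "\<dots> = density m (\<lambda>v. (?wb v / ?Zb) * (?wa v / (?Zs / ?Zb)))"
    unfolding cb by (rule density_density_eq) measurable
  also have "\<dots> = density m (\<lambda>v. ?ws v / ?Zs)"
  proof (rule density_cong)
    show "AE v in m. ?wb v / ?Zb * (?wa v / (?Zs / ?Zb)) = ?ws v / ?Zs"
      using w
    proof eventually_elim
      case (elim v)
      obtain z y where z: "?Zb = ennreal z" "0 < z" and y: "?Zs = ennreal y" "0 < y"
        using fin Zb Zs by (cases ?Zb; cases ?Zs) auto
      show ?case unfolding elim[symmetric] z y using z(2) y(2)
        by (simp add: divide_ennreal ennreal_mult'[symmetric] cavity_weight_def)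
    qed
  qed measurable
  also have "\<dots> = cavity e s ?l m"
    using fin(2) unfolding cavity_def Let_def by auto
  finally show ?thesis .
qed

lemma cavity_law_cavity_law:
  assumes L: "L \<in> space (prob_algebra (prob_algebra unit_ball))"
    and s: "s > 0" "s\<^sup>2 = a\<^sup>2 + b\<^sup>2"
  shows "cavity_law e a (cavity_law e b L) = cavity_law e s L"
proof (rule measure_eqI)
  interpret G: prob_space gauss_law by (rule prob_space_gauss_law)
  interpret GG: pair_sigma_finite gauss_law gauss_law ..
  have sets_cl: "sets (cavity_law e c X) = sets (prob_algebra unit_ball)" for c X
      by (simp add: cavity_law_def)
  show "sets (cavity_law e a (cavity_law e b L)) = sets (cavity_law e s L)" by (simp add: sets_cl)
  fix A assume "A \<in> sets (cavity_law e a (cavity_law e b L))"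
  then have A[measurable]: "A \<in> sets (prob_algebra unit_ball)" by (simp add: sets_cl)
  note cL = cavity_law_in_prob_algebra(1)[OF L, of e b]
  let ?f = "\<lambda>m. indicator A m :: ennreal"
  let ?l = "\<lambda>p i. (b * fst p i + a * snd p i) / s"
  have fm: "?f \<in> borel_measurable (prob_algebra unit_ball)" by measurable
  have gm: "(\<lambda>p. ?f (cavity e c (snd p) (fst p)))
      \<in> borel_measurable (prob_algebra unit_ball \<Otimes>\<^sub>M gauss_law)" for c
    by (rule measurable_compose[OF measurable_cavity_fst_snd fm])
  have gml: "(\<lambda>l. ?f (cavity e c l m)) \<in> borel_measurable gauss_law"
      if "m \<in> space (prob_algebra unit_ball)" for c m
    using measurable_compose[OF measurable_Pair1'[OF that] gm] by simp
  have hm: "(\<lambda>m. \<integral>\<^sup>+l. ?f (cavity e a l m) \<partial>gauss_law) \<in> borel_measurable (prob_algebra unit_ball)"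
    using G.borel_measurable_nn_integral_fst[OF gm] by simp
  have "emeasure (cavity_law e a (cavity_law e b L)) A = (\<integral>\<^sup>+m. ?f m
      \<partial>cavity_law e a (cavity_law e b L))"
    by (simp add: sets_cl)
  also have "\<dots> = (\<integral>\<^sup>+m. \<integral>\<^sup>+l'. ?f (cavity e a l' m) \<partial>gauss_law \<partial>cavity_law e b L)"
    by (rule cavity_law_in_prob_algebra(2)[OF cL fm])
  also have "\<dots> = (\<integral>\<^sup>+m. \<integral>\<^sup>+l. \<integral>\<^sup>+l'. ?f (cavity e a l' (cavity e b l m)) \<partial>gauss_law \<partial>gauss_law \<partial>L)"
    by (rule cavity_law_in_prob_algebra(2)[OF L hm])
  also have "\<dots> = (\<integral>\<^sup>+m. \<integral>\<^sup>+l. ?f (cavity e s l m) \<partial>gauss_law \<partial>L)"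
  proof (rule nn_integral_cong)
    fix m assume "m \<in> space L"
    then have m: "m \<in> space (prob_algebra unit_ball)" using sampling_lawD(2)[OF L] by simp
    \<comment> \<open>The combined field again has law \<open>gauss_law\<close>, so its
      normalisation is finite for almost every pair of fields.\<close>
    have "AE p in gauss_law \<Otimes>\<^sub>M gauss_law. (\<integral>\<^sup>+v. ennreal (cavity_weight e s (?l p) v) \<partial>m) < \<infinity>"
      using AE_nn_integral_cavity_weight_finite[OF m, of s]
      by (subst (asm) distr_gauss_law_combination[OF s, symmetric])
        (rule AE_distrD[OF measurable_gauss_law_combination])
    then have fs: "AE l in gauss_law. AE l' in gauss_law. (\<integral>\<^sup>+v. ennreal (cavity_weight e s (?l (l,
        l')) v) \<partial>m) < \<infinity>"
      by (rule GG.AE_pair)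
    have "(\<integral>\<^sup>+l. \<integral>\<^sup>+l'. ?f (cavity e a l' (cavity e b l m)) \<partial>gauss_law \<partial>gauss_law)
       = (\<integral>\<^sup>+l. \<integral>\<^sup>+l'. ?f (cavity e s (?l (l, l')) m) \<partial>gauss_law \<partial>gauss_law)"
    proof (rule nn_integral_cong_AE)
      show "AE l in gauss_law. (\<integral>\<^sup>+l'. ?f (cavity e a l' (cavity e b l m)) \<partial>gauss_law)
          = (\<integral>\<^sup>+l'. ?f (cavity e s (?l (l, l')) m) \<partial>gauss_law)"
        using fs AE_AE_cavity_field_summable[OF onb m] AE_nn_integral_cavity_weight_finite[OF m, of
            b]
      proof eventually_elim
        case (elim l)
        show ?case
        proof (rule nn_integral_cong_AE)
          show "AE l' in gauss_law. ?f (cavity e a l' (cavity e b l m))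
              = ?f (cavity e s (?l (l, l')) m)"
            using elim(1) AE_AE_cavity_field_summable[OF onb m]
          proof eventually_elim
            case (elim l')
            from cavity_cavity[OF m s \<open>AE v in m. summable (\<lambda>i. l i * (v \<bullet> e i))\<close> elim(2)
                \<open>(\<integral>\<^sup>+v. ennreal (cavity_weight e b l v) \<partial>m) < \<infinity>\<close>] elim(1)
            show ?case by simp
          qed
        qed
      qed
    qed
    also have "\<dots> = (\<integral>\<^sup>+p. ?f (cavity e s (?l p) m) \<partial>(gauss_law \<Otimes>\<^sub>M gauss_law))"
      using measurable_compose[OF measurable_gauss_law_combination[of b a s] gml[OF m, of s]]
      by (subst G.nn_integral_fst[symmetric]) auto
    also have "\<dots> = (\<integral>\<^sup>+l. ?f (cavity e s l m) \<partial>distr (gauss_law \<Otimes>\<^sub>M gauss_law) gauss_law ?l)"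
      by (rule nn_integral_distr[symmetric, OF measurable_gauss_law_combination]) (simp add: gml[OF
          m])
    also have "\<dots> = (\<integral>\<^sup>+l. ?f (cavity e s l m) \<partial>gauss_law)"
      by (simp only: distr_gauss_law_combination[OF s])
    finally show "(\<integral>\<^sup>+l. \<integral>\<^sup>+l'. ?f (cavity e a l' (cavity e b l m)) \<partial>gauss_law \<partial>gauss_law)
       = (\<integral>\<^sup>+l. ?f (cavity e s l m) \<partial>gauss_law)" .
  qed
  also have "\<dots> = (\<integral>\<^sup>+m. ?f m \<partial>cavity_law e s L)"
    by (rule cavity_law_in_prob_algebra(2)[OF L fm, symmetric])
  finally show "emeasure (cavity_law e a (cavity_law e b L)) A = emeasure (cavity_law e s L) A"
    by (simp add: sets_cl)
qed

text \<open>One step of parameter \<open>c\<close> is added at a time. As a law of measures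
  \<open>cavity_law e c L\<close> may differ from \<open>L\<close> and share only its overlap law;
  the congruence lets the outer step act on \<open>L\<close> nevertheless.\<close>

lemma ROSt_of_cavity_law_sqrt:
  assumes L: "L \<in> space (prob_algebra (prob_algebra unit_ball))" and c: "c > 0"
    and inv: "ROSt_of (cavity_law e c L) = ROSt_of L"
  shows "ROSt_of (cavity_law e (sqrt (Suc n) * c) L) = ROSt_of L"
proof (induction n)
  case 0
  then show ?case using inv by simp
next
  case (Suc n)
  note cL = cavity_law_in_prob_algebra(1)[OF L, of e c]
  have "cavity_law e (sqrt (Suc (Suc n)) * c) L
      = cavity_law e (sqrt (Suc n) * c) (cavity_law e c L)"
    using c by (intro cavity_law_cavity_law[OF L, symmetric]) (auto simp: power_mult_distrib
        algebra_simps)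
  then show ?case
    using ROSt_of_cavity_law_cong[OF onb cL L inv, of "sqrt (Suc n) * c"] Suc by simp
qed

end

section \<open>Gaussian integration by parts\<close>

lemma abs_exp_minus_one_le: "\<bar>exp z - 1\<bar> \<le> \<bar>z\<bar> * exp \<bar>z\<bar>" for z :: real
proof (cases "z \<ge> 0")
  case True
  have "1 - z \<le> exp (- z)" using exp_ge_add_one_self[of "- z"] by simp
  then have "(1 - z) * exp z \<le> exp (- z) * exp z" by (intro mult_right_mono) auto
  then have "exp z - 1 \<le> z * exp z" by (simp add: exp_minus field_simps)
  then show ?thesis using True by simp
next
  case False
  then have z: "z < 0" by simp
  have "1 - exp z \<le> - z" using exp_ge_add_one_self[of z] by linarith
  also have "\<dots> \<le> - z * exp (- z)" using z by simp
  finally show ?thesis using z by (simp add: abs_of_neg)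
qed

text \<open>Differentiation under the integral by dominated convergence along sequences: convergent
  increments are bounded by some \<open>H\<close>, and then all difference quotients are at most
  \<open>exp \<bar>u\<bar> * exp H\<close>.\<close>

lemma DERIV_integral_exp:
  fixes f X :: "'a \<Rightarrow> real"
  assumes M: "finite_measure M" and [measurable]: "f \<in> borel_measurable M" "X \<in> borel_measurable M"
    and f: "\<And>v. v \<in> space M \<Longrightarrow> \<bar>f v\<bar> \<le> 1" and X: "\<And>v. v \<in> space M \<Longrightarrow> \<bar>X v\<bar> \<le> 1"
  shows "((\<lambda>u. \<integral>v. f v * exp (u * X v) \<partial>M) has_real_derivative (\<integral>v. f v * X v * exp (u * X v)
      \<partial>M)) (at u)"
    and "integrable M (\<lambda>v. f v * exp (u * X v))"
proof -
  interpret finite_measure M by fact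
  have eb: "exp (u * X v) \<le> exp \<bar>u\<bar>" if "v \<in> space M" for v u
  proof -
    have "u * X v \<le> \<bar>u\<bar> * \<bar>X v\<bar>" by (metis abs_ge_self abs_mult)
    also have "\<dots> \<le> \<bar>u\<bar> * 1" using X[OF that] by (intro mult_left_mono) auto
    finally show ?thesis by simp
  qed
  have int: "integrable M (\<lambda>v. f v * exp (u * X v))" for u
  proof (rule integrable_const_bound[where B = "exp \<bar>u\<bar>"])
    show "AE v in M. norm (f v * exp (u * X v)) \<le> exp \<bar>u\<bar>"
    proof (rule AE_I2)
      fix v assume v: "v \<in> space M"
      have "\<bar>f v\<bar> * exp (u * X v) \<le> 1 * exp \<bar>u\<bar>" using f[OF v] eb[OF v] by (intro mult_mono) auto
      then show "norm (f v * exp (u * X v)) \<le> exp \<bar>u\<bar>" by (simp add: abs_mult)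
    qed
  qed measurable
  then show "integrable M (\<lambda>v. f v * exp (u * X v))" .
  show "((\<lambda>u. \<integral>v. f v * exp (u * X v) \<partial>M) has_real_derivative (\<integral>v. f v * X v * exp (u * X v)
      \<partial>M)) (at u)"
    unfolding DERIV_def tendsto_at_iff_sequentially
  proof (intro allI impI)
    fix h :: "nat \<Rightarrow> real" assume h: "\<forall>i. h i \<in> UNIV - {0}" "h \<longlonglongrightarrow> 0"
    then have "Bseq h" by (intro convergent_imp_Bseq convergentI)
    then obtain H where H: "\<And>n. \<bar>h n\<bar> \<le> H" unfolding Bseq_def by auto
    have "(\<lambda>n. \<integral>v. (f v * exp ((u + h n) * X v) - f v * exp (u * X v)) / h n \<partial>M)
        \<longlonglongrightarrow> (\<integral>v. f v * X v * exp (u * X v) \<partial>M)"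
    proof (rule integral_dominated_convergence[where w = "\<lambda>_. exp \<bar>u\<bar> * exp H"])
      show "AE v in M. (\<lambda>n. (f v * exp ((u + h n) * X v) - f v * exp (u * X v)) / h n)
          \<longlonglongrightarrow> f v * X v * exp (u * X v)"
      proof (rule AE_I2)
        fix v
        have "((\<lambda>u. f v * exp (u * X v)) has_real_derivative f v * (exp (u * X v) * X v)) (at u)"
          by (auto intro!: derivative_eq_intros)
        from this[unfolded DERIV_def tendsto_at_iff_sequentially, rule_format, of h] h
        show "(\<lambda>n. (f v * exp ((u + h n) * X v) - f v * exp (u * X v)) / h n)
            \<longlonglongrightarrow> f v * X v * exp (u * X v)"
          by (simp add: o_def mult_ac)
      qed
      show "AE v in M. norm ((f v * exp ((u + h n) * X v) - f v * exp (u * X v)) / h n)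
          \<le> exp \<bar>u\<bar> * exp H" for n
      proof (rule AE_I2)
        fix v assume v: "v \<in> space M"
        have hn: "h n \<noteq> 0" using h(1) by auto
        have "\<bar>exp (h n * X v) - 1\<bar> \<le> \<bar>h n * X v\<bar> * exp \<bar>h n * X v\<bar>" by (rule abs_exp_minus_one_le)
        also have "\<dots> \<le> \<bar>h n\<bar> * exp H"
        proof (intro mult_mono)
          show le: "\<bar>h n * X v\<bar> \<le> \<bar>h n\<bar>" using X[OF v] by (simp add: abs_mult mult_left_le)
          show "exp \<bar>h n * X v\<bar> \<le> exp H" using le H[of n] by simp
        qed auto
        finally have e: "\<bar>exp (h n * X v) - 1\<bar> / \<bar>h n\<bar> \<le> exp H" using hn
            by (simp add: divide_le_eq mult.commute)
        have "norm ((f v * exp ((u + h n) * X v) - f v * exp (u * X v)) / h n)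
            = (\<bar>f v\<bar> * exp (u * X v)) * (\<bar>exp (h n * X v) - 1\<bar> / \<bar>h n\<bar>)"
        proof -
          have "f v * exp ((u + h n) * X v) - f v * exp (u * X v)
              = (f v * exp (u * X v)) * (exp (h n * X v) - 1)"
            by (simp add: distrib_right exp_add right_diff_distrib)
          then show ?thesis by (simp add: abs_mult)
        qed
        also have "\<dots> \<le> (1 * exp \<bar>u\<bar>) * exp H"
          using f[OF v] eb[OF v] e by (intro mult_mono) auto
        finally show "norm ((f v * exp ((u + h n) * X v) - f v * exp (u * X v)) / h n)
            \<le> exp \<bar>u\<bar> * exp H" by simp
      qed
    qed auto
    moreover have "(\<integral>v. (f v * exp ((u + h n) * X v) - f v * exp (u * X v)) / h n \<partial>M)
      = ((\<integral>v. f v * exp ((u + h n) * X v) \<partial>M) - (\<integral>v. f v * exp (u * X v) \<partial>M)) / h n" for n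
      using int by simp
    ultimately show "((\<lambda>h. ((\<integral>v. f v * exp ((u + h) * X v) \<partial>M) - (\<integral>v. f v * exp (u * X v)
        \<partial>M)) / h) \<circ> h)
        \<longlonglongrightarrow> (\<integral>v. f v * X v * exp (u * X v) \<partial>M)"
      unfolding o_def by (simp only:)
  qed
qed

lemma integrable_std_normal_ident: "integrable std_normal_distribution (\<lambda>s. s)"
  using std_normal_moment_odd[of 0] by (auto simp: integrable_density has_bochner_integral_iff)

text \<open>The density \<open>?\<phi>\<close> has derivative \<open>- s * ?\<phi> s\<close>, so the
  difference of the two integrands is the derivative of \<open>h s * ?\<phi> s\<close>, which
  vanishes at both ends because \<open>h\<close> is bounded.\<close>

lemma gaussian_integration_by_parts:
  fixes h h' :: "real \<Rightarrow> real"
  assumes d: "\<And>s. (h has_real_derivative h' s) (at s)" and c: "\<And>s. isCont h' s"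
    and K: "\<And>s. \<bar>h s\<bar> \<le> K" "\<And>s. \<bar>h' s\<bar> \<le> K"
  shows "(\<integral>s. s * h s \<partial>std_normal_distribution) = (\<integral>s. h' s \<partial>std_normal_distribution)"
proof -
  interpret N: prob_space std_normal_distribution by (rule prob_space_std_normal)
  let ?\<phi> = std_normal_density
  have hc: "isCont h s" for s using d DERIV_isCont by blast
  have [measurable]: "h \<in> borel_measurable borel" "h' \<in> borel_measurable borel"
    using hc c by (auto intro!: borel_measurable_continuous_onI simp:
        continuous_on_eq_continuous_at)
  have i1: "integrable std_normal_distribution h'"
    by (rule N.integrable_const_bound[where B = K]) (use K in auto)
  have i2: "integrable std_normal_distribution (\<lambda>s. s * h s)"
  proof (rule Bochner_Integration.integrable_bound)
    show "integrable std_normal_distribution (\<lambda>s. K * s)" using integrable_std_normal_ident by simp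
    show "AE s in std_normal_distribution. norm (s * h s) \<le> norm (K * s)"
    proof (rule AE_I2)
      fix s
      have "\<bar>s\<bar> * \<bar>h s\<bar> \<le> \<bar>s\<bar> * \<bar>K\<bar>" using K(1)[of s] by (intro mult_left_mono) auto
      then show "norm (s * h s) \<le> norm (K * s)" by (simp add: abs_mult mult.commute)
    qed
  qed measurable
  have j1: "integrable lborel (\<lambda>s. ?\<phi> s * h' s)" and j2: "integrable lborel (\<lambda>s. ?\<phi> s * (s * h s))"
    using i1 i2 by (simp_all add: integrable_density)
  have dphi: "(?\<phi> has_real_derivative - s * ?\<phi> s) (at s)" for s
    unfolding normal_density_def by (auto intro!: derivative_eq_intros simp: field_simps)
  have lim: "((\<lambda>s. h s * ?\<phi> s) \<longlongrightarrow> 0) F" if "(?\<phi> \<longlongrightarrow> 0) F" for F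
  proof (rule Lim_null_comparison)
    show "\<forall>\<^sub>F s in F. norm (h s * ?\<phi> s) \<le> K * ?\<phi> s"
      using K(1) by (intro always_eventually allI) (auto simp: abs_mult intro: mult_right_mono)
    show "((\<lambda>s. K * ?\<phi> s) \<longlongrightarrow> 0) F" using tendsto_mult_right_zero[OF that] by simp
  qed
  have t1: "(?\<phi> \<longlongrightarrow> 0) at_top" unfolding normal_density_def by real_asymp
  have t2: "(?\<phi> \<longlongrightarrow> 0) at_bot" unfolding normal_density_def by real_asymp
  have "(LBINT s=-\<infinity>..\<infinity>. ?\<phi> s * h' s - ?\<phi> s * (s * h s)) = 0 - 0"
  proof (rule interval_integral_FTC_integrable)
    show "((\<lambda>s. h s * ?\<phi> s) has_vector_derivative ?\<phi> s * h' s - ?\<phi> s * (s * h s)) (at s)" for s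
      unfolding has_real_derivative_iff_has_vector_derivative[symmetric]
      by (auto intro!: derivative_eq_intros d dphi simp: algebra_simps)
    show "isCont (\<lambda>s. ?\<phi> s * h' s - ?\<phi> s * (s * h s)) s" for s
      using c hc dphi[THEN DERIV_isCont] by (intro continuous_intros) auto
    show "set_integrable lborel (einterval (- \<infinity>) \<infinity>) (\<lambda>s. ?\<phi> s * h' s - ?\<phi> s * (s * h s))"
      using j1 j2 by (simp add: set_integrable_def)
    show "(((\<lambda>s. h s * ?\<phi> s) \<circ> real_of_ereal) \<longlongrightarrow> 0) (at_right (- \<infinity>))"
      unfolding ereal_tendsto_simps using lim[OF t2] by simp
    show "(((\<lambda>s. h s * ?\<phi> s) \<circ> real_of_ereal) \<longlongrightarrow> 0) (at_left \<infinity>)"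
      unfolding ereal_tendsto_simps using lim[OF t1] by simp
  qed auto
  then have "(\<integral>s. ?\<phi> s * h' s - ?\<phi> s * (s * h s) \<partial>lborel) = 0"
    by (simp add: interval_lebesgue_integral_def set_lebesgue_integral_def)
  then have "(\<integral>s. ?\<phi> s * h' s \<partial>lborel) = (\<integral>s. ?\<phi> s * (s * h s) \<partial>lborel)"
    using j1 j2 by simp
  then show ?thesis by (simp add: integral_density)
qed

text \<open>The quotients are the mean and the variance of \<open>X\<close> under the exponential tilt of \<open>M\<close> by
  \<open>c * s * X\<close>; as a function of \<open>c * s\<close>, the mean has the variance as its derivative.\<close>

lemma integral_mult_tilted_mean_std_normal:
  fixes X :: "'a \<Rightarrow> real"
  assumes M: "finite_measure M" "emeasure M (space M) \<noteq> 0"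
      and [measurable]: "X \<in> borel_measurable M"
    and X: "\<And>v. v \<in> space M \<Longrightarrow> \<bar>X v\<bar> \<le> 1"
  defines "B \<equiv> \<lambda>u. \<integral>v. exp (u * X v) \<partial>M"
  shows "(\<integral>s. s * ((\<integral>v. X v * exp (c * s * X v) \<partial>M) / B (c * s)) \<partial>std_normal_distribution)
    = c * (\<integral>s. (\<integral>v. (X v)\<^sup>2 * exp (c * s * X v) \<partial>M) / B (c * s)
       - ((\<integral>v. X v * exp (c * s * X v) \<partial>M) / B (c * s))\<^sup>2 \<partial>std_normal_distribution)"
proof -
  interpret finite_measure M by fact
  define A where "A k u = (\<integral>v. X v ^ k * exp (u * X v) \<partial>M)" for k :: nat and u
  have Xk: "\<bar>X v ^ k\<bar> \<le> 1" if "v \<in> space M" for v k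
    using X[OF that] by (simp add: power_abs power_le_one)
  have B: "B u = A 0 u" for u by (simp add: A_def B_def)
  have dA: "(A k has_real_derivative A (Suc k) u) (at u)" for k u
    using DERIV_integral_exp(1)[OF M(1), of "\<lambda>v. X v ^ k" X u] Xk X
    unfolding A_def by (simp add: power_Suc2 mult.commute)
  have iA: "integrable M (\<lambda>v. X v ^ k * exp (u * X v))" for k u
    using DERIV_integral_exp(2)[OF M(1), of "\<lambda>v. X v ^ k" X u] Xk X by simp
  have pos: "0 < A 0 u" for u
  proof -
    have "A 0 u \<noteq> 0"
    proof
      assume "A 0 u = 0"
      then have "AE v in M. exp (u * X v) = 0"
        unfolding A_def using iA[of 0 u] by (subst (asm) integral_nonneg_eq_0_iff_AE) auto
      then have "AE v in M. False" by simp
      then show False using M(2) by (simp add: AE_iff_measurable[OF _ refl])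
    qed
    moreover have "0 \<le> A 0 u" unfolding A_def by (intro integral_nonneg_AE) auto
    ultimately show ?thesis by simp
  qed
  \<comment> \<open>Normalised moments of a variable with values in [-1, 1]; this gives the
    boundedness that the integration by parts asks for.\<close>
  have Ab: "\<bar>A k u / A 0 u\<bar> \<le> 1" for k u
  proof -
    have "\<bar>A k u\<bar> \<le> (\<integral>v. \<bar>X v ^ k * exp (u * X v)\<bar> \<partial>M)" unfolding A_def by (rule integral_abs_bound)
    also have "\<dots> \<le> A 0 u"
      unfolding A_def using iA[of 0 u] integrable_abs[OF iA[of k u]] Xk[of _ k]
      by (intro integral_mono) (auto simp: abs_mult intro: mult_left_le_one_le)
    finally show ?thesis using pos[of u] by simp
  qed
  define h where "h s = A 1 (c * s) / A 0 (c * s)" for s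
  define V where "V s = A 2 (c * s) / A 0 (c * s) - (A 1 (c * s) / A 0 (c * s))\<^sup>2" for s
  have dAc: "((\<lambda>s. A k (c * s)) has_real_derivative A (Suc k) (c * s) * c) (at s)" for k s
    by (rule DERIV_chain2[OF dA]) (auto intro!: derivative_eq_intros)
  have cA: "isCont (\<lambda>s. A k (c * s)) s" for k s using dAc DERIV_isCont by blast
  have dh: "(h has_real_derivative c * V s) (at s)" for s
  proof -
    have "(h has_real_derivative (A 2 (c * s) * c * A 0 (c * s) - A 1 (c * s) * (A 1 (c * s) * c)) /
        (A 0 (c * s) * A 0 (c * s))) (at s)"
      unfolding h_def using dAc[of 1 s] dAc[of 0 s] pos[of "c * s"]
      by (intro DERIV_divide) (auto simp: numeral_2_eq_2)
    moreover have "(A 2 (c * s) * c * A 0 (c * s) - A 1 (c * s) * (A 1 (c * s) * c)) / (A 0 (c * s)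
        * A 0 (c * s)) = c * V s"
      unfolding V_def using pos[of "c * s"] by (simp add: field_simps power2_eq_square)
    ultimately show ?thesis by simp
  qed
  have Vb: "\<bar>V s\<bar> \<le> 2" for s
  proof -
    have "(A 1 (c * s) / A 0 (c * s))\<^sup>2 \<le> 1" using Ab[of 1 "c * s"] by (simp add: abs_square_le_1)
    moreover have "0 \<le> (A 1 (c * s) / A 0 (c * s))\<^sup>2" by simp
    ultimately show ?thesis using Ab[of 2 "c * s"] unfolding V_def by linarith
  qed
  have "(\<integral>s. s * h s \<partial>std_normal_distribution) = (\<integral>s. c * V s \<partial>std_normal_distribution)"
  proof (rule gaussian_integration_by_parts[OF dh, where K = "1 + \<bar>c\<bar> * 2"])
    show "isCont (\<lambda>s. c * V s) s" for s
      unfolding V_def using cA pos[of "c * s"] by (intro continuous_intros) auto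
    show "\<bar>h s\<bar> \<le> 1 + \<bar>c\<bar> * 2" for s using Ab[of 1 "c * s"] unfolding h_def by linarith
    show "\<bar>c * V s\<bar> \<le> 1 + \<bar>c\<bar> * 2" for s
      using Vb[of s] by (simp add: abs_mult mult_left_mono add_increasing)
  qed
  then show ?thesis by (simp add: h_def V_def B A_def)
qed

text \<open>Replacing one coordinate by a fresh independent Gaussian preserves the law: conditioning
  on all other coordinates, without splitting the index set.\<close>

lemma gauss_law_fun_upd:
  "distr (std_normal_distribution \<Otimes>\<^sub>M gauss_law) gauss_law (\<lambda>p. (snd p)(i := fst p)) = gauss_law"
  using distr_pair_PiM_eq_PiM[of UNIV "\<lambda>_::nat. std_normal_distribution" i] prob_space_std_normal
  by (simp add: gauss_law_def case_prod_beta')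

lemma measurable_gauss_law_fun_upd:
  "(\<lambda>p. (snd p)(i := fst p)) \<in> std_normal_distribution \<Otimes>\<^sub>M gauss_law \<rightarrow>\<^sub>M gauss_law"
proof -
  note measurable_gauss_law_component[measurable]
  have "(\<lambda>p. (snd p)(i := fst p)) \<in> std_normal_distribution \<Otimes>\<^sub>M gauss_law \<rightarrow>\<^sub>M (\<Pi>\<^sub>M i\<in>UNIV. borel)"
    by (rule measurable_PiM_single') (auto simp: fun_upd_def)
  then show ?thesis using sets_gauss_law by (simp cong: measurable_cong_sets)
qed

section \<open>Coordinate means and variances under the cavity mapping\<close>

definition coord_mean :: "'h::real_inner measure \<Rightarrow> 'h \<Rightarrow> real" where
  "coord_mean m x = (\<integral>v. v \<bullet> x \<partial>m)"

definition coord_var :: "'h::real_inner measure \<Rightarrow> 'h \<Rightarrow> real" where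
  "coord_var m x = (\<integral>v. (v \<bullet> x)\<^sup>2 \<partial>m) - (coord_mean m x)\<^sup>2"

lemma inner_unit_ball:
  fixes m :: "'h::{real_inner, banach, second_countable_topology} measure"
  assumes m: "m \<in> space (prob_algebra unit_ball)" and x: "norm x \<le> 1"
  shows "v \<in> space m \<Longrightarrow> \<bar>v \<bullet> x\<bar> \<le> 1" "(\<lambda>v. v \<bullet> x) \<in> borel_measurable m"
    "integrable m (\<lambda>v. v \<bullet> x)" "integrable m (\<lambda>v. (v \<bullet> x)\<^sup>2)"
proof -
  interpret prob_space m by (rule sets_unit_ball_space(2)[OF m])
  have b: "\<bar>v \<bullet> x\<bar> \<le> 1" if "v \<in> space m" for v
  proof -
    have "\<bar>v \<bullet> x\<bar> \<le> norm v * norm x" by (rule Cauchy_Schwarz_ineq2)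
    also have "\<dots> \<le> 1 * 1" using that sets_unit_ball_space(3)[OF m] x by (intro mult_mono) auto
    finally show ?thesis by simp
  qed
  then show "v \<in> space m \<Longrightarrow> \<bar>v \<bullet> x\<bar> \<le> 1" .
  have [measurable]: "(\<lambda>v. v) \<in> borel_measurable m"
    using measurable_ident_unit_ball sets_unit_ball_space(1)[OF m]
        by (simp cong: measurable_cong_sets)
  show "(\<lambda>v. v \<bullet> x) \<in> borel_measurable m" by measurable
  show "integrable m (\<lambda>v. v \<bullet> x)"
    by (rule integrable_const_bound[where B = 1]) (use b in auto)
  show "integrable m (\<lambda>v. (v \<bullet> x)\<^sup>2)"
    by (rule integrable_const_bound[where B = 1]) (use b in \<open>auto simp: abs_square_le_1\<close>)
qed

lemma coord_mean_le_1:
  fixes m :: "'h::{real_inner, banach, second_countable_topology} measure"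
  assumes m: "m \<in> space (prob_algebra unit_ball)" and x: "norm x \<le> 1"
  shows "\<bar>coord_mean m x\<bar> \<le> 1"
proof -
  interpret prob_space m by (rule sets_unit_ball_space(2)[OF m])
  have "\<bar>coord_mean m x\<bar> \<le> (\<integral>v. \<bar>v \<bullet> x\<bar> \<partial>m)" unfolding coord_mean_def by (rule integral_abs_bound)
  also have "\<dots> \<le> 1" using inner_unit_ball[OF m x] by (intro integral_le_const) auto
  finally show ?thesis .
qed

text \<open>The cross term of two independent samples is the squared mean. The variance thus becomes
  a statement about replicas, and its sign comes for free.\<close>

lemma nn_integral_iid_coord_diff:
  fixes m :: "'h::{real_inner, banach, second_countable_topology} measure"
  assumes m: "m \<in> space (prob_algebra unit_ball)" and x: "norm x \<le> 1" and jk: "j \<noteq> k"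
  shows "(\<integral>\<^sup>+v. ennreal ((v j \<bullet> x - v k \<bullet> x)\<^sup>2) \<partial>iid m) = ennreal (2 * coord_var m x)"
    and "0 \<le> coord_var m x"
proof -
  interpret sequence_space m by (rule sequence_space_prob_space[OF sets_unit_ball_space(2)[OF m]])
  note X = inner_unit_ball[OF m x]
  note X(2)[measurable]
  have comp: "distr (iid m) m (\<lambda>v. v i) = m" for i by (rule PiM_component) simp
  have ic: "integrable (iid m) (\<lambda>v. f (v i))" "(\<integral>v. f (v i) \<partial>iid m) = (\<integral>w. f w \<partial>m)"
      if "integrable m f" for i and f :: "'h \<Rightarrow> real"
  proof -
    have [measurable]: "f \<in> borel_measurable m" using that by simp
    show "integrable (iid m) (\<lambda>v. f (v i))"
      using that by (subst (asm) comp[of i, symmetric]) (simp add: integrable_distr_eq)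
    show "(\<integral>v. f (v i) \<partial>iid m) = (\<integral>w. f w \<partial>m)"
      by (subst (2) comp[of i, symmetric]) (simp add: integral_distr)
  qed
  have cross: "(\<integral>v. (v j \<bullet> x) * (v k \<bullet> x) \<partial>iid m) = (coord_mean m x)\<^sup>2"
  proof -
    have "(\<integral>v. (\<Prod>i\<in>{j, k}. v i \<bullet> x) \<partial>iid m) = (\<Prod>i\<in>{j, k}. coord_mean m x)"
      unfolding coord_mean_def using X(3) by (intro integral_PiM_prod) auto
    then show ?thesis using jk by (simp add: power2_eq_square)
  qed
  have icross: "integrable (iid m) (\<lambda>v. (v j \<bullet> x) * (v k \<bullet> x))"
  proof (rule P.integrable_const_bound[where B = 1])
    show "AE v in iid m. norm ((v j \<bullet> x) * (v k \<bullet> x)) \<le> 1"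
    proof (rule AE_I2)
      fix v assume "v \<in> space (iid m)"
      then have "v i \<in> space m" for i by (auto simp: space_PiM)
      then have "\<bar>v j \<bullet> x\<bar> * \<bar>v k \<bullet> x\<bar> \<le> 1 * 1" using X(1) by (intro mult_mono) auto
      then show "norm ((v j \<bullet> x) * (v k \<bullet> x)) \<le> 1" by (simp add: abs_mult)
    qed
  qed measurable
  have eq: "(v j \<bullet> x - v k \<bullet> x)\<^sup>2 = (v j \<bullet> x)\<^sup>2 + (v k \<bullet> x)\<^sup>2 - 2 * ((v j \<bullet> x) * (v k \<bullet> x))"
      for v :: "nat \<Rightarrow> 'h"
    by (simp add: power2_diff)
  have int: "integrable (iid m) (\<lambda>v. (v j \<bullet> x - v k \<bullet> x)\<^sup>2)"
    unfolding eq by (intro Bochner_Integration.integrable_diff Bochner_Integration.integrable_add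
        integrable_mult_right icross ic(1)[OF X(4)])
  have "(\<integral>v. (v j \<bullet> x - v k \<bullet> x)\<^sup>2 \<partial>iid m) = 2 * coord_var m x"
    unfolding eq using ic[OF X(4)] icross cross by (simp add: coord_var_def)
  moreover have "(\<integral>\<^sup>+v. ennreal ((v j \<bullet> x - v k \<bullet> x)\<^sup>2) \<partial>iid m) = ennreal (\<integral>v. (v j \<bullet> x - v k \<bullet> x)\<^sup>2
      \<partial>iid m)"
    using int by (rule nn_integral_eq_integral) auto
  moreover have "0 \<le> (\<integral>v. (v j \<bullet> x - v k \<bullet> x)\<^sup>2 \<partial>iid m)" by (intro integral_nonneg_AE) auto
  ultimately show "(\<integral>\<^sup>+v. ennreal ((v j \<bullet> x - v k \<bullet> x)\<^sup>2) \<partial>iid m) = ennreal (2 * coord_var m x)" "0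
      \<le> coord_var m x"
    by auto
qed

text \<open>\<open>C\<close> is orthogonal but not normalised and may contain 0, where division by
  zero makes the term vanish.\<close>

lemma orthogonal_expansion:
  fixes C :: "'h::real_inner set"
  assumes C: "finite C" "pairwise orthogonal C" and v: "v \<in> span C"
  shows "v = (\<Sum>b\<in>C. (v \<bullet> b / (b \<bullet> b)) *\<^sub>R b)"
  using v
proof (induction rule: span_induct_alt)
  case base
  then show ?case by simp
next
  case (step a x y)
  have "(\<Sum>b\<in>C. (x \<bullet> b / (b \<bullet> b)) *\<^sub>R b) = (\<Sum>b\<in>C. if b = x then x else 0)"
  proof (intro sum.cong refl)
    fix b assume b: "b \<in> C"
    show "(x \<bullet> b / (b \<bullet> b)) *\<^sub>R b = (if b = x then x else 0)"
    proof (cases "b = x")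
      case False
      then have "x \<bullet> b = 0" using C(2) b step.hyps by (auto simp: pairwise_def orthogonal_def)
      then show ?thesis using False by simp
    qed (cases "x = 0", auto)
  qed
  also have "\<dots> = x" using C(1) step.hyps by simp
  finally have x: "(\<Sum>b\<in>C. (x \<bullet> b / (b \<bullet> b)) *\<^sub>R b) = x" .
  have "(\<Sum>b\<in>C. ((a *\<^sub>R x + y) \<bullet> b / (b \<bullet> b)) *\<^sub>R b)
      = a *\<^sub>R (\<Sum>b\<in>C. (x \<bullet> b / (b \<bullet> b)) *\<^sub>R b) + (\<Sum>b\<in>C. (y \<bullet> b / (b \<bullet> b)) *\<^sub>R b)"
    by (simp add: inner_add_left add_divide_distrib scaleR_add_left sum.distrib scaleR_sum_right)
  then show ?case using x step.IH by simp
qed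

context
  fixes e :: "nat \<Rightarrow> 'h::{real_inner, banach, second_countable_topology}"
  assumes onb: "orthonormal_basis e"
begin

lemma norm_basis: "norm (e i) = 1"
  using orthonormal_basis_inner[OF onb, of i i] by (simp add: norm_eq_sqrt_inner)

lemma cavity_field_fun_upd:
  assumes "summable (\<lambda>j. l j * (v \<bullet> e j))"
  shows "cavity_field e (l(i := s)) v = cavity_field e l v + (s - l i) * (v \<bullet> e i)"
proof -
  have "(\<lambda>j. l j * (v \<bullet> e j) + (if j = i then (s - l j) * (v \<bullet> e j) else 0)) sums
      (cavity_field e l v + (s - l i) * (v \<bullet> e i))"
    unfolding cavity_field_def using assms
    by (intro sums_add summable_sums sums_single)
  moreover have "(\<lambda>j. l j * (v \<bullet> e j) + (if j = i then (s - l j) * (v \<bullet> e j) else 0))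
      = (\<lambda>j. (l(i := s)) j * (v \<bullet> e j))"
    by (auto simp: algebra_simps)
  ultimately show ?thesis unfolding cavity_field_def by (simp only: sums_unique[symmetric])
qed

text \<open>With the other coordinates of \<open>l\<close> frozen, the cavity measure is the
  exponential tilt by \<open>c * s * (v \<bullet> e i)\<close> of the measure \<open>R\<close>, in
  which the i-th coordinate is set to 0. This is the setting of the one-dimensional
  identity.\<close>

lemma integral_cavity_fun_upd:
  fixes g :: "'h \<Rightarrow> real" and m :: "'h measure" and i :: nat and l :: "nat \<Rightarrow> real" and c s :: real
  assumes m: "m \<in> space (prob_algebra unit_ball)"
    and l: "AE v in m. summable (\<lambda>j. l j * (v \<bullet> e j))"
    and fin: "(\<integral>\<^sup>+v. ennreal (cavity_weight e c l v) \<partial>m) < \<infinity>"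
  defines "R \<equiv> density m (\<lambda>v. ennreal (cavity_weight e c (l(i := 0)) v))"
  shows "finite_measure R" "emeasure R (space R) \<noteq> 0"
    and "g \<in> borel_measurable m \<Longrightarrow> (\<integral>v. g v \<partial>cavity e c (l(i := s)) m)
       = (\<integral>v. g v * exp (c * s * (v \<bullet> e i)) \<partial>R) / (\<integral>v. exp (c * s * (v \<bullet> e i)) \<partial>R)"
proof -
  note measurable_cavity_weight_fixed[OF onb m, measurable]
  note X = inner_unit_ball[OF m, of "e i"]
  have X1: "v \<in> space m \<Longrightarrow> \<bar>v \<bullet> e i\<bar> \<le> 1" for v using X(1) norm_basis by simp
  have [measurable]: "(\<lambda>v. v \<bullet> e i) \<in> borel_measurable m" using X(2) norm_basis by simp
  let ?w = "\<lambda>s v. cavity_weight e c (l(i := s)) v"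
  let ?Z = "\<lambda>s. \<integral>\<^sup>+v. ennreal (?w s v) \<partial>m"
  \<comment> \<open>On the unit ball a change of one coordinate multiplies the weight by at most a
    constant, so finiteness at \<open>l\<close> gives finiteness for every \<open>s\<close>.\<close>
  have Zfin: "?Z s < \<infinity>" for s
  proof -
    have "?Z s \<le> (\<integral>\<^sup>+v. ennreal (exp (\<bar>c\<bar> * \<bar>s - l i\<bar>)) * ennreal (cavity_weight e c l v) \<partial>m)"
    proof (rule nn_integral_mono_AE)
      show "AE v in m. ennreal (?w s v) \<le> ennreal (exp (\<bar>c\<bar> * \<bar>s - l i\<bar>)) * ennreal (cavity_weight e
          c l v)"
        using l AE_space
      proof eventually_elim
        case (elim v)
        have "c * ((s - l i) * (v \<bullet> e i)) \<le> \<bar>c * ((s - l i) * (v \<bullet> e i))\<bar>" by simp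
        also have "\<dots> = \<bar>c\<bar> * \<bar>s - l i\<bar> * \<bar>v \<bullet> e i\<bar>" by (simp add: abs_mult)
        also have "\<dots> \<le> \<bar>c\<bar> * \<bar>s - l i\<bar> * 1" using X1[OF elim(2)] by (intro mult_left_mono) auto
        finally have "?w s v \<le> exp (\<bar>c\<bar> * \<bar>s - l i\<bar>) * cavity_weight e c l v"
          unfolding cavity_weight_def cavity_field_fun_upd[OF elim(1)] exp_add[symmetric]
          by (simp add: distrib_left)
        then show ?case by (simp add: ennreal_mult'[symmetric] ennreal_leI)
      qed
    qed
    also have "\<dots> < \<infinity>" using fin by (subst nn_integral_cmult) (auto simp: ennreal_mult_less_top)
    finally show ?thesis .
  qed
  have Zpos: "0 < ?Z s" for s by (rule nn_integral_cavity_weight_pos[OF onb m])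
  have R: "emeasure R (space R) = ?Z 0"
    unfolding R_def by (subst emeasure_density) (auto intro!: nn_integral_cong simp: indicator_def)
  show "finite_measure R" using Zfin[of 0] by (intro finite_measureI) (simp add: R)
  show "emeasure R (space R) \<noteq> 0" using Zpos[of 0] by (simp add: R)
  assume g[measurable]: "g \<in> borel_measurable m"
  have ws: "AE v in m. ?w 0 v * exp (c * s * (v \<bullet> e i)) = ?w s v"
    using l
  proof eventually_elim
    case (elim v)
    show ?case unfolding cavity_weight_def cavity_field_fun_upd[OF elim] exp_add[symmetric]
      by (intro arg_cong[where f = exp]) (simp add: algebra_simps)
  qed
  have Rg: "(\<integral>v. f v * exp (c * s * (v \<bullet> e i)) \<partial>R) = (\<integral>v. ?w s v * f v \<partial>m)"
      if [measurable]: "f \<in> borel_measurable m" for f :: "'h \<Rightarrow> real"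
  proof -
    have "(\<integral>v. f v * exp (c * s * (v \<bullet> e i)) \<partial>R) = (\<integral>v. ?w 0 v * (f v * exp (c * s * (v \<bullet> e i)))
        \<partial>m)"
      unfolding R_def by (subst integral_density) (auto simp: cavity_weight_def)
    also have "\<dots> = (\<integral>v. ?w s v * f v \<partial>m)"
      using ws by (intro integral_cong_AE) (auto simp: mult_ac elim!: eventually_mono)
    finally show ?thesis .
  qed
  define z where "z = enn2real (?Z s)"
  have z: "?Z s = ennreal z" "0 < z"
    using Zfin[of s] Zpos[of s] by (auto simp: z_def enn2real_positive_iff)
  have "(\<integral>v. ?w s v \<partial>m) = z"
    using z by (subst integral_eq_nn_integral) (auto simp: cavity_weight_def)
  then have den: "(\<integral>v. exp (c * s * (v \<bullet> e i)) \<partial>R) = z"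
    using Rg[of "\<lambda>_. 1"] by simp
  have "cavity e c (l(i := s)) m = density m (\<lambda>v. ennreal (?w s v) / ?Z s)"
    using Zfin[of s] unfolding cavity_def Let_def by auto
  also have "\<dots> = density m (\<lambda>v. ennreal (?w s v / z))"
    unfolding z(1) using z(2) by (simp add: divide_ennreal cavity_weight_def)
  finally have cav: "cavity e c (l(i := s)) m = density m (\<lambda>v. ennreal (?w s v / z))" .
  have "(\<integral>v. g v \<partial>cavity e c (l(i := s)) m) = (\<integral>v. ?w s v / z * g v \<partial>m)"
  proof -
    have "0 \<le> ?w s v / z" for v using z(2) by (simp add: cavity_weight_def)
    then show ?thesis unfolding cav by (subst integral_density) auto
  qed
  also have "\<dots> = (\<integral>v. ?w s v * g v \<partial>m) / z" by simp
  finally show "(\<integral>v. g v \<partial>cavity e c (l(i := s)) m)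
       = (\<integral>v. g v * exp (c * s * (v \<bullet> e i)) \<partial>R) / (\<integral>v. exp (c * s * (v \<bullet> e i)) \<partial>R)"
    unfolding den Rg[OF g] .
qed

lemma measurable_coord_cavity:
  assumes m: "m \<in> space (prob_algebra unit_ball)"
  shows "(\<lambda>l. coord_mean (cavity e c l m) x) \<in> borel_measurable gauss_law"
    and "(\<lambda>l. coord_var (cavity e c l m) x) \<in> borel_measurable gauss_law"
proof -
  have [measurable]: "(\<lambda>v. v) \<in> borel_measurable (unit_ball :: 'h measure)"
      by (rule measurable_ident_unit_ball)
  have k: "(\<lambda>l. cavity e c l m) \<in> gauss_law \<rightarrow>\<^sub>M subprob_algebra unit_ball"
    using measurable_prob_algebraD[OF measurable_compose[OF measurable_Pair1'[OF m]
        measurable_cavity_fst_snd[of e c]]] by simp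
  show 1: "(\<lambda>l. coord_mean (cavity e c l m) x) \<in> borel_measurable gauss_law"
    unfolding coord_mean_def by (rule measurable_compose[OF k integral_measurable_subprob_algebra])
        measurable
  have 2: "(\<lambda>l. \<integral>v. (v \<bullet> x)\<^sup>2 \<partial>cavity e c l m) \<in> borel_measurable gauss_law"
    by (rule measurable_compose[OF k integral_measurable_subprob_algebra]) measurable
  show "(\<lambda>l. coord_var (cavity e c l m) x) \<in> borel_measurable gauss_law"
    unfolding coord_var_def using 1 2 by measurable
qed

lemma coord_var_le_1:
  assumes m: "m \<in> space (prob_algebra (unit_ball :: 'h measure))" and x: "norm x \<le> 1"
  shows "coord_var m x \<le> 1"
proof -
  interpret prob_space m by (rule sets_unit_ball_space(2)[OF m])
  have "(\<integral>v. (v \<bullet> x)\<^sup>2 \<partial>m) \<le> 1"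
    using inner_unit_ball[OF m x] by (intro integral_le_const) (auto simp: abs_square_le_1)
  then show ?thesis unfolding coord_var_def by (smt (verit) zero_le_power2)
qed

text \<open>Condition on all coordinates but the i-th, apply the identity for tilted means in that
  coordinate, and average over the others.\<close>

lemma integral_coord_mean_cavity:
  assumes m: "m \<in> space (prob_algebra unit_ball)"
  shows "(\<integral>l. l i * coord_mean (cavity e c l m) (e i) \<partial>gauss_law)
      = c * (\<integral>l. coord_var (cavity e c l m) (e i) \<partial>gauss_law)"
    and "integrable gauss_law (\<lambda>l. l i * coord_mean (cavity e c l m) (e i))"
    and "integrable gauss_law (\<lambda>l. coord_var (cavity e c l m) (e i))"
proof -
  let ?N = std_normal_distribution
  let ?M = "\<lambda>l. coord_mean (cavity e c l m) (e i)" and ?V = "\<lambda>l. coord_var (cavity e c l m) (e i)"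
  let ?u = "\<lambda>p. (snd p)(i := fst p)"
  interpret G: prob_space gauss_law by (rule prob_space_gauss_law)
  interpret N: prob_space ?N by (rule prob_space_std_normal)
  interpret NG: pair_prob_space ?N gauss_law ..
  note measurable_gauss_law_component[measurable] measurable_coord_cavity[OF m, measurable]
  note u = measurable_gauss_law_fun_upd[of i]
  have ne: "norm (e i) \<le> 1" by (simp add: norm_basis)
  have cm: "cavity e c l m \<in> space (prob_algebra unit_ball)" for l
      by (rule cavity_in_prob_algebra[OF m])
  have Mb: "\<bar>?M l\<bar> \<le> 1" and Vb: "0 \<le> ?V l" "?V l \<le> 1" for l
    using coord_mean_le_1[OF cm ne] nn_integral_iid_coord_diff(2)[OF cm ne, of 0 1]
        coord_var_le_1[OF cm ne] by auto
  show iV: "integrable gauss_law ?V"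
    by (rule G.integrable_const_bound[where B = 1]) (use Vb in auto)
  have comp: "distr gauss_law ?N (\<lambda>l. l i) = ?N"
    unfolding gauss_law_def by (rule distr_PiM_component) (auto intro: prob_space_std_normal)
  have il: "integrable gauss_law (\<lambda>l. l i)"
    using integrable_std_normal_ident by (subst (asm) comp[symmetric]) (simp add:
        integrable_distr_eq)
  show iM: "integrable gauss_law (\<lambda>l. l i * ?M l)"
  proof (rule Bochner_Integration.integrable_bound[OF il])
    show "AE l in gauss_law. norm (l i * ?M l) \<le> norm (l i)"
      using Mb by (intro AE_I2) (simp add: abs_mult mult_left_le)
  qed measurable
  have tr: "(\<integral>l. F l \<partial>gauss_law) = (\<integral>l. \<integral>s. F (l(i := s)) \<partial>?N \<partial>gauss_law)"
      if F: "integrable gauss_law F" for F :: "(nat \<Rightarrow> real) \<Rightarrow> real"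
  proof -
    have Fm[measurable]: "F \<in> borel_measurable gauss_law" using F by simp
    have iF: "integrable (?N \<Otimes>\<^sub>M gauss_law) (\<lambda>p. F (?u p))"
      using F by (subst (asm) gauss_law_fun_upd[of i, symmetric]) (simp add: integrable_distr_eq u)
    have "(\<integral>l. F l \<partial>gauss_law) = (\<integral>p. F (?u p) \<partial>(?N \<Otimes>\<^sub>M gauss_law))"
      by (subst gauss_law_fun_upd[of i, symmetric]) (rule integral_distr[OF u Fm])
    also have "\<dots> = (\<integral>l. \<integral>s. F (l(i := s)) \<partial>?N \<partial>gauss_law)"
      using NG.integral_snd[of "\<lambda>s l. F (l(i := s))"] iF by (simp add: case_prod_beta')
    finally show ?thesis .
  qed
  have "(\<integral>l. l i * ?M l \<partial>gauss_law) = (\<integral>l. \<integral>s. s * ?M (l(i := s)) \<partial>?N \<partial>gauss_law)"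
    using tr[OF iM] by simp
  also have "\<dots> = (\<integral>l. c * (\<integral>s. ?V (l(i := s)) \<partial>?N) \<partial>gauss_law)"
  proof (rule integral_cong_AE)
    have um: "(\<lambda>l. \<integral>s. F (l(i := s)) \<partial>?N) \<in> borel_measurable gauss_law"
      if "F \<in> borel_measurable gauss_law" for F :: "(nat \<Rightarrow> real) \<Rightarrow> real"
    proof (rule N.borel_measurable_lebesgue_integral)
      have sw: "(\<lambda>p. (snd p, fst p)) \<in> gauss_law \<Otimes>\<^sub>M ?N \<rightarrow>\<^sub>M ?N \<Otimes>\<^sub>M gauss_law" by measurable
      show "(\<lambda>(l, s). F (l(i := s))) \<in> borel_measurable (gauss_law \<Otimes>\<^sub>M ?N)"
        using measurable_compose[OF sw measurable_compose[OF u that]] by (simp add: case_prod_beta')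
    qed
    show "(\<lambda>l. \<integral>s. s * ?M (l(i := s)) \<partial>?N) \<in> borel_measurable gauss_law"
      using um[of "\<lambda>l. l i * ?M l"] by simp
    show "(\<lambda>l. c * (\<integral>s. ?V (l(i := s)) \<partial>?N)) \<in> borel_measurable gauss_law"
      using um[of ?V] by simp
    \<comment> \<open>The exceptional set concerns \<open>l\<close> alone: for all other
      \<open>l\<close> the tilt formula holds at every value \<open>s\<close> of the
      coordinate.\<close>
    show "AE l in gauss_law. (\<integral>s. s * ?M (l(i := s)) \<partial>?N) = c * (\<integral>s. ?V (l(i := s)) \<partial>?N)"
      using AE_AE_cavity_field_summable[OF onb m] AE_nn_integral_cavity_weight_finite[OF onb m, of
          c]
    proof eventually_elim
      case (elim l)
      let ?R = "density m (\<lambda>v. ennreal (cavity_weight e c (l(i := 0)) v))"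
      note R = integral_cavity_fun_upd[OF m elim, where i = i]
      have Xm: "(\<lambda>v. v \<bullet> e i) \<in> borel_measurable m" by (rule inner_unit_ball(2)[OF m ne])
      show ?case
        using integral_mult_tilted_mean_std_normal[OF R(1,2), of "\<lambda>v. v \<bullet> e i" c]
          R(3)[OF Xm] R(3)[OF borel_measurable_power[OF Xm, of 2]] Xm inner_unit_ball(1)[OF m ne]
        by (simp add: coord_var_def coord_mean_def)
    qed
  qed
  also have "\<dots> = c * (\<integral>l. ?V l \<partial>gauss_law)"
    using tr[OF iV] by simp
  finally show "(\<integral>l. l i * ?M l \<partial>gauss_law) = c * (\<integral>l. ?V l \<partial>gauss_law)" .
qed

text \<open>Summing the identity over \<open>i < n\<close> leaves the mean of the truncated field
  under the cavity measure. Expansion along \<open>C\<close> bounds it by \<open>card C\<close>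
  absolute values of Gaussians of variance at most 1, whatever \<open>c\<close> and \<open>n\<close>
  are. The 4 is a crude bound for the mean of one of them.\<close>

lemma integral_sum_coord_var_le:
  assumes m: "m \<in> space (prob_algebra unit_ball)" and c: "c > 0"
    and C: "finite C" "pairwise orthogonal C" and mC: "AE v in m. v \<in> span C"
  shows "(\<Sum>i<n. \<integral>l. coord_var (cavity e c l m) (e i) \<partial>gauss_law) \<le> 4 * card C / c"
proof -
  let ?V = "\<lambda>i. \<integral>l. coord_var (cavity e c l m) (e i) \<partial>gauss_law"
  let ?l = "\<lambda>l v. \<Sum>i<n. l i * (v \<bullet> e i)"
  let ?M = "\<lambda>i l. coord_mean (cavity e c l m) (e i)"
  let ?a = "\<lambda>b i. (b /\<^sub>R norm b) \<bullet> e i"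
  let ?S = "\<lambda>b l. \<Sum>i<n. l i * ?a b i"
  interpret G: prob_space gauss_law by (rule prob_space_gauss_law)
  note measurable_gauss_law_component[measurable] measurable_coord_cavity[OF m, measurable]
  have S: "(\<integral>\<^sup>+l. ennreal \<bar>?S b l\<bar> \<partial>gauss_law) \<le> 4" for b
  proof -
    have a: "(\<Sum>i<n. (?a b i)\<^sup>2) \<le> 1"
    proof -
      have "(\<Sum>i<n. (?a b i)\<^sup>2) \<le> (norm (b /\<^sub>R norm b))\<^sup>2"
        using norm_basis_expansion_diff[OF onb, of "b /\<^sub>R norm b" n] by (smt (verit) zero_le_power2)
      also have "\<dots> \<le> 1" by (cases "b = 0") auto
      finally show ?thesis .
    qed
    \<comment> \<open>Both signs of \<open>t\<close> enter through
      \<open>\<bar>x\<bar> \<le> exp x + exp (- x)\<close>; each moment is at most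
      \<open>exp (1 / 2)\<close>, hence at most 2.\<close>
    have ex: "(\<integral>\<^sup>+l. ennreal (exp (\<Sum>i<n. l i * (t * ?a b i))) \<partial>gauss_law) \<le> 2" if "t\<^sup>2 = 1" for t
    proof -
      have "exp ((\<Sum>i<n. (t * ?a b i)\<^sup>2) / 2) \<le> exp (1 / 2)"
        using a that by (simp add: power_mult_distrib)
      also have "\<dots> \<le> (2::real)"
      proof -
        have "exp (1/2 :: real) ^ 2 = exp 1" by (simp add: power2_eq_square exp_add[symmetric])
        also have "\<dots> \<le> 2 ^ 2" using exp_le by simp
        finally show ?thesis by (rule power2_le_imp_le) simp
      qed
      finally show ?thesis unfolding nn_integral_gauss_law_exp
          by (metis ennreal_leI ennreal_numeral)
    qed
    have "\<bar>x\<bar> \<le> exp x + exp (- x)" for x :: real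
      using exp_ge_add_one_self[of x] exp_ge_add_one_self[of "- x"] exp_gt_zero[of x] exp_gt_zero[of
          "- x"] by linarith
    then have "(\<integral>\<^sup>+l. ennreal \<bar>?S b l\<bar> \<partial>gauss_law)
        \<le> (\<integral>\<^sup>+l. ennreal (exp (?S b l)) + ennreal (exp (- ?S b l)) \<partial>gauss_law)"
      by (intro nn_integral_mono) (simp add: ennreal_plus[symmetric] ennreal_leI del: ennreal_plus)
    also have "\<dots> = (\<integral>\<^sup>+l. ennreal (exp (?S b l)) \<partial>gauss_law) + (\<integral>\<^sup>+l. ennreal (exp (- ?S b l))
        \<partial>gauss_law)"
      by (rule nn_integral_add) measurable
    also have "\<dots> \<le> 2 + 2" using ex[of 1] ex[of "-1"] by (intro add_mono) (simp_all add: sum_negf)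
    finally show ?thesis by simp
  qed
  have Sint: "integrable gauss_law (\<lambda>l. \<bar>?S b l\<bar>)" "(\<integral>l. \<bar>?S b l\<bar> \<partial>gauss_law) \<le> 4" for b
  proof -
    have "(\<integral>\<^sup>+l. ennreal (norm \<bar>?S b l\<bar>) \<partial>gauss_law) < \<infinity>" using S[of b] by (simp add: le_less_trans)
    then show i: "integrable gauss_law (\<lambda>l. \<bar>?S b l\<bar>)" by (intro integrableI_bounded) auto
    have "ennreal (\<integral>l. \<bar>?S b l\<bar> \<partial>gauss_law) \<le> ennreal 4" using S[of b] nn_integral_eq_integral[OF i]
        by simp
    then show "(\<integral>l. \<bar>?S b l\<bar> \<partial>gauss_law) \<le> 4" by (subst (asm) ennreal_le_iff) auto
  qed
  \<comment> \<open>Valid for every \<open>l\<close>: almost every \<open>v\<close> is a combination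
    of the normalised elements of \<open>C\<close>, with coefficients in [-1, 1] because
    \<open>norm v \<le> 1\<close>.\<close>
  have pw: "(\<Sum>i<n. l i * ?M i l) \<le> (\<Sum>b\<in>C. \<bar>?S b l\<bar>)" for l
  proof -
    let ?\<mu> = "cavity e c l m"
    have cm: "?\<mu> \<in> space (prob_algebra unit_ball)" by (rule cavity_in_prob_algebra[OF m])
    interpret \<mu>: prob_space ?\<mu> by (rule sets_unit_ball_space(2)[OF cm])
    have ne: "norm (e i) \<le> 1" for i by (simp add: norm_basis)
    have "AE v in ?\<mu>. v \<in> span C"
    proof (cases "(\<integral>\<^sup>+w. ennreal (cavity_weight e c l w) \<partial>m) = \<infinity>")
      case False
      then have eq: "?\<mu> = density m (\<lambda>v. ennreal (cavity_weight e c l v) / (\<integral>\<^sup>+w. ennreal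
          (cavity_weight e c l w) \<partial>m))"
        unfolding cavity_def Let_def by auto
      have wm: "(\<lambda>v. ennreal (cavity_weight e c l v) / (\<integral>\<^sup>+w. ennreal (cavity_weight e c l w) \<partial>m))
          \<in> borel_measurable m"
        using measurable_cavity_weight_fixed[OF onb m] by measurable
      show ?thesis unfolding eq AE_density[OF wm] using mC by (rule eventually_mono) simp
    next
      \<comment> \<open>The fallback value of \<open>cavity\<close> is \<open>m\<close>, so no
        \<open>l\<close> has to be excluded.\<close>
      case True
      then have eq: "?\<mu> = m" unfolding cavity_def Let_def by auto
      show ?thesis unfolding eq by (rule mC)
    qed
    moreover have "AE v in ?\<mu>. norm v \<le> 1" using sets_unit_ball_space(3)[OF cm]
        by (intro AE_I2) auto
    ultimately have ae: "AE v in ?\<mu>. ?l l v \<le> (\<Sum>b\<in>C. \<bar>?S b l\<bar>)"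
    proof eventually_elim
      case (elim v)
      have "?l l v = (\<Sum>i<n. l i * ((\<Sum>b\<in>C. (v \<bullet> b / (b \<bullet> b)) *\<^sub>R b) \<bullet> e i))"
        using orthogonal_expansion[OF C elim(1)] by simp
      also have "\<dots> = (\<Sum>b\<in>C. (v \<bullet> b / (b \<bullet> b)) * ?l l b)"
        unfolding inner_sum_left sum_distrib_left by (subst sum.swap) (simp add: mult_ac)
      also have "\<dots> \<le> (\<Sum>b\<in>C. \<bar>?S b l\<bar>)"
      proof (rule sum_mono)
        fix b assume "b \<in> C"
        show "(v \<bullet> b / (b \<bullet> b)) * ?l l b \<le> \<bar>?S b l\<bar>"
        proof (cases "b = 0")
          case False
          have eq: "?l l b = norm b * ?S b l"
            unfolding sum_distrib_left using False by (intro sum.cong refl) (simp add: field_simps)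
          have "(v \<bullet> b / (b \<bullet> b)) * ?l l b = (v \<bullet> b / norm b) * ?S b l"
            unfolding eq using False by (simp add: power2_norm_eq_inner[symmetric] power2_eq_square)
          also have "\<dots> \<le> \<bar>v \<bullet> b / norm b\<bar> * \<bar>?S b l\<bar>" by (metis abs_ge_self abs_mult)
          also have "\<dots> \<le> 1 * \<bar>?S b l\<bar>"
          proof (intro mult_right_mono)
            have "\<bar>v \<bullet> b\<bar> \<le> norm v * norm b" by (rule Cauchy_Schwarz_ineq2)
            also have "\<dots> \<le> 1 * norm b" using elim(2) by (intro mult_right_mono) auto
            finally show "\<bar>v \<bullet> b / norm b\<bar> \<le> 1" using False by simp
          qed simp
          finally show ?thesis by simp
        qed simp
      qed
      finally show ?case .
    qed
    have "(\<Sum>i<n. l i * ?M i l) = (\<integral>v. ?l l v \<partial>?\<mu>)"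
      unfolding coord_mean_def using inner_unit_ball(3)[OF cm ne]
          by (subst Bochner_Integration.integral_sum) auto
    also have "\<dots> \<le> (\<Sum>b\<in>C. \<bar>?S b l\<bar>)"
      using ae inner_unit_ball(3)[OF cm ne] by (intro \<mu>.integral_le_const) auto
    finally show ?thesis .
  qed
  have "c * (\<Sum>i<n. ?V i) = (\<Sum>i<n. \<integral>l. l i * ?M i l \<partial>gauss_law)"
    unfolding sum_distrib_left by (intro sum.cong refl) (simp add: integral_coord_mean_cavity(1)[OF
        m])
  also have "\<dots> = (\<integral>l. (\<Sum>i<n. l i * ?M i l) \<partial>gauss_law)"
    using integral_coord_mean_cavity(2)[OF m] by (intro Bochner_Integration.integral_sum[symmetric])
        auto
  also have "\<dots> \<le> (\<integral>l. (\<Sum>b\<in>C. \<bar>?S b l\<bar>) \<partial>gauss_law)"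
    using pw integral_coord_mean_cavity(2)[OF m] Sint(1) by (intro integral_mono) auto
  also have "\<dots> = (\<Sum>b\<in>C. \<integral>l. \<bar>?S b l\<bar> \<partial>gauss_law)"
    using Sint(1) by (intro Bochner_Integration.integral_sum) auto
  also have "\<dots> \<le> (\<Sum>b\<in>C. 4)" using Sint(2) by (intro sum_mono)
  finally show ?thesis using c by (simp add: le_divide_eq mult_ac)
qed

text \<open>Parseval splits the squared distance of two samples into coordinates, each contributing
  twice its variance: hence 8 in place of 4. The bound on the partial sums does not depend on
  \<open>n\<close> and passes to the series.\<close>

lemma nn_integral_cavity_dist_le:
  assumes m: "m \<in> space (prob_algebra unit_ball)" and c: "c > 0"
    and C: "finite C" "pairwise orthogonal C" and mC: "AE v in m. v \<in> span C"
    and jk: "j \<noteq> k"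
  shows "(\<integral>\<^sup>+l. \<integral>\<^sup>+v. ennreal ((norm (v j - v k))\<^sup>2) \<partial>iid (cavity e c l m) \<partial>gauss_law)
      \<le> ennreal (8 * card C / c)"
proof -
  let ?d = "\<lambda>l. \<integral>\<^sup>+v. ennreal ((norm (v j - v k))\<^sup>2) \<partial>iid (cavity e c l m)"
  let ?V = "\<lambda>i l. coord_var (cavity e c l m) (e i)"
  interpret G: prob_space gauss_law by (rule prob_space_gauss_law)
  have cm: "cavity e c l m \<in> space (prob_algebra unit_ball)" for l
      by (rule cavity_in_prob_algebra[OF m])
  have ne: "norm (e i) \<le> 1" for i by (simp add: norm_basis)
  have V0: "0 \<le> ?V i l" for i l using nn_integral_iid_coord_diff(2)[OF cm ne jk] .
  have "?d l = (\<Sum>i. ennreal (2 * ?V i l))" for l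
  proof -
    have [measurable]: "(\<lambda>v. v \<bullet> e i) \<in> borel_measurable (cavity e c l m)" for i
        by (rule inner_unit_ball(2)[OF cm ne])
    have "?d l
        = (\<integral>\<^sup>+v. (\<Sum>i. ennreal ((v j \<bullet> e i - v k \<bullet> e i)\<^sup>2)) \<partial>iid (cavity e c l m))"
    proof (intro nn_integral_cong)
      fix v :: "nat \<Rightarrow> 'h"
      have "(\<lambda>i. (v j \<bullet> e i - v k \<bullet> e i)\<^sup>2) sums (norm (v j - v k))\<^sup>2"
        using parseval[OF onb, of "v j - v k"] by (simp add: inner_diff_left)
      then show "ennreal ((norm (v j - v k))\<^sup>2) = (\<Sum>i. ennreal ((v j \<bullet> e i - v k \<bullet> e i)\<^sup>2))"
        by (subst suminf_ennreal_eq) auto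
    qed
    also have "\<dots> = (\<Sum>i. \<integral>\<^sup>+v. ennreal ((v j \<bullet> e i - v k \<bullet> e i)\<^sup>2) \<partial>iid (cavity e c l m))"
      by (rule nn_integral_suminf) measurable
    also have "\<dots> = (\<Sum>i. ennreal (2 * ?V i l))"
      by (simp only: nn_integral_iid_coord_diff(1)[OF cm ne jk])
    finally show ?thesis .
  qed
  then have "(\<integral>\<^sup>+l. ?d l \<partial>gauss_law) = (\<integral>\<^sup>+l. (\<Sum>i. ennreal (2 * ?V i l)) \<partial>gauss_law)"
    by simp
  also have "\<dots> = (\<Sum>i. \<integral>\<^sup>+l. ennreal (2 * ?V i l) \<partial>gauss_law)"
    using measurable_coord_cavity(2)[OF m] by (intro nn_integral_suminf) measurable
  also have "\<dots> = (\<Sum>i. ennreal (2 * (\<integral>l. ?V i l \<partial>gauss_law)))"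
    using integral_coord_mean_cavity(3)[OF m] V0
        by (intro suminf_cong) (subst nn_integral_eq_integral, auto)
  also have "\<dots> \<le> ennreal (8 * card C / c)"
  proof (rule suminf_le_const)
    fix n
    have I0: "0 \<le> (\<integral>l. ?V i l \<partial>gauss_law)" for i using V0 by (intro integral_nonneg_AE) auto
    then have "(\<Sum>i<n. ennreal (2 * (\<integral>l. ?V i l \<partial>gauss_law))) = ennreal (2 * (\<Sum>i<n. \<integral>l. ?V i l
        \<partial>gauss_law))"
      by (subst sum_ennreal) (auto simp: sum_distrib_left)
    also have "\<dots> \<le> ennreal (8 * card C / c)"
      using integral_sum_coord_var_le[OF m c C mC, of n] by (intro ennreal_leI) simp
    finally show "(\<Sum>i<n. ennreal (2 * (\<integral>l. ?V i l \<partial>gauss_law))) \<le> ennreal (8 * card C / c)" .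
  qed simp
  finally show ?thesis .
qed

end

section \<open>The covariance operator\<close>

lemma cov_op_inner:
  fixes m :: "'h::{real_inner, banach, second_countable_topology} measure"
  assumes m: "m \<in> space (prob_algebra unit_ball)"
  shows "x \<bullet> cov_op m y = (\<integral>v. (x \<bullet> v) * (v \<bullet> y) \<partial>m)"
  using theI'[OF cov_op_exists[OF m]] unfolding cov_op_def by blast

lemma edim_le_imp_finite_span:
  fixes S :: "'h::real_vector set"
  assumes "\<And>B. B \<subseteq> S \<Longrightarrow> finite B \<Longrightarrow> independent B \<Longrightarrow> card B \<le> N"
  obtains B where "B \<subseteq> S" "finite B" "S \<subseteq> span B"
proof -
  obtain B where B: "B \<subseteq> S" "independent B" "S \<subseteq> span B"
    using maximal_independent_subset[of S] by blast
  have "finite B"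
  proof (rule ccontr)
    assume "infinite B"
    then obtain F where F: "F \<subseteq> B" "finite F" "card F = Suc N" by (meson infinite_arbitrarily_large)
    then have "card F \<le> N" using B assms[of F] independent_mono by blast
    then show False using F by simp
  qed
  then show thesis using B that by blast
qed

text \<open>Sorted by eigenvalue, \<open>B\<close> splits into independent subsets of finitely many
  eigenspaces, and \<open>mdim\<close> bounds the sum of the dimensions of these.\<close>

lemma independent_eigenvectors_card_le:
  fixes m :: "'h::{real_inner, banach, second_countable_topology} measure"
  assumes dim: "mdim m = enat N"
    and B: "finite B" "independent B" "\<And>x. x \<in> B \<Longrightarrow> \<exists>a. a \<noteq> 0 \<and> cov_op m x = a *\<^sub>R x"
  shows "card B \<le> N"
proof -
  obtain f where f: "\<And>x. x \<in> B \<Longrightarrow> f x \<noteq> 0 \<and> cov_op m x = f x *\<^sub>R x" using B(3) by metis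
  let ?A = "f ` B"
  have "enat (card B) = (\<Sum>a\<in>?A. enat (card {x\<in>B. f x = a}))"
  proof -
    have "card B = (\<Sum>a\<in>?A. card {x\<in>B. f x = a})"
      using B(1) sum.image_gen[of B "\<lambda>_. 1::nat" f] by simp
    moreover have "(\<Sum>a\<in>F. enat (g a)) = enat (sum g F)" if "finite F" for F and g :: "real \<Rightarrow> nat"
      using that by (induction F) (auto simp: zero_enat_def)
    ultimately show ?thesis using B(1) by simp
  qed
  also have "\<dots> \<le> (\<Sum>a\<in>?A. edim {x. cov_op m x = a *\<^sub>R x})"
  proof (rule sum_mono)
    fix a assume "a \<in> ?A"
    have "{x\<in>B. f x = a} \<in> {B'. B' \<subseteq> {x. cov_op m x = a *\<^sub>R x} \<and> finite B' \<and> independent B'}"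
      using f B independent_mono[OF B(2), of "{x\<in>B. f x = a}"] by auto
    then show "enat (card {x\<in>B. f x = a}) \<le> edim {x. cov_op m x = a *\<^sub>R x}"
      unfolding edim_def by (rule SUP_upper)
  qed
  also have "\<dots> \<le> mdim m"
    unfolding mdim_def using B(1) f by (intro SUP_upper) auto
  finally show ?thesis using dim by simp
qed

context
  fixes e :: "nat \<Rightarrow> 'h::{real_inner, banach, second_countable_topology}"
  assumes onb: "orthonormal_basis e"
begin

lemma eq_0_if_orthogonal_basis:
  assumes "\<And>i. x \<bullet> e i = 0"
  shows "x = 0"
  using sums_unique2[OF parseval[OF onb, of x], of 0] assms by simp

text \<open>Each box is the sum of the previous one and a segment, and sums of compact sets are
  compact. It supplies the finite nets for the compactness of the operator.\<close>

lemma compact_basis_box: "compact {x. \<exists>a. (\<forall>i<n. \<bar>a i\<bar> \<le> 1) \<and> x = (\<Sum>i<n. a i *\<^sub>R e i)}"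
proof (induction n)
  case 0
  then show ?case by simp
next
  case (Suc n)
  let ?K = "\<lambda>n. {x. \<exists>a. (\<forall>i<n. \<bar>a i\<bar> \<le> (1::real)) \<and> x = (\<Sum>i<n. a i *\<^sub>R e i)}"
  have c: "compact ((\<lambda>t. t *\<^sub>R e n) ` {-1..1})"
    by (intro compact_continuous_image continuous_intros) simp
  have "?K (Suc n) = {x + y | x y. x \<in> ?K n \<and> y \<in> (\<lambda>t. t *\<^sub>R e n) ` {-1..1}}"
  proof (intro set_eqI iffI)
    fix x assume "x \<in> ?K (Suc n)"
    then obtain a where a: "\<forall>i<Suc n. \<bar>a i\<bar> \<le> 1" "x = (\<Sum>i<Suc n. a i *\<^sub>R e i)" by blast
    then have "(\<Sum>i<n. a i *\<^sub>R e i) \<in> ?K n" "a n *\<^sub>R e n \<in> (\<lambda>t. t *\<^sub>R e n) ` {-1..1}"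
      by (auto simp: abs_le_iff less_Suc_eq intro!: imageI)
    then show "x \<in> {x + y | x y. x \<in> ?K n \<and> y \<in> (\<lambda>t. t *\<^sub>R e n) ` {-1..1}}"
      unfolding a(2) sum.lessThan_Suc by blast
  next
    fix x assume "x \<in> {x + y | x y. x \<in> ?K n \<and> y \<in> (\<lambda>t. t *\<^sub>R e n) ` {-1..1}}"
    then obtain a t where at: "\<forall>i<n. \<bar>a i\<bar> \<le> 1" "t \<in> {-1..1}" "x = (\<Sum>i<n. a i *\<^sub>R e i) + t *\<^sub>R e n"
        by blast
    let ?b = "a(n := t)"
    have "x = (\<Sum>i<Suc n. ?b i *\<^sub>R e i)" using at(3) by simp
    moreover have "\<forall>i<Suc n. \<bar>?b i\<bar> \<le> 1" using at by auto
    ultimately show "x \<in> ?K (Suc n)" by blast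
  qed
  then show ?case using compact_sums[OF Suc.IH c] by simp
qed

text \<open>The bound of \<open>x \<bullet> cov_op m y\<close> by a first absolute moment of
  \<open>x \<bullet> v\<close> is the one behind compactness: it transfers smallness of truncation
  errors of \<open>v\<close> to the operator.\<close>

lemma cov_op_properties:
  assumes m: "m \<in> space (prob_algebra (unit_ball :: 'h measure))"
  shows "x \<bullet> cov_op m y = cov_op m x \<bullet> y"
    and "cov_op m (x - y) = cov_op m x - cov_op m y"
    and "cov_op m (c *\<^sub>R x) = c *\<^sub>R cov_op m x"
    and "0 \<le> x \<bullet> cov_op m x"
    and "norm (cov_op m x) \<le> norm x"
    and "\<bar>x \<bullet> cov_op m y\<bar> \<le> norm y * (\<integral>v. \<bar>x \<bullet> v\<bar> \<partial>m)"
    and "integrable m (\<lambda>v. (x \<bullet> v) * (v \<bullet> y))" "integrable m (\<lambda>v. \<bar>x \<bullet> v\<bar>)"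
proof -
  let ?T = "cov_op m"
  note T = cov_op_inner[OF m]
  interpret prob_space m by (rule sets_unit_ball_space(2)[OF m])
  have [measurable]: "(\<lambda>v. v) \<in> borel_measurable m"
    using measurable_ident_unit_ball sets_unit_ball_space(1)[OF m]
        by (simp cong: measurable_cong_sets)
  have nv: "norm v \<le> 1" if "v \<in> space m" for v using sets_unit_ball_space(3)[OF m] that by simp
  have b: "\<bar>x \<bullet> v\<bar> \<le> norm x" if "v \<in> space m" for v x
  proof -
    have "\<bar>x \<bullet> v\<bar> \<le> norm x * norm v" by (rule Cauchy_Schwarz_ineq2)
    also have "\<dots> \<le> norm x * 1" using nv[OF that] by (intro mult_left_mono) auto
    finally show ?thesis by simp
  qed
  have int: "integrable m (\<lambda>v. (x \<bullet> v) * (v \<bullet> y))" for x y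
  proof (rule integrable_const_bound[where B = "norm x * norm y"])
    show "AE v in m. norm ((x \<bullet> v) * (v \<bullet> y)) \<le> norm x * norm y"
      using b by (intro AE_I2) (auto simp: abs_mult inner_commute[of _ y] intro!: mult_mono)
  qed measurable
  then show "integrable m (\<lambda>v. (x \<bullet> v) * (v \<bullet> y))" .
  have inta: "integrable m (\<lambda>v. \<bar>x \<bullet> v\<bar>)" for x
    by (rule integrable_const_bound[where B = "norm x"]) (use b in auto)
  then show "integrable m (\<lambda>v. \<bar>x \<bullet> v\<bar>)" .
  show sym: "x \<bullet> ?T y = ?T x \<bullet> y" for x y
    unfolding T inner_commute[of "?T x"] by (simp add: inner_commute mult.commute)
  have "z \<bullet> ?T (x - y) = z \<bullet> (?T x - ?T y)" for z
    unfolding inner_diff_right T using int by (simp add: right_diff_distrib)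
  then show "?T (x - y) = ?T x - ?T y" using vector_eq_ldot by blast
  have "z \<bullet> ?T (c *\<^sub>R x) = z \<bullet> (c *\<^sub>R ?T x)" for z
    unfolding inner_scaleR_right T by (simp add: mult.left_commute)
  then show "?T (c *\<^sub>R x) = c *\<^sub>R ?T x" using vector_eq_ldot by blast
  show "0 \<le> x \<bullet> ?T x" unfolding T by (intro integral_nonneg_AE) (simp add: inner_commute)
  show bnd: "\<bar>x \<bullet> ?T y\<bar> \<le> norm y * (\<integral>v. \<bar>x \<bullet> v\<bar> \<partial>m)" for x y
  proof -
    have "\<bar>x \<bullet> ?T y\<bar> \<le> (\<integral>v. \<bar>(x \<bullet> v) * (v \<bullet> y)\<bar> \<partial>m)" unfolding T by (rule integral_abs_bound)
    also have "\<dots> \<le> (\<integral>v. norm y * \<bar>x \<bullet> v\<bar> \<partial>m)"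
      using integrable_abs[OF int[of x y]] inta[of x] b[of _ y]
      by (intro integral_mono) (auto simp: abs_mult inner_commute[of _ y] mult.commute[of "norm y"]
          intro!: mult_left_mono)
    finally show ?thesis by simp
  qed
  have "norm (?T x) * norm (?T x) \<le> norm x * norm (?T x)"
  proof -
    have "norm (?T x) * norm (?T x) = ?T x \<bullet> ?T x"
        by (simp add: power2_norm_eq_inner[symmetric] power2_eq_square)
    also have "\<dots> \<le> norm x * (\<integral>v. \<bar>?T x \<bullet> v\<bar> \<partial>m)" using bnd[of "?T x" x] by linarith
    also have "\<dots> \<le> norm x * norm (?T x)"
      using b inta by (intro mult_left_mono integral_le_const) auto
    finally show ?thesis .
  qed
  then show "norm (?T x) \<le> norm x" by (cases "?T x = 0") auto
qed

text \<open>Truncation to the first \<open>n\<close> basis vectors changes the image of a vector in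
  the unit ball by at most the m-mean of \<open>norm (v - ?p n v)\<close>, which tends to 0. The
  image is therefore uniformly close to a compact box.\<close>

lemma compact_closure_cov_op:
  assumes m: "m \<in> space (prob_algebra (unit_ball :: 'h measure))"
  shows "compact (closure (cov_op m ` cball 0 1))"
  unfolding compact_eq_totally_bounded complete_eq_closed
proof (intro conjI allI impI closed_closure)
  interpret prob_space m by (rule sets_unit_ball_space(2)[OF m])
  have [measurable]: "(\<lambda>v. v) \<in> borel_measurable m"
    using measurable_ident_unit_ball sets_unit_ball_space(1)[OF m]
        by (simp cong: measurable_cong_sets)
  have nv: "norm v \<le> 1" if "v \<in> space m" for v using sets_unit_ball_space(3)[OF m] that by simp
  let ?T = "cov_op m"
  let ?p = "\<lambda>n v. (\<Sum>i<n. (v \<bullet> e i) *\<^sub>R e i)"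
  have np: "norm (v - ?p n v) \<le> norm v" for n v
  proof (rule power2_le_imp_le)
    show "(norm (v - ?p n v))\<^sup>2 \<le> (norm v)\<^sup>2" by (simp add: norm_basis_expansion_diff[OF onb]
        sum_nonneg)
  qed simp
  have plim: "(\<lambda>n. norm (v - ?p n v)) \<longlonglongrightarrow> 0" for v
  proof -
    have "(\<lambda>n. sqrt ((norm v)\<^sup>2 - (\<Sum>i<n. (v \<bullet> e i)\<^sup>2))) \<longlonglongrightarrow> sqrt ((norm v)\<^sup>2 - (norm v)\<^sup>2)"
      using parseval[OF onb, of v] unfolding sums_def by (intro tendsto_intros)
    moreover have "sqrt ((norm v)\<^sup>2 - (\<Sum>i<n. (v \<bullet> e i)\<^sup>2)) = norm (v - ?p n v)" for n
      using norm_basis_expansion_diff[OF onb, of v n]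
          by (simp flip: norm_basis_expansion_diff[OF onb])
    ultimately show ?thesis by simp
  qed
  have elim: "(\<lambda>n. \<integral>v. norm (v - ?p n v) \<partial>m) \<longlonglongrightarrow> (\<integral>v. 0 \<partial>m)"
  proof (rule integral_dominated_convergence[where w = "\<lambda>_. 1"])
    show "AE v in m. norm (norm (v - ?p n v)) \<le> 1" for n
      using np nv by (intro AE_I2) (auto intro: order_trans)
  qed (use plim in auto)
  fix \<epsilon> :: real assume \<epsilon>: "\<epsilon> > 0"
  obtain n where n: "(\<integral>v. norm (v - ?p n v) \<partial>m) < \<epsilon> / 4"
  proof -
    have "eventually (\<lambda>n. (\<integral>v. norm (v - ?p n v) \<partial>m) < \<epsilon> / 4) sequentially"
      using elim \<epsilon> by (intro order_tendstoD) auto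
    then show thesis using that by (auto simp: eventually_sequentially)
  qed
  have near: "norm (?T x - ?p n (?T x)) \<le> \<epsilon> / 4" if x: "norm x \<le> 1" for x
  proof -
    let ?u = "?T x - ?p n (?T x)"
    have sym: "a \<bullet> ?p n b = ?p n a \<bullet> b" for a b
        by (simp add: inner_sum_left inner_sum_right inner_commute mult.commute)
    have inti: "integrable m (\<lambda>v. norm (v - ?p n v))"
      by (rule integrable_const_bound[where B = 1]) (use np nv in \<open>auto intro!: AE_I2 intro:
          order_trans\<close>)
    \<comment> \<open>The sections are symmetric, so testing against \<open>u\<close> moves the
      truncation from the operator onto the sample vector.\<close>
    have le: "u \<bullet> ?u \<le> norm u * (\<epsilon> / 4)" for u
    proof -
      have "u \<bullet> ?u = (u - ?p n u) \<bullet> ?T x" by (simp add: inner_diff_left inner_diff_right sym)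
      also have "\<dots> \<le> norm x * (\<integral>v. \<bar>(u - ?p n u) \<bullet> v\<bar> \<partial>m)"
          using cov_op_properties(6)[OF m, of "u - ?p n u" x] by linarith
      also have "\<dots> \<le> 1 * (\<integral>v. \<bar>(u - ?p n u) \<bullet> v\<bar> \<partial>m)" using x by (intro mult_right_mono) auto
      also have "(\<integral>v. \<bar>(u - ?p n u) \<bullet> v\<bar> \<partial>m) \<le> (\<integral>v. norm u * norm (v - ?p n v) \<partial>m)"
      proof (rule integral_mono)
        show "integrable m (\<lambda>v. \<bar>(u - ?p n u) \<bullet> v\<bar>)" by (rule cov_op_properties(8)[OF m])
        show "integrable m (\<lambda>v. norm u * norm (v - ?p n v))" using inti by simp
        fix v
        have "(u - ?p n u) \<bullet> v = u \<bullet> (v - ?p n v)"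
            by (simp add: inner_diff_left inner_diff_right sym)
        then show "\<bar>(u - ?p n u) \<bullet> v\<bar> \<le> norm u * norm (v - ?p n v)"
            by (simp add: Cauchy_Schwarz_ineq2)
      qed
      also have "(\<integral>v. norm u * norm (v - ?p n v) \<partial>m) \<le> norm u * (\<epsilon> / 4)"
          using mult_left_mono[OF less_imp_le[OF n], of "norm u"] by simp
      finally show ?thesis by simp
    qed
    have "norm ?u * norm ?u \<le> norm ?u * (\<epsilon> / 4)"
      using le[of ?u] by (simp add: power2_norm_eq_inner[symmetric] power2_eq_square)
    then show ?thesis using \<epsilon> by (cases "?u = 0") auto
  qed
  let ?K = "{x. \<exists>a. (\<forall>i<n. \<bar>a i\<bar> \<le> 1) \<and> x = (\<Sum>i<n. a i *\<^sub>R e i)}"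
  obtain k where k: "finite k" "?K \<subseteq> (\<Union>x\<in>k. ball x (\<epsilon>/4))"
    using compact_basis_box[of n] \<epsilon> unfolding compact_eq_totally_bounded
        by (meson divide_pos_pos zero_less_numeral)
  \<comment> \<open>Truncation and net contribute \<epsilon>/4 each. Closed balls of radius
    \<epsilon>/2 survive the passage to the closure and fit into open balls of radius
    \<epsilon>.\<close>
  have "?T ` cball 0 1 \<subseteq> (\<Union>x\<in>k. cball x (\<epsilon> / 2))"
  proof clarify
    fix x :: 'h assume "x \<in> cball 0 1"
    then have x: "norm x \<le> 1" by simp
    have "?p n (?T x) \<in> ?K"
    proof (intro CollectI exI[of _ "\<lambda>i. ?T x \<bullet> e i"] conjI allI impI refl)
      fix i
      have "\<bar>?T x \<bullet> e i\<bar> \<le> norm (?T x) * norm (e i)" by (rule Cauchy_Schwarz_ineq2)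
      also have "\<dots> \<le> 1 * 1" using cov_op_properties(5)[OF m, of x] x norm_basis[OF onb]
          by (intro mult_mono) auto
      finally show "\<bar>?T x \<bullet> e i\<bar> \<le> 1" by simp
    qed
    then obtain z where z: "z \<in> k" "dist z (?p n (?T x)) < \<epsilon> / 4" using k(2)
        by (auto simp: ball_def)
    have "dist z (?T x) \<le> dist z (?p n (?T x)) + dist (?p n (?T x)) (?T x)" by (rule dist_triangle)
    also have "dist (?p n (?T x)) (?T x) = norm (?T x - ?p n (?T x))"
        by (simp add: dist_norm norm_minus_commute)
    finally have "dist z (?T x) \<le> \<epsilon> / 2" using z near[OF x] by linarith
    then show "?T x \<in> (\<Union>x\<in>k. cball x (\<epsilon> / 2))" using z by auto
  qed
  moreover have "closed (\<Union>x\<in>k. cball x (\<epsilon> / 2))" using k(1) by (intro closed_UN) auto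
  ultimately have "closure (?T ` cball 0 1) \<subseteq> (\<Union>x\<in>k. cball x (\<epsilon> / 2))" by (rule closure_minimal)
  also have "\<dots> \<subseteq> (\<Union>x\<in>k. ball x \<epsilon>)" using \<epsilon> by (intro UN_mono) (auto simp: cball_def ball_def)
  finally show "\<exists>k. finite k \<and> closure (?T ` cball 0 1) \<subseteq> (\<Union>x\<in>k. ball x \<epsilon>)" using k(1) by blast
qed

text \<open>The maximum of the quadratic form on the invariant subspace \<open>W\<close> is attained by
  compactness, at an eigenvector.\<close>

lemma cov_op_eigenvector:
  assumes m: "m \<in> space (prob_algebra (unit_ball :: 'h measure))"
    and W: "subspace W" "closed W" "\<And>x. x \<in> W \<Longrightarrow> cov_op m x \<in> W"
    and x0: "x0 \<in> W" "x0 \<bullet> cov_op m x0 \<noteq> 0"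
  obtains a z where "a \<noteq> 0" "z \<in> W" "z \<noteq> 0" "cov_op m z = a *\<^sub>R z"
proof -
  let ?T = "cov_op m"
  note T = cov_op_properties[OF m]
  define Q where "Q = {x \<bullet> ?T x | x. x \<in> W \<and> norm x \<le> 1}"
  have Qb: "q \<le> 1" if q: "q \<in> Q" for q
  proof -
    obtain x where x: "q = x \<bullet> ?T x" "norm x \<le> 1" using q unfolding Q_def by blast
    have "x \<bullet> ?T x \<le> norm x * norm (?T x)" by (rule norm_cauchy_schwarz)
    also have "\<dots> \<le> 1 * 1" using x(2) T(5)[of x] by (intro mult_mono) auto
    finally show ?thesis using x by simp
  qed
  have bdd: "bdd_above Q" using Qb by (auto simp: bdd_above_def)
  have Q0: "0 \<in> Q" unfolding Q_def using subspace_0[OF W(1)] by (intro CollectI exI[of _ 0]) auto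
  define \<kappa> where "\<kappa> = Sup Q"
  have scaled: "x \<bullet> ?T x \<le> \<kappa> * (norm x)\<^sup>2" if x: "x \<in> W" for x
  proof (cases "x = 0")
    case False
    let ?y = "x /\<^sub>R norm x"
    have "?y \<in> W" "norm ?y \<le> 1" using x W(1) False by (auto simp: subspace_scale)
    then have "?y \<bullet> ?T ?y \<in> Q" unfolding Q_def by blast
    then have "?y \<bullet> ?T ?y \<le> \<kappa>" unfolding \<kappa>_def using bdd by (rule cSup_upper)
    then show ?thesis using False by (simp add: T(3) field_simps power2_eq_square)
  qed simp
  have \<kappa>: "\<kappa> > 0"
  proof -
    have "0 < x0 \<bullet> ?T x0" using T(4)[of x0] x0(2) by simp
    then have "0 < \<kappa> * (norm x0)\<^sup>2" using scaled[OF x0(1)] by linarith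
    then show ?thesis by (simp add: zero_less_mult_iff)
  qed
  \<comment> \<open>Positivity of the form at \<open>x - (1 / \<kappa>) *\<^sub>R ?T x\<close>,
    combined with the upper bound by \<kappa> at \<open>?T x\<close>, which lies in
    \<open>W\<close>.\<close>
  have Tle: "(norm (?T x))\<^sup>2 \<le> \<kappa> * (x \<bullet> ?T x)" if x: "x \<in> W" for x
  proof -
    let ?y = "?T x"
    have yW: "?y \<in> W" using W(3)[OF x] .
    let ?s = "1 / \<kappa>"
    have "0 \<le> (x - ?s *\<^sub>R ?y) \<bullet> ?T (x - ?s *\<^sub>R ?y)" by (rule T(4))
    also have "\<dots> = x \<bullet> ?y - 2 * ?s * (?y \<bullet> ?y) + ?s * ?s * (?y \<bullet> ?T ?y)"
      by (simp add: T(2,3) inner_diff_left inner_diff_right T(1)[of x ?y] algebra_simps)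
    also have "\<dots> \<le> x \<bullet> ?y - 2 * ?s * (?y \<bullet> ?y) + ?s * ?s * (\<kappa> * (norm ?y)\<^sup>2)"
      using scaled[OF yW] by (intro add_left_mono mult_left_mono) auto
    also have "\<dots> = x \<bullet> ?y - ?s * (norm ?y)\<^sup>2"
      using \<kappa> by (simp add: power2_norm_eq_inner field_simps)
    finally show ?thesis using \<kappa> by (simp add: field_simps)
  qed
  have "\<exists>x. x \<in> W \<and> norm x \<le> 1 \<and> \<kappa> - 1 / Suc n < x \<bullet> ?T x" for n :: nat
  proof -
    have "\<kappa> - 1 / Suc n < Sup Q" by (simp add: \<kappa>_def)
    then obtain q where "q \<in> Q" "\<kappa> - 1 / Suc n < q" using less_cSup_iff[of Q] Q0 bdd by blast
    then show ?thesis by (auto simp: Q_def)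
  qed
  then obtain x where x: "\<And>n. x n \<in> W" "\<And>n. norm (x n) \<le> 1" "\<And>n::nat. \<kappa> - 1 / Suc n
      < x n \<bullet> ?T (x n)" by metis
  have xle: "x n \<bullet> ?T (x n) \<le> \<kappa>" for n
  proof -
    have "x n \<bullet> ?T (x n) \<in> Q" unfolding Q_def using x(1,2) by blast
    then show ?thesis unfolding \<kappa>_def using bdd by (rule cSup_upper)
  qed
  have q: "(\<lambda>n. x n \<bullet> ?T (x n)) \<longlonglongrightarrow> \<kappa>"
  proof (rule tendsto_sandwich[of "\<lambda>n. \<kappa> - 1 / Suc n" _ _ "\<lambda>_. \<kappa>"])
    show "(\<lambda>n. \<kappa> - 1 / real (Suc n)) \<longlonglongrightarrow> \<kappa>" using tendsto_diff[OF tendsto_const LIMSEQ_Suc[OF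
        lim_1_over_n], of \<kappa>] by simp
  qed (use x(3) xle in \<open>auto intro: less_imp_le always_eventually\<close>)
  \<comment> \<open>A maximising sequence consists of approximate eigenvectors: the squared defect
    is controlled by the distance of the form from its supremum.\<close>
  have d0: "(\<lambda>n. norm (?T (x n) - \<kappa> *\<^sub>R x n)) \<longlonglongrightarrow> 0"
  proof -
    have "(norm (?T (x n) - \<kappa> *\<^sub>R x n))\<^sup>2 \<le> \<kappa> * (\<kappa> - x n \<bullet> ?T (x n))" for n
    proof -
      have "(norm (?T (x n) - \<kappa> *\<^sub>R x n))\<^sup>2 = (norm (?T (x n)))\<^sup>2 - 2 * \<kappa> * (x n \<bullet> ?T (x n)) + \<kappa>\<^sup>2 *
          (norm (x n))\<^sup>2"
        unfolding power2_norm_eq_inner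
        by (simp add: inner_diff_left inner_diff_right inner_commute[of "?T (x n)" "x n"]
            power2_eq_square[of \<kappa>] algebra_simps)
      also have "\<dots> \<le> \<kappa> * (x n \<bullet> ?T (x n)) - 2 * \<kappa> * (x n \<bullet> ?T (x n)) + \<kappa>\<^sup>2 * 1"
        using Tle[OF x(1)[of n]] x(2)[of n] \<kappa> by (intro add_mono diff_mono mult_left_mono) (auto
            simp: power_le_one)
      finally show ?thesis by (simp add: algebra_simps power2_eq_square)
    qed
    moreover have "(\<lambda>n. \<kappa> * (\<kappa> - x n \<bullet> ?T (x n))) \<longlonglongrightarrow> 0"
      using tendsto_mult[OF tendsto_const[of \<kappa>] tendsto_diff[OF tendsto_const[of \<kappa>] q]] by simp
    ultimately have "(\<lambda>n. (norm (?T (x n) - \<kappa> *\<^sub>R x n))\<^sup>2) \<longlonglongrightarrow> 0"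
      by - (rule tendsto_sandwich[of "\<lambda>_. 0" _ _ "\<lambda>n. \<kappa> * (\<kappa> - x n \<bullet> ?T (x n))"], auto intro:
          always_eventually)
    then have "(\<lambda>n. sqrt ((norm (?T (x n) - \<kappa> *\<^sub>R x n))\<^sup>2)) \<longlonglongrightarrow> sqrt 0" by (rule tendsto_real_sqrt)
    then show ?thesis by simp
  qed
  have "seq_compact (closure (?T ` cball 0 1))"
    by (intro compact_imp_seq_compact compact_closure_cov_op[OF m])
  moreover have "\<forall>n. ?T (x n) \<in> closure (?T ` cball 0 1)"
    using x(2) by (auto intro!: subsetD[OF closure_subset])
  ultimately obtain y r where r: "strict_mono (r :: nat \<Rightarrow> nat)" "((\<lambda>n. ?T (x n)) \<circ> r) \<longlonglongrightarrow> y"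
    unfolding seq_compact_def by metis
  have Ty: "(\<lambda>n. ?T (x (r n))) \<longlonglongrightarrow> y" using r(2) by (simp add: o_def)
  have d0r: "(\<lambda>n. ?T (x (r n)) - \<kappa> *\<^sub>R x (r n)) \<longlonglongrightarrow> 0"
    using LIMSEQ_subseq_LIMSEQ[OF d0 r(1)] by (simp add: o_def tendsto_norm_zero_iff)
  \<comment> \<open>The images converge along \<open>r\<close>, and the defect tends to 0 with
    \<kappa> positive, so the vectors themselves converge.\<close>
  define z where "z = y /\<^sub>R \<kappa>"
  have xz: "(\<lambda>n. x (r n)) \<longlonglongrightarrow> z"
  proof -
    have "(\<lambda>n. (?T (x (r n)) - (?T (x (r n)) - \<kappa> *\<^sub>R x (r n))) /\<^sub>R \<kappa>) \<longlonglongrightarrow> (y - 0) /\<^sub>R \<kappa>"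
      using Ty d0r by (intro tendsto_intros)
    then show ?thesis using \<kappa> by (simp add: z_def)
  qed
  have "(\<lambda>n. ?T (x (r n))) \<longlonglongrightarrow> ?T z"
  proof -
    have "(\<lambda>n. norm (x (r n) - z)) \<longlonglongrightarrow> 0" using xz by (simp add: LIM_zero_iff tendsto_norm_zero_iff)
    moreover have "norm (?T (x (r n)) - ?T z) \<le> norm (x (r n) - z)" for n
        using T(5)[of "x (r n) - z"] by (simp add: T(2))
    ultimately have "(\<lambda>n. norm (?T (x (r n)) - ?T z)) \<longlonglongrightarrow> 0"
      by - (rule tendsto_sandwich[of "\<lambda>_. 0" _ _ "\<lambda>n. norm (x (r n) - z)"], auto intro:
          always_eventually)
    then show ?thesis by (simp add: LIM_zero_iff tendsto_norm_zero_iff)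
  qed
  then have "y = ?T z" by (rule LIMSEQ_unique[OF Ty])
  moreover have "y = \<kappa> *\<^sub>R z" using \<kappa> by (simp add: z_def)
  ultimately have Tz: "?T z = \<kappa> *\<^sub>R z" by metis
  have "(\<lambda>n. x (r n) \<bullet> ?T (x (r n))) \<longlonglongrightarrow> z \<bullet> y" using xz Ty by (rule tendsto_inner)
  moreover have "(\<lambda>n. x (r n) \<bullet> ?T (x (r n))) \<longlonglongrightarrow> \<kappa>"
    using LIMSEQ_subseq_LIMSEQ[OF q r(1)] by (simp add: o_def)
  ultimately have "z \<bullet> y = \<kappa>" by (rule LIMSEQ_unique)
  then have "z \<noteq> 0" using \<kappa> by auto
  moreover have "z \<in> W" by (rule closed_sequentially[OF W(2) x(1) xz])
  moreover have "\<kappa> \<noteq> 0" using \<kappa> by simp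
  ultimately show thesis using Tz by (intro that[of \<kappa> z])
qed

text \<open>On the orthogonal complement \<open>W\<close> of all eigenvectors with non-zero
  eigenvalue the quadratic form vanishes, since an eigenvector found there would be orthogonal to
  itself. The form at \<open>x\<close> is the mean square of \<open>x \<bullet> v\<close>, so each
  element of \<open>W\<close> is orthogonal to almost every \<open>v\<close>.\<close>

lemma mdim_finite_imp_carried_by_span:
  assumes m: "m \<in> space (prob_algebra (unit_ball :: 'h measure))" and dim: "mdim m \<noteq> \<infinity>"
  obtains C where "finite C" "pairwise orthogonal C" "AE v in m. v \<in> span C"
proof -
  let ?T = "cov_op m"
  note T = cov_op_properties[OF m]
  obtain N where N: "mdim m = enat N" using dim by (cases "mdim m") auto
  define K where "K = {x. \<exists>a. a \<noteq> 0 \<and> ?T x = a *\<^sub>R x}"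
  obtain B where B: "B \<subseteq> K" "finite B" "K \<subseteq> span B"
  proof (rule edim_le_imp_finite_span[of K N])
    fix B assume "B \<subseteq> K" "finite B" "independent B"
    then show "card B \<le> N" by (intro independent_eigenvectors_card_le[OF N]) (auto simp: K_def)
  qed
  obtain C where C: "finite C" "span C = span B" "pairwise orthogonal C"
    using basis_orthogonal[OF B(2)] by blast
  define W where "W = {x. \<forall>b\<in>B. x \<bullet> b = 0}"
  have W: "subspace W" "closed W"
  proof -
    show "subspace W" by (auto simp: W_def subspace_def inner_add_left)
    have "W = (\<Inter>b\<in>B. {x. x \<bullet> b = 0})" by (auto simp: W_def)
    moreover have "closed {x. x \<bullet> b = 0}" for b :: 'h by (intro closed_Collect_eq continuous_intros)
    ultimately show "closed W" by auto
  qed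
  have TW: "?T x \<in> W" if "x \<in> W" for x
    unfolding W_def
  proof (intro CollectI ballI)
    fix b assume b: "b \<in> B"
    then obtain a where "?T b = a *\<^sub>R b" using B(1) by (auto simp: K_def)
    then show "?T x \<bullet> b = 0" using that b T(1)[of x b] by (simp add: W_def)
  qed
  have orth: "x \<bullet> y = 0" if "x \<in> W" "y \<in> span B" for x y
    using that(2)
  proof (induction rule: span_induct_alt)
    case (step c b y)
    then show ?case using that(1) by (simp add: W_def inner_add_right)
  qed simp
  have zero: "x \<bullet> ?T x = 0" if x: "x \<in> W" for x
  proof (rule ccontr)
    assume "x \<bullet> ?T x \<noteq> 0"
    then obtain a z where z: "a \<noteq> 0" "z \<in> W" "z \<noteq> 0" "?T z = a *\<^sub>R z"
      using cov_op_eigenvector[OF m W TW x] by blast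
    then have "z \<in> span B" using B(3) by (auto simp: K_def)
    then have "z \<bullet> z = 0" using orth z(2) by blast
    then show False using z(3) by simp
  qed
  let ?p = "\<lambda>v. (\<Sum>b\<in>C. (v \<bullet> b / (b \<bullet> b)) *\<^sub>R b)"
  have sym: "u \<bullet> ?p v = ?p u \<bullet> v" for u v
    by (simp add: inner_sum_left inner_sum_right inner_commute mult.commute)
  have pspan: "?p v \<in> span C" for v by (intro span_sum span_scale span_base)
  \<comment> \<open>The residues of the basis vectors are countably many elements of
    \<open>W\<close> that together detect \<open>v - ?p v\<close>; one null set suffices.\<close>
  have xW: "e i - ?p (e i) \<in> W" for i
    unfolding W_def
  proof (intro CollectI ballI)
    fix b assume "b \<in> B"
    then have "b \<in> span C" using C(2) span_base by blast
    then have "?p b = b" using orthogonal_expansion[OF C(1,3)] by simp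
    then show "(e i - ?p (e i)) \<bullet> b = 0" using sym[of "e i" b] by (simp add: inner_diff_left)
  qed
  have "AE v in m. (e i - ?p (e i)) \<bullet> v = 0" for i
  proof -
    let ?x = "e i - ?p (e i)"
    have "(\<integral>v. (?x \<bullet> v) * (v \<bullet> ?x) \<partial>m) = 0" using zero[OF xW] cov_op_inner[OF m] by metis
    then have "AE v in m. (?x \<bullet> v) * (v \<bullet> ?x) = 0"
      using T(7)[of ?x ?x] by (subst (asm) integral_nonneg_eq_0_iff_AE) (auto simp: inner_commute)
    then show ?thesis by eventually_elim (simp add: inner_commute)
  qed
  then have "AE v in m. \<forall>i. (e i - ?p (e i)) \<bullet> v = 0" by (simp add: AE_all_countable)
  then have "AE v in m. v \<in> span C"
  proof eventually_elim
    case (elim v)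
    have "(v - ?p v) \<bullet> e i = 0" for i
      using elim[rule_format, of i] sym[of "e i" v]
          by (simp add: inner_diff_left inner_diff_right inner_commute)
    then have "v - ?p v = 0" by (rule eq_0_if_orthogonal_basis)
    then show ?case using pspan[of v] by simp
  qed
  then show thesis using that C by blast
qed

end

section \<open>Finite rank seen from the overlaps\<close>

text \<open>A set of positive mass is missed by \<open>k\<close> consecutive samples with
  probability \<open>p ^ k\<close>, where \<open>p < 1\<close>.\<close>

lemma emeasure_iid_tail_null:
  assumes m: "prob_space m" and A: "A \<in> sets m" "emeasure m A \<noteq> 0"
  shows "AE v in iid m. \<exists>j\<ge>n. v j \<in> A"
proof -
  interpret sequence_space m by (rule sequence_space_prob_space[OF m])
  note A(1)[measurable]
  let ?N = "{v\<in>space (iid m). \<forall>j\<ge>n. v j \<notin> A}"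
  define p where "p = measure m (space m - A)"
  have p: "0 \<le> p" "p < 1"
  proof -
    have "p = 1 - measure m A" unfolding p_def using A(1) by (rule M.prob_compl)
    moreover have "0 < measure m A" using A(2)
        by (simp add: M.emeasure_eq_measure zero_less_measure_iff)
    ultimately show "p < 1" by simp
  qed (simp add: p_def)
  have le: "emeasure (iid m) ?N \<le> ennreal (p ^ k)" for k
  proof -
    have "emeasure (iid m) ?N \<le> emeasure (iid m) {v\<in>space (iid m). \<forall>j\<in>{n..<n+k}. v j \<in> space m - A}"
    proof (rule emeasure_mono)
      show "?N \<subseteq> {v\<in>space (iid m). \<forall>j\<in>{n..<n+k}. v j \<in> space m - A}" by (auto simp: space_PiM)
      have "Measurable.pred (iid m) (\<lambda>v. \<forall>j\<in>{n..<n+k}. v j \<in> space m - A)" by measurable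
      then show "{v\<in>space (iid m). \<forall>j\<in>{n..<n+k}. v j \<in> space m - A} \<in> sets (iid m)"
          by (simp only: pred_def)
    qed
    also have "\<dots> = (\<Prod>j\<in>{n..<n+k}. emeasure m (space m - A))"
      using A(1) by (intro emeasure_PiM_Collect) auto
    also have "\<dots> = ennreal (p ^ k)" by (simp add: p_def M.emeasure_eq_measure ennreal_power)
    finally show ?thesis .
  qed
  have "(\<lambda>k. ennreal (p ^ k)) \<longlonglongrightarrow> ennreal 0"
    using p by (intro tendsto_ennrealI LIMSEQ_power_zero) auto
  then have "emeasure (iid m) ?N \<le> ennreal 0" using le by (intro LIMSEQ_le_const) auto
  moreover have "?N \<in> sets (iid m)" by measurable
  ultimately have "?N \<in> null_sets (iid m)" by auto
  then show ?thesis by (rule AE_I') auto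
qed

text \<open>The first clause lets an index be replaced by a later one outside any finite set, so
  that off-diagonal overlaps also give access to squared norms. The second says that the sample is
  dense in the support.\<close>

definition good_sample :: "'a::topological_space measure \<Rightarrow> (nat \<Rightarrow> 'a) \<Rightarrow> bool" where
  "good_sample m v \<longleftrightarrow>
     (\<forall>U i n. open U \<longrightarrow> v i \<in> U \<longrightarrow> (\<exists>j\<ge>n. v j \<in> U)) \<and>
     (\<forall>S. closed S \<longrightarrow> range v \<subseteq> S \<longrightarrow> (AE x in m. x \<in> S))"

text \<open>Over a countable basis: a null basic set is almost surely never hit, any other is hit
  infinitely often. Both clauses follow from this dichotomy.\<close>

lemma AE_good_sample:
  fixes m :: "'h::{real_inner, banach, second_countable_topology} measure"
  assumes m: "m \<in> space (prob_algebra unit_ball)"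
  shows "AE v in iid m. good_sample m v"
proof -
  note pm = sets_unit_ball_space(2)[OF m]
  interpret sequence_space m by (rule sequence_space_prob_space[OF pm])
  have id[measurable]: "(\<lambda>v. v) \<in> borel_measurable m"
    using measurable_ident_unit_ball sets_unit_ball_space(1)[OF m]
        by (simp cong: measurable_cong_sets)
  obtain B :: "'h set set" where B: "countable B" "topological_basis B" using ex_countable_basis
      by blast
  have opB: "open U" if "U \<in> B" for U using topological_basis_open[OF B(2) that] .
  have "AE v in iid m. (\<forall>n. \<exists>j\<ge>n. v j \<in> U) \<or> ((AE x in m. x \<notin> U) \<and> (\<forall>i. v i \<notin> U))" if U: "U \<in> B"
      for U
  proof -
    have Us: "U \<inter> space m \<in> sets m"
      using measurable_sets[OF id, of U] opB[OF U] by simp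
    show ?thesis
    proof (cases "emeasure m (U \<inter> space m) = 0")
      case True
      then have null: "AE x in m. x \<notin> U"
        using Us by (intro AE_I[of _ _ "U \<inter> space m"]) auto
      have "AE v in iid m. \<forall>i. v i \<notin> U"
        unfolding AE_all_countable
        by (intro allI AE_component[of _ "\<lambda>x. x \<notin> U"] null) simp
      then show ?thesis by (rule eventually_mono) (use null in blast)
    next
      case False
      have "AE v in iid m. \<forall>n. \<exists>j\<ge>n. v j \<in> U \<inter> space m"
        unfolding AE_all_countable using emeasure_iid_tail_null[OF pm Us False] by blast
      then show ?thesis by eventually_elim blast
    qed
  qed
  then have "AE v in iid m. \<forall>U\<in>B. (\<forall>n. \<exists>j\<ge>n. v j \<in> U) \<or> ((AE x in m. x \<notin> U) \<and> (\<forall>i. v i \<notin> U))"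
    using B(1) by (simp add: AE_ball_countable)
  then show ?thesis
  proof eventually_elim
    case (elim v)
    show ?case unfolding good_sample_def
    proof (intro conjI allI impI)
      fix U i n assume "open U" "v i \<in> U"
      then obtain U' where U': "U' \<in> B" "v i \<in> U'" "U' \<subseteq> U"
        using B(2) by (meson topological_basisE)
      then show "\<exists>j\<ge>n. v j \<in> U" using elim by blast
    next
      fix S assume S: "closed S" "range v \<subseteq> S"
      let ?B = "{U\<in>B. U \<subseteq> - S}"
      have "AE x in m. x \<notin> U" if "U \<in> ?B" for U
      proof -
        have "v j \<notin> U" for j using that S(2) by auto
        then show ?thesis using elim that by blast
      qed
      then have "AE x in m. \<forall>U\<in>?B. x \<notin> U"
        using B(1) by (subst AE_ball_countable) auto
      then show "AE x in m. x \<in> S"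
      proof eventually_elim
        case (elim x)
        show ?case
        proof (rule ccontr)
          assume "x \<notin> S"
          then obtain U where "U \<in> B" "x \<in> U" "U \<subseteq> - S"
            using B(2) S(1) by (meson ComplI open_Compl topological_basisE)
          then show False using elim by blast
        qed
      qed
    qed
  qed
qed

text \<open>Rational coefficients and countable quantifiers make the event measurable. The
  condition says that a linear combination of \<open>v (I ! 0), \<dots>, v (I ! (N - 1))\<close> with a unit
  coefficient is nearly orthogonal to the rest of the sample; only off-diagonal overlaps occur.\<close>

definition finite_rank_event :: "(nat \<times> nat \<Rightarrow> real) set" where
  "finite_rank_event = {q. \<exists>N. \<forall>I. distinct I \<longrightarrow> length I = N \<longrightarrow>
     (\<exists>p<N. \<forall>k. \<exists>r::rat list. r ! p = 1 \<and>
        (\<forall>j. j \<notin> set I \<longrightarrow> \<bar>\<Sum>i<N. of_rat (r ! i) * q (I ! i, j)\<bar> \<le> 1 / real (Suc k)))}"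

lemma finite_rank_event_sets: "finite_rank_event \<in> sets matrix_space"
proof -
  have [measurable]: "(\<lambda>q. q p) \<in> borel_measurable matrix_space" for p
    unfolding matrix_space_def by measurable
  have "{q\<in>space matrix_space. \<exists>N. \<forall>I. distinct I \<longrightarrow> length I = N \<longrightarrow>
     (\<exists>p\<in>{..<N}. \<forall>k. \<exists>r::rat list. r ! p = 1 \<and>
        (\<forall>j. j \<notin> set I \<longrightarrow> \<bar>\<Sum>i<N. of_rat (r ! i) * q (I ! i, j)\<bar> \<le> 1 / real (Suc k)))}
            \<in> sets matrix_space"
    by measurable
  then show ?thesis by (simp add: finite_rank_event_def matrix_space_def space_PiM Bex_def
      lessThan_def)
qed

text \<open>Indices are counted, not values: a repetition gives the relation with coefficients 1 and
  -1, and otherwise the values are linearly dependent.\<close>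

lemma family_linear_relation:
  fixes w :: "nat \<Rightarrow> 'h::real_vector"
  assumes C: "finite C" "card C < N" and w: "\<And>i. i < N \<Longrightarrow> w i \<in> span C"
  obtains x p where "p < N" "x p = (1::real)" "(\<Sum>i<N. x i *\<^sub>R w i) = 0"
proof -
  have "\<exists>x. (\<exists>p<N. x p \<noteq> (0::real)) \<and> (\<Sum>i<N. x i *\<^sub>R w i) = 0"
  proof (cases "inj_on w {..<N}")
    case False
    then obtain i j where ij: "i < N" "j < N" "i \<noteq> j" "w i = w j" by (auto simp: inj_on_def)
    let ?x = "\<lambda>k. if k = i then 1 else if k = j then -1 else (0::real)"
    have "(\<Sum>k<N. ?x k *\<^sub>R w k) = (\<Sum>k\<in>{i, j}. ?x k *\<^sub>R w k)"
      using ij by (intro sum.mono_neutral_right) auto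
    also have "\<dots> = 0" using ij by simp
    finally show ?thesis using ij by (intro exI[of _ ?x]) auto
  next
    case True
    have "\<not> independent (w ` {..<N})"
    proof
      assume "independent (w ` {..<N})"
      then have "card (w ` {..<N}) \<le> card C"
        using independent_span_bound[OF C(1), of "w ` {..<N}"] w by auto
      then show False using C(2) True by (simp add: card_image)
    qed
    then obtain u where u: "\<exists>v\<in>w ` {..<N}. u v \<noteq> 0" "(\<Sum>v\<in>w ` {..<N}. u v *\<^sub>R v) = 0"
      using dependent_finite[of "w ` {..<N}"] by auto
    then show ?thesis using True by (intro exI[of _ "u \<circ> w"]) (auto simp: sum.reindex)
  qed
  then obtain x p where x: "p < N" "x p \<noteq> (0::real)" "(\<Sum>i<N. x i *\<^sub>R w i) = 0" by blast
  have "(\<Sum>i<N. (x i / x p) *\<^sub>R w i) = (1 / x p) *\<^sub>R (\<Sum>i<N. x i *\<^sub>R w i)"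
    by (simp add: scaleR_sum_right)
  then show thesis using that[of p "\<lambda>i. x i / x p"] x by simp
qed

text \<open>Any \<open>card C + 1\<close> samples satisfy a linear relation with one coefficient
  equal to 1. For \<open>j\<close> outside \<open>I\<close> the matrix entries are true inner
  products, so only the rational approximation of the coefficients causes an error.\<close>

lemma gram_matrix_in_finite_rank_event:
  fixes v :: "nat \<Rightarrow> 'h::real_inner"
  assumes C: "finite C" and v: "\<And>i. v i \<in> span C" "\<And>i. norm (v i) \<le> 1"
  shows "gram_matrix v \<in> finite_rank_event"
  unfolding finite_rank_event_def mem_Collect_eq
proof (rule exI[of _ "Suc (card C)"], intro allI impI)
  fix I :: "nat list"
  let ?N = "Suc (card C)"
  assume I: "distinct I" "length I = ?N"
  obtain x p where x: "p < ?N" "x p = (1::real)" "(\<Sum>i<?N. x i *\<^sub>R v (I ! i)) = 0"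
    using family_linear_relation[OF C lessI, of "\<lambda>i. v (I ! i)"] v(1) by blast
  show "\<exists>p<?N. \<forall>k. \<exists>r::rat list. r ! p = 1 \<and>
        (\<forall>j. j \<notin> set I \<longrightarrow> \<bar>\<Sum>i<?N. of_rat (r ! i) * gram_matrix v (I ! i, j)\<bar> \<le> 1 / real (Suc k))"
  proof (intro exI[of _ p] conjI allI)
    fix k
    \<comment> \<open>Errors of \<open>1 / (?N * Suc k)\<close> add up to \<open>1 / Suc k\<close>
      over the \<open>?N\<close> terms; the coefficient at \<open>p\<close> is kept exact.\<close>
    have "\<exists>r::rat. \<bar>of_rat r - x i\<bar> \<le> 1 / (?N * Suc k) \<and> (i = p \<longrightarrow> r = 1)" for i
    proof (cases "i = p")
      case False
      have "x i < x i + 1 / (?N * Suc k)" by (simp add: add_pos_nonneg)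
      then obtain r where "x i < of_rat r" "of_rat r < x i + 1 / (?N * Suc k)" using of_rat_dense
          by blast
      then show ?thesis using False by (intro exI[of _ r]) auto
    qed (use x(2) in \<open>auto intro: exI[of _ 1]\<close>)
    then obtain f where f: "\<And>i. \<bar>of_rat (f i) - x i\<bar> \<le> 1 / (?N * Suc k)" "f p = (1::rat)" by metis
    show "\<exists>r::rat list. r ! p = 1 \<and>
        (\<forall>j. j \<notin> set I \<longrightarrow> \<bar>\<Sum>i<?N. of_rat (r ! i) * gram_matrix v (I ! i, j)\<bar> \<le> 1 / real (Suc k))"
    proof (intro exI[of _ "map f [0..<?N]"] conjI allI impI)
      have nth: "map f [0..<?N] ! i = f i" if "i < ?N" for i using that by (simp del: upt_Suc)
      show "map f [0..<?N] ! p = 1" using nth[OF x(1)] f(2) by simp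
      fix j assume j: "j \<notin> set I"
      have "(\<Sum>i<?N. of_rat (map f [0..<?N] ! i) * gram_matrix v (I ! i, j))
          = (\<Sum>i<?N. of_rat (f i) * (v (I ! i) \<bullet> v j))"
      proof (intro sum.cong refl)
        fix i assume "i \<in> {..<?N}"
        then have i: "i < ?N" "I ! i \<noteq> j" using j I(2) nth_mem by fastforce+
        then show "of_rat (map f [0..<?N] ! i) * gram_matrix v (I ! i, j)
            = of_rat (f i) * (v (I ! i) \<bullet> v j)"
          by (simp only: nth gram_matrix_def case_prod_conv if_False)
      qed
      also have "\<dots> = (\<Sum>i<?N. (of_rat (f i) - x i) * (v (I ! i) \<bullet> v j)) + (\<Sum>i<?N. x i *\<^sub>R v (I ! i)) \<bullet>
          v j"
        by (simp add: inner_sum_left left_diff_distrib sum_subtractf del: sum.lessThan_Suc)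
      also have "\<dots> = (\<Sum>i<?N. (of_rat (f i) - x i) * (v (I ! i) \<bullet> v j))" using x(3) by simp
      finally have eq: "(\<Sum>i<?N. of_rat (map f [0..<?N] ! i) * gram_matrix v (I ! i, j)) = \<dots>" .
      have "\<bar>\<Sum>i<?N. (of_rat (f i) - x i) * (v (I ! i) \<bullet> v j)\<bar> \<le> (\<Sum>i<?N. 1 / (?N * Suc k))"
      proof (rule order_trans[OF sum_abs sum_mono])
        fix i
        have "\<bar>v (I ! i) \<bullet> v j\<bar> \<le> norm (v (I ! i)) * norm (v j)" by (rule Cauchy_Schwarz_ineq2)
        also have "\<dots> \<le> 1 * 1" using v(2) by (intro mult_mono) auto
        finally have "\<bar>of_rat (f i) - x i\<bar> * \<bar>v (I ! i) \<bullet> v j\<bar> \<le> 1 / (?N * Suc k) * 1"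
          using f(1)[of i] by (intro mult_mono) auto
        then show "\<bar>(of_rat (f i) - x i) * (v (I ! i) \<bullet> v j)\<bar> \<le> 1 / (?N * Suc k)"
            by (simp add: abs_mult)
      qed
      also have "\<dots> = 1 / real (Suc k)" by (simp del: of_nat_Suc mult_Suc mult_Suc_right)
      finally show "\<bar>\<Sum>i<?N. of_rat (map f [0..<?N] ! i) * gram_matrix v (I ! i, j)\<bar>
          \<le> 1 / real (Suc k)"
        unfolding eq .
    qed
  qed (fact x(1))
qed

text \<open>The span is the fixed-point set of the projection, which is continuous.\<close>

lemma closed_span_orthogonal:
  fixes C :: "'h::real_inner set"
  assumes "finite C" "pairwise orthogonal C"
  shows "closed (span C)"
proof -
  have "span C = {v. v = (\<Sum>b\<in>C. (v \<bullet> b / (b \<bullet> b)) *\<^sub>R b)}"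
  proof (intro set_eqI iffI)
    fix v assume "v \<in> {v. v = (\<Sum>b\<in>C. (v \<bullet> b / (b \<bullet> b)) *\<^sub>R b)}"
    then have "v = (\<Sum>b\<in>C. (v \<bullet> b / (b \<bullet> b)) *\<^sub>R b)" by simp
    also have "\<dots> \<in> span C" by (intro span_sum span_scale span_base)
    finally show "v \<in> span C" .
  qed (use orthogonal_expansion[OF assms] in auto)
  moreover have "closed {v. v = (\<Sum>b\<in>C. (v \<bullet> b / (b \<bullet> b)) *\<^sub>R b)}"
    unfolding divide_inverse
    by (intro closed_Collect_eq continuous_on_sum continuous_on_scaleR continuous_on_mult
        continuous_on_inner continuous_on_const continuous_on_id)
  ultimately show ?thesis by simp
qed

text \<open>\<open>w\<close> minus its projection onto \<open>span F\<close>. Pairing with this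
  vector isolates the coefficient of \<open>w\<close> in a combination of \<open>w\<close> and
  \<open>F\<close>.\<close>

lemma orthogonal_component:
  fixes w :: "'h::real_inner"
  assumes F: "finite F" and w: "w \<notin> span F"
  obtains u where "u \<in> span (insert w F)" "u \<noteq> 0" "\<And>b. b \<in> F \<Longrightarrow> b \<bullet> u = 0" "w \<bullet> u = u \<bullet> u"
proof -
  obtain C where C: "finite C" "span C = span F" "pairwise orthogonal C"
    using basis_orthogonal[OF F] by blast
  let ?p = "\<lambda>v. (\<Sum>b\<in>C. (v \<bullet> b / (b \<bullet> b)) *\<^sub>R b)"
  have sym: "x \<bullet> ?p y = ?p x \<bullet> y" for x y
    by (simp add: inner_sum_left inner_sum_right inner_commute mult.commute)
  have pC: "?p v \<in> span F" for v unfolding C(2)[symmetric] by (intro span_sum span_scale span_base)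
  have id: "?p y = y" if "y \<in> span F" for y using orthogonal_expansion[OF C(1,3)] that C(2) by simp
  have orth: "y \<bullet> (w - ?p w) = 0" if "y \<in> span F" for y
    using sym[of y w] id[OF that] by (simp add: inner_diff_right)
  show thesis
  proof (rule that)
    show "w - ?p w \<in> span (insert w F)"
      by (rule span_diff[OF span_base[OF insertI1] subsetD[OF span_mono[OF subset_insertI] pC]])
    show "w - ?p w \<noteq> 0" using w pC[of w] by auto
    show "b \<bullet> (w - ?p w) = 0" if "b \<in> F" for b using orth[OF span_base[OF that]] .
    show "w \<bullet> (w - ?p w) = (w - ?p w) \<bullet> (w - ?p w)" using orth[OF pC[of w]]
        by (simp add: inner_diff_left)
  qed
qed

text \<open>Among \<open>N\<close> independent sample vectors the event yields combinations
  \<open>z k\<close> with unit coefficient at a fixed vector, nearly orthogonal to the rest of the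
  sample and, by recurrence, to these vectors as well. So \<open>z k\<close> tends weakly to 0 on
  their span, against the unit coefficient. Hence the sample spans a finite-dimensional space, which
  is closed and carries \<open>m\<close>.\<close>

lemma carried_by_span_if_finite_rank_event:
  fixes v :: "nat \<Rightarrow> 'h::{real_inner, banach, second_countable_topology}"
  assumes good: "good_sample m v" and ev: "gram_matrix v \<in> finite_rank_event"
  obtains C where "finite C" "pairwise orthogonal C" "AE x in m. x \<in> span C"
proof -
  obtain N where N: "\<And>I. distinct I \<Longrightarrow> length I = N \<Longrightarrow>
     (\<exists>p<N. \<forall>k. \<exists>r::rat list. r ! p = 1 \<and>
        (\<forall>j. j \<notin> set I \<longrightarrow> \<bar>\<Sum>i<N. of_rat (r ! i) * gram_matrix v (I ! i, j)\<bar> \<le> 1 / real (Suc k)))"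
    using ev unfolding finite_rank_event_def by blast
  have "card B \<le> N" if B: "B \<subseteq> range v" "finite B" "independent B" for B
  proof (rule ccontr)
    assume "\<not> card B \<le> N"
    then obtain F where F: "F \<subseteq> B" "card F = N" "finite F"
        by (meson nat_le_linear obtain_subset_with_card_n)
    have indF: "independent F" using B(3) F(1) independent_mono by blast
    obtain ws where ws: "set ws = F" "distinct ws" using finite_distinct_list[OF F(3)] by blast
    obtain g where g: "\<And>x. x \<in> F \<Longrightarrow> v (g x) = x" using F(1) B(1) by (metis f_inv_into_f subsetD)
    define I where "I = map g ws"
    have lw: "length ws = N" using ws F(2) distinct_card by metis
    have vI: "v (I ! i) = ws ! i" if "i < N" for i
    proof -
      have "ws ! i \<in> F" using ws(1) lw that nth_mem by metis
      then show ?thesis using lw that g by (simp add: I_def)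
    qed
    have I: "distinct I" "length I = N"
    proof -
      have "inj_on g F" using g by (metis inj_onI)
      then show "distinct I" using ws by (simp add: I_def distinct_map)
    qed (simp add: I_def lw)
    from N[OF I] obtain p where p: "p < N" and "\<forall>k. \<exists>r::rat list. r ! p = 1 \<and>
        (\<forall>j. j \<notin> set I \<longrightarrow> \<bar>\<Sum>i<N. of_rat (r ! i) * gram_matrix v (I ! i, j)\<bar> \<le> 1 / real (Suc k))"
            by blast
    from choice[OF this(2)] obtain r :: "nat \<Rightarrow> rat list" where r: "\<And>k. r k ! p = 1"
      "\<And>k j. j \<notin> set I \<Longrightarrow> \<bar>\<Sum>i<N. of_rat (r k ! i) * gram_matrix v (I ! i, j)\<bar> \<le> 1 / real (Suc k)"
          by blast
    let ?w = "ws ! p"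
    define z where "z k = (\<Sum>i<N. of_rat (r k ! i) *\<^sub>R ws ! i)" for k
    have zj: "\<bar>z k \<bullet> v j\<bar> \<le> 1 / real (Suc k)" if j: "j \<notin> set I" for k j
    proof -
      have "z k \<bullet> v j = (\<Sum>i<N. of_rat (r k ! i) * gram_matrix v (I ! i, j))"
        unfolding z_def inner_sum_left
      proof (intro sum.cong refl)
        fix i assume "i \<in> {..<N}"
        then have i: "i < N" "I ! i \<noteq> j" using j I(2) nth_mem by fastforce+
        then show "(of_rat (r k ! i) *\<^sub>R ws ! i) \<bullet> v j = of_rat (r k ! i) * gram_matrix v (I ! i, j)"
          by (simp add: gram_matrix_def vI)
      qed
      then show ?thesis using r(2)[OF j, of k] by simp
    qed
    \<comment> \<open>The event is silent about indices in \<open>I\<close>. A violation at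
      \<open>x\<close> is an open condition met by a sample point, hence also at some later index
      outside \<open>I\<close>.\<close>
    have zx: "\<bar>z k \<bullet> x\<bar> \<le> 1 / real (Suc k)" if x: "x \<in> F" for k x
    proof (rule ccontr)
      assume "\<not> \<bar>z k \<bullet> x\<bar> \<le> 1 / real (Suc k)"
      then have "v (g x) \<in> {y. 1 / real (Suc k) < \<bar>z k \<bullet> y\<bar>}" using g[OF x] by simp
      moreover have "open {y. 1 / real (Suc k) < \<bar>z k \<bullet> y\<bar>}"
          by (intro open_Collect_less continuous_intros)
      ultimately obtain j where j: "j \<ge> Suc (Max (insert 0 (set I)))" "v j \<in> {y. 1 / real (Suc k)
          < \<bar>z k \<bullet> y\<bar>}"
        using good unfolding good_sample_def by meson
      have "j \<notin> set I"
      proof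
        assume "j \<in> set I"
        then have "j \<le> Max (insert 0 (set I))" by (intro Max_ge) auto
        then show False using j(1) by simp
      qed
      from zj[OF this, of k] j(2) show False by simp
    qed
    have wF: "?w \<in> F" using p lw ws(1) nth_mem by metis
    have "?w \<notin> span (F - {?w})" using indF wF by (auto simp: dependent_def)
    then obtain u where u: "u \<in> span (insert ?w (F - {?w}))" "u \<noteq> 0" "\<And>b. b \<in> F - {?w} \<Longrightarrow> b \<bullet> u
        = 0" "?w \<bullet> u = u \<bullet> u"
      using orthogonal_component[of "F - {?w}" ?w] F(3) by blast
    \<comment> \<open>Only the coefficient of \<open>?w\<close> survives, and it is 1. The position
      \<open>p\<close> is chosen before \<open>k\<close>, so one \<open>u\<close> serves the whole
      sequence.\<close>
    have zu: "z k \<bullet> u = u \<bullet> u" for k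
    proof -
      have "z k \<bullet> u = (\<Sum>i<N. of_rat (r k ! i) * (ws ! i \<bullet> u))" by (simp add: z_def inner_sum_left)
      also have "\<dots> = (\<Sum>i\<in>{p}. of_rat (r k ! i) * (ws ! i \<bullet> u))"
      proof (rule sum.mono_neutral_right)
        show "\<forall>i\<in>{..<N} - {p}. of_rat (r k ! i) * (ws ! i \<bullet> u) = 0"
        proof
          fix i assume i: "i \<in> {..<N} - {p}"
          then have "ws ! i \<in> F - {?w}" using p lw ws nth_eq_iff_index_eq[OF ws(2)] nth_mem
              by fastforce
          then show "of_rat (r k ! i) * (ws ! i \<bullet> u) = 0" using u(3) by simp
        qed
      qed (use p in auto)
      finally show ?thesis using r(1) u(4) by simp
    qed
    have lim: "(\<lambda>k. z k \<bullet> y) \<longlonglongrightarrow> 0" if "y \<in> span F" for y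
      using that
    proof (induction rule: span_induct_alt)
      case (step c x y)
      have "(\<lambda>k. z k \<bullet> x) \<longlonglongrightarrow> 0"
        by (rule Lim_null_comparison[OF _ LIMSEQ_Suc[OF lim_1_over_n]]) (use zx[OF step.hyps] in
            \<open>auto intro: always_eventually\<close>)
      then have "(\<lambda>k. c * (z k \<bullet> x) + z k \<bullet> y) \<longlonglongrightarrow> c * 0 + 0"
        using step.IH by (intro tendsto_intros)
      then show ?case by (simp add: inner_add_right)
    qed simp
    have "u \<in> span F" using u(1) wF by (simp add: insert_absorb)
    from lim[OF this] have "(\<lambda>k::nat. u \<bullet> u) \<longlonglongrightarrow> 0" unfolding zu .
    then have "u \<bullet> u = 0" using LIMSEQ_unique[OF tendsto_const] by blast
    then show False using u(2) by simp
  qed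
  then obtain B where B: "B \<subseteq> range v" "finite B" "range v \<subseteq> span B"
    using edim_le_imp_finite_span[of "range v" N] by blast
  obtain C where C: "finite C" "span C = span B" "pairwise orthogonal C"
    using basis_orthogonal[OF B(2)] by blast
  have "AE x in m. x \<in> span C"
    using good B(3) closed_span_orthogonal[OF C(1,3)] unfolding good_sample_def C(2)[symmetric]
        by blast
  then show thesis using that C by blast
qed

section \<open>Invariant laws\<close>

text \<open>An explicit carrying span: orthogonality makes projections computable, and the
  almost-everywhere form is stable under passing to an equivalent measure.\<close>

definition finite_dimensional :: "'h::real_inner measure \<Rightarrow> bool" where
  "finite_dimensional m \<longleftrightarrow> (\<exists>C. finite C \<and> pairwise orthogonal C \<and> (AE v in m. v \<in> span C))"

lemma AE_gram_matrix_in_finite_rank_event: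
  fixes m :: "'h::{real_inner, banach, second_countable_topology} measure"
  assumes m: "m \<in> space (prob_algebra unit_ball)" and f: "finite_dimensional m"
  shows "AE v in iid m. gram_matrix v \<in> finite_rank_event"
proof -
  interpret sequence_space m by (rule sequence_space_prob_space[OF sets_unit_ball_space(2)[OF m]])
  obtain C where C: "finite C" "AE v in m. v \<in> span C" using f
      by (auto simp: finite_dimensional_def)
  have "AE v in iid m. \<forall>i. v i \<in> span C"
    unfolding AE_all_countable by (intro allI AE_component[of _ "\<lambda>x. x \<in> span C"] C) simp
  then show ?thesis using AE_space
  proof eventually_elim
    case (elim v)
    show ?case using elim(1) norm_le_1_iid[OF m elim(2)]
        by (intro gram_matrix_in_finite_rank_event[OF C(1)]) auto
  qed
qed

text \<open>With the preceding lemma this is a zero-one law: given \<open>m\<close>, the event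
  almost surely agrees with \<open>finite_dimensional m\<close>.\<close>

lemma AE_gram_matrix_notin_finite_rank_event:
  fixes m :: "'h::{real_inner, banach, second_countable_topology} measure"
  assumes m: "m \<in> space (prob_algebra unit_ball)" and f: "\<not> finite_dimensional m"
  shows "AE v in iid m. gram_matrix v \<notin> finite_rank_event"
  using AE_good_sample[OF m]
proof eventually_elim
  case (elim v)
  then show ?case
    using f carried_by_span_if_finite_rank_event[OF elim] unfolding finite_dimensional_def by metis
qed

text \<open>Differences of samples turn out orthogonal to every sample, including those they are
  formed from, so all samples coincide; the closed set consisting of their common value carries
  \<open>m\<close>.\<close>

lemma eq_return_if_overlaps_constant:
  fixes m :: "'h::{real_inner, banach, second_countable_topology} measure"
  assumes m: "m \<in> space (prob_algebra unit_ball)"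
    and eq: "AE v in iid m. \<forall>i j k. distinct [i, j, k] \<longrightarrow> v i \<bullet> v j = v i \<bullet> v k"
  shows "\<exists>a\<in>cball 0 1. m = return unit_ball a"
proof -
  interpret m: prob_space m by (rule sets_unit_ball_space(2)[OF m])
  interpret sequence_space m by (rule sequence_space_prob_space[OF sets_unit_ball_space(2)[OF m]])
  have "AE v in iid m. (\<forall>i j k. distinct [i, j, k] \<longrightarrow> v i \<bullet> v j = v i \<bullet> v k) \<and> good_sample m v \<and> v
      \<in> space (iid m)"
    using eq AE_good_sample[OF m] AE_space by eventually_elim blast
  then obtain v where v: "\<And>i j k. distinct [i, j, k] \<Longrightarrow> v i \<bullet> v j = v i \<bullet> v k" "good_sample m v" "v
      \<in> space (iid m)"
    using P.AE_False eventually_mono by (smt (verit, best))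
  \<comment> \<open>The assumption does not cover \<open>a = j\<close> or \<open>a = k\<close>;
    recurrence of the sample near \<open>v a\<close> supplies an index beyond both.\<close>
  have z: "v a \<bullet> (v j - v k) = 0" if jk: "j \<noteq> k" for a j k
  proof (rule ccontr)
    assume "v a \<bullet> (v j - v k) \<noteq> 0"
    then have "v a \<in> {y. y \<bullet> (v j - v k) \<noteq> 0}" by simp
    moreover have "open {y. y \<bullet> (v j - v k) \<noteq> 0}" by (intro open_Collect_neq continuous_intros)
    ultimately obtain i where i: "i \<ge> Suc (max j k)" "v i \<in> {y. y \<bullet> (v j - v k) \<noteq> 0}"
      using v(2) unfolding good_sample_def by meson
    have "v i \<bullet> v j = v i \<bullet> v k" using i(1) jk by (intro v(1)) auto
    then show False using i(2) by (simp add: inner_diff_right)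
  qed
  have "v j = v 0" for j
  proof (cases "j = 0")
    case False
    have "(v j - v 0) \<bullet> (v j - v 0) = 0" using z[OF False, of j] z[OF False, of 0]
        by (simp add: inner_diff_left)
    then show ?thesis by simp
  qed simp
  then have "range v \<subseteq> {v 0}" by auto
  then have ae: "AE x in m. x \<in> {v 0}" using v(2) unfolding good_sample_def by blast
  have v0: "v 0 \<in> cball 0 1" using norm_le_1_iid[OF m v(3), of 0] by simp
  have "m = return unit_ball (v 0)"
  proof (rule measure_eqI)
    show "sets m = sets (return unit_ball (v 0))" using sets_unit_ball_space(1)[OF m] by simp
    fix A assume A: "A \<in> sets m"
    then have A': "A \<in> sets unit_ball" using sets_unit_ball_space(1)[OF m] by simp
    show "emeasure m A = emeasure (return unit_ball (v 0)) A"
    proof (cases "v 0 \<in> A")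
      case True
      have "AE x in m. x \<in> A" using ae by eventually_elim (use True in auto)
      then show ?thesis using A A' True by (simp add: m.emeasure_eq_1_AE)
    next
      case False
      have "AE x in m. x \<notin> A" using ae by eventually_elim (use False in auto)
      then have "emeasure m A = 0" using A by (subst (asm) AE_iff_measurable[OF A]) (auto dest:
          sets.sets_into_space)
      then show ?thesis using A' False by simp
    qed
  qed
  then show ?thesis using v0 by blast
qed

context
  fixes e :: "nat \<Rightarrow> 'h::{real_inner, banach, second_countable_topology}"
  assumes onb: "orthonormal_basis e"
begin

text \<open>A finite normalisation makes the density strictly positive, so every null set of the
  image is null for \<open>m\<close>: the mapping cannot lower an infinite dimension to a finite
  one.\<close>

lemma finite_dimensional_cavityD:
  assumes m: "m \<in> space (prob_algebra unit_ball)" and f: "finite_dimensional (cavity e c l m)"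
  shows "finite_dimensional m"
proof (cases "(\<integral>\<^sup>+w. ennreal (cavity_weight e c l w) \<partial>m) = \<infinity>")
  case True
  then have "cavity e c l m = m" unfolding cavity_def Let_def by auto
  then show ?thesis using f by simp
next
  case False
  let ?Z = "\<integral>\<^sup>+w. ennreal (cavity_weight e c l w) \<partial>m"
  obtain C where C: "finite C" "pairwise orthogonal C" "AE v in cavity e c l m. v \<in> span C"
    using f unfolding finite_dimensional_def by blast
  have eq: "cavity e c l m = density m (\<lambda>v. ennreal (cavity_weight e c l v) / ?Z)"
    using False unfolding cavity_def Let_def by auto
  have wm: "(\<lambda>v. ennreal (cavity_weight e c l v) / ?Z) \<in> borel_measurable m"
    using measurable_cavity_weight_fixed[OF onb m] by measurable
  have pos: "0 < ennreal (cavity_weight e c l v) / ?Z" for v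
    using False by (simp add: ennreal_zero_less_divide cavity_weight_def less_top)
  have "AE v in m. v \<in> span C"
    using C(3) unfolding eq AE_density[OF wm] by (rule eventually_mono) (use pos in blast)
  then show ?thesis using C(1,2) unfolding finite_dimensional_def by blast
qed

text \<open>The restriction to finite dimension is read from the matrix itself, so the mean of the
  defect is a functional of the overlap law, to which invariance applies.\<close>

definition overlap_defect :: "nat \<Rightarrow> nat \<Rightarrow> nat \<Rightarrow> (nat \<times> nat \<Rightarrow> real) \<Rightarrow> ennreal" where
  "overlap_defect i j k q = indicator finite_rank_event q * ennreal ((q (i, j) - q (i, k))\<^sup>2)"

lemma measurable_overlap_defect: "overlap_defect i j k \<in> borel_measurable matrix_space"
proof -
  have [measurable]: "(\<lambda>q. q p) \<in> borel_measurable matrix_space" for p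
    unfolding matrix_space_def by measurable
  note finite_rank_event_sets[measurable]
  show ?thesis unfolding overlap_defect_def by measurable
qed

text \<open>Cauchy-Schwarz with \<open>norm (v i) \<le> 1\<close> bounds the difference of overlaps
  by the distance of \<open>v j\<close> and \<open>v k\<close>. Points of the unit ball have squared
  distance at most 4.\<close>

lemma nn_integral_overlap_defect:
  assumes m: "m \<in> space (prob_algebra (unit_ball :: 'h measure))" and d: "distinct [i, j, k]"
  shows "(\<integral>\<^sup>+q. overlap_defect i j k q \<partial>gram_law m) = (\<integral>\<^sup>+v. overlap_defect i j k (gram_matrix v)
      \<partial>iid m)"
    and "(\<integral>\<^sup>+q. overlap_defect i j k q \<partial>gram_law m) \<le> (\<integral>\<^sup>+v. ennreal ((norm (v j - v k))\<^sup>2) \<partial>iid m)"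
    and "(\<integral>\<^sup>+q. overlap_defect i j k q \<partial>gram_law m) \<le> 4"
    and "\<not> finite_dimensional m \<Longrightarrow> (\<integral>\<^sup>+q. overlap_defect i j k q \<partial>gram_law m) = 0"
proof -
  let ?D = "\<integral>\<^sup>+q. overlap_defect i j k q \<partial>gram_law m"
  let ?n = "\<lambda>v. ennreal ((norm (v j - v k))\<^sup>2)"
  interpret I: prob_space "iid m" by (intro prob_space_PiM sets_unit_ball_space(2)[OF m])
  show 1: "?D = (\<integral>\<^sup>+v. overlap_defect i j k (gram_matrix v) \<partial>iid m)"
    unfolding gram_law_def
    by (rule nn_integral_distr[OF measurable_gram_matrix[OF sets_unit_ball_space(1)[OF m]] ]) (simp
        add: measurable_overlap_defect)
  have b: "overlap_defect i j k (gram_matrix v) \<le> ?n v" "?n v \<le> 4"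
    if v: "v \<in> space (iid m)" for v
  proof -
    have nv: "norm (v n) \<le> 1" for n by (rule norm_le_1_iid[OF m v])
    have "\<bar>v i \<bullet> (v j - v k)\<bar> \<le> norm (v i) * norm (v j - v k)" by (rule Cauchy_Schwarz_ineq2)
    also have "\<dots> \<le> 1 * norm (v j - v k)" using nv by (intro mult_right_mono) auto
    finally have "\<bar>v i \<bullet> v j - v i \<bullet> v k\<bar> \<le> norm (v j - v k)" by (simp add: inner_diff_right)
    then have "(v i \<bullet> v j - v i \<bullet> v k)\<^sup>2 \<le> (norm (v j - v k))\<^sup>2"
        by (rule power2_le_iff_abs_le[THEN iffD2, rotated]) simp
    then show "overlap_defect i j k (gram_matrix v) \<le> ?n v"
      using d by (auto simp: overlap_defect_def gram_matrix_def indicator_def intro!: ennreal_leI)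
    have "norm (v j - v k) \<le> 2" using norm_triangle_ineq4[of "v j" "v k"] nv[of j] nv[of k]
        by linarith
    then have "(norm (v j - v k))\<^sup>2 \<le> 2\<^sup>2" by (intro power_mono) auto
    then have "?n v \<le> ennreal 4" by (intro ennreal_leI) simp
    then show "?n v \<le> 4" by simp
  qed
  show 2: "?D \<le> (\<integral>\<^sup>+v. ?n v \<partial>iid m)"
    unfolding 1 by (intro nn_integral_mono b)
  also have "\<dots> \<le> (\<integral>\<^sup>+v. 4 \<partial>iid m)" by (intro nn_integral_mono b)
  finally show "?D \<le> 4" by (simp add: I.emeasure_space_1)
  assume "\<not> finite_dimensional m"
  then have "AE v in iid m. gram_matrix v \<notin> finite_rank_event"
      by (rule AE_gram_matrix_notin_finite_rank_event[OF m])
  then have "(\<integral>\<^sup>+v. overlap_defect i j k (gram_matrix v) \<partial>iid m) = (\<integral>\<^sup>+v. 0 \<partial>iid m)"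
    by (intro nn_integral_cong_AE) (auto simp: overlap_defect_def elim!: eventually_mono)
  then show "?D = 0" unfolding 1 by simp
qed

text \<open>In finite dimension the distance bound decays like \<open>1 / sqrt n\<close>. Otherwise
  the image is infinite-dimensional too, and its defect is 0 for every \<open>n\<close>.\<close>

lemma nn_integral_overlap_defect_cavity_tendsto:
  assumes m: "m \<in> space (prob_algebra unit_ball)" and c: "c > 0" and d: "distinct [i, j, k]"
  shows "(\<lambda>n. \<integral>\<^sup>+l. \<integral>\<^sup>+q. overlap_defect i j k q \<partial>gram_law (cavity e (sqrt (Suc n) * c) l m)
      \<partial>gauss_law) \<longlonglongrightarrow> 0"
proof (cases "finite_dimensional m")
  let ?D = "\<lambda>n. \<integral>\<^sup>+l. \<integral>\<^sup>+q. overlap_defect i j k q \<partial>gram_law (cavity e (sqrt (Suc n) * c) l m)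
      \<partial>gauss_law"
  case True
  then obtain C where C: "finite C" "pairwise orthogonal C" "AE v in m. v \<in> span C"
    unfolding finite_dimensional_def by blast
  have le: "?D n
      \<le> ennreal (8 * card C / (sqrt (Suc n) * c))" for n
  proof -
    have "?D n
      \<le> (\<integral>\<^sup>+l. \<integral>\<^sup>+v. ennreal ((norm (v j - v k))\<^sup>2) \<partial>iid (cavity e (sqrt (Suc n) * c) l m) \<partial>gauss_law)"
      by (intro nn_integral_mono nn_integral_overlap_defect(2)[OF cavity_in_prob_algebra[OF m] d])
    also have "\<dots> \<le> ennreal (8 * card C / (sqrt (Suc n) * c))"
      using c d by (intro nn_integral_cavity_dist_le[OF onb m _ C]) auto
    finally show ?thesis .
  qed
  have "(\<lambda>n. 8 * card C / (sqrt (Suc n) * c)) \<longlonglongrightarrow> 0"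
    using c by real_asymp
  then have "(\<lambda>n. ennreal (8 * card C / (sqrt (Suc n) * c))) \<longlonglongrightarrow> ennreal 0" by (rule tendsto_ennrealI)
  then have "(\<lambda>n. ennreal (8 * card C / (sqrt (Suc n) * c))) \<longlonglongrightarrow> 0" by simp
  then show ?thesis
    by (rule tendsto_sandwich[OF _ _ tendsto_const, rotated 2]) (use le in auto)
next
  case False
  have "(\<integral>\<^sup>+q. overlap_defect i j k q \<partial>gram_law (cavity e c' l m)) = 0" for c' l
    using False finite_dimensional_cavityD[OF m]
        by (intro nn_integral_overlap_defect(4)[OF cavity_in_prob_algebra[OF m] d]) auto
  then show ?thesis by simp
qed

text \<open>Invariance under all parameters \<open>sqrt (Suc n) * c\<close> makes the mean defect
  after the mapping independent of \<open>n\<close>, while it tends to 0. So the mean defect of the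
  law itself is 0, and on finite-dimensional \<open>m\<close> this says that overlaps with a common
  sample agree.\<close>

lemma AE_dirac_if_finite_dimensional:
  assumes L: "L \<in> space (prob_algebra (prob_algebra unit_ball))" and c: "c > 0"
    and inv: "ROSt_of (cavity_law e c L) = ROSt_of L"
  shows "AE m in L. finite_dimensional m \<longrightarrow> (\<exists>a\<in>cball 0 1. m = return unit_ball a)"
proof -
  let ?D = "\<lambda>i j k m. \<integral>\<^sup>+q. overlap_defect i j k q \<partial>gram_law m"
  interpret L: prob_space L by (rule sampling_lawD(3)[OF L])
  interpret G: prob_space gauss_law by (rule prob_space_gauss_law)
  have Lm: "m \<in> space (prob_algebra unit_ball)" if "m \<in> space L" for m
      using that sampling_lawD(2)[OF L] by simp
  have gm: "(\<lambda>m. ?D i j k m) \<in> borel_measurable (prob_algebra (unit_ball :: 'h measure))" for i j k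
    by (rule measurable_compose[OF measurable_prob_algebraD[OF measurable_gram_law]
        nn_integral_measurable_subprob_algebra[OF measurable_overlap_defect]])
  have "AE m in L. finite_dimensional m \<longrightarrow> (AE v in iid m. v i \<bullet> v j = v i \<bullet> v k)"
      if d: "distinct [i, j, k]" for i j k
  proof -
    let ?F = "\<lambda>n m. \<integral>\<^sup>+l. ?D i j k (cavity e (sqrt (Suc n) * c) l m) \<partial>gauss_law"
    have s: "sets (L \<Otimes>\<^sub>M gauss_law) = sets (prob_algebra unit_ball \<Otimes>\<^sub>M gauss_law)"
      by (intro sets_pair_measure_cong sampling_lawD(1)[OF L] refl)
    have Fm: "?F n \<in> borel_measurable L" for n
    proof -
      have "(\<lambda>p. ?D i j k (cavity e (sqrt (Suc n) * c) (snd p) (fst p)))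
          \<in> borel_measurable (L \<Otimes>\<^sub>M gauss_law)"
        using measurable_compose[OF measurable_cavity_fst_snd gm] s
            by (simp cong: measurable_cong_sets)
      from G.borel_measurable_nn_integral_fst[OF this] show ?thesis by simp
    qed
    \<comment> \<open>The rate for a single \<open>m\<close> depends on its dimension, which is not
      bounded over \<open>L\<close>; dominated convergence with the constant 4 copes with
      this.\<close>
    have "(\<lambda>n. \<integral>\<^sup>+m. ?F n m \<partial>L) \<longlonglongrightarrow> (\<integral>\<^sup>+m. 0 \<partial>L)"
    proof (rule nn_integral_dominated_convergence[where w = "\<lambda>_. 4"])
      show "AE m in L. ?F n m \<le> 4" for n
      proof (rule AE_I2)
        fix m assume m: "m \<in> space L"
        have "?F n m \<le> (\<integral>\<^sup>+l. 4 \<partial>gauss_law)"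
          by (intro nn_integral_mono nn_integral_overlap_defect(3)[OF cavity_in_prob_algebra[OF
              Lm[OF m]] d])
        then show "?F n m \<le> 4" using G.emeasure_space_1 by simp
      qed
      show "AE m in L. (\<lambda>n. ?F n m) \<longlonglongrightarrow> 0"
        by (intro AE_I2 nn_integral_overlap_defect_cavity_tendsto[OF Lm c d])
    qed (use Fm in \<open>auto simp: L.emeasure_space_1\<close>)
    moreover have "(\<integral>\<^sup>+m. ?F n m \<partial>L) = (\<integral>\<^sup>+q. overlap_defect i j k q \<partial>ROSt_of L)" for n
    proof -
      have "(\<integral>\<^sup>+m. ?F n m \<partial>L) = (\<integral>\<^sup>+m. ?D i j k m \<partial>cavity_law e (sqrt (Suc n) * c) L)"
        by (rule cavity_law_in_prob_algebra(2)[OF L gm, symmetric])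
      also have "\<dots> = (\<integral>\<^sup>+q. overlap_defect i j k q \<partial>ROSt_of (cavity_law e (sqrt (Suc n) * c) L))"
        by (rule nn_integral_ROSt_of[OF cavity_law_in_prob_algebra(1)[OF L]
            measurable_overlap_defect, symmetric])
      finally show ?thesis by (simp only: ROSt_of_cavity_law_sqrt[OF onb L c inv])
    qed
    ultimately have "(\<integral>\<^sup>+q. overlap_defect i j k q \<partial>ROSt_of L) = 0"
      using LIMSEQ_unique[OF tendsto_const] by simp
    then have "(\<integral>\<^sup>+m. ?D i j k m \<partial>L) = 0"
      by (simp only: nn_integral_ROSt_of[OF L measurable_overlap_defect])
    moreover have "(\<lambda>m. ?D i j k m) \<in> borel_measurable L"
      using gm sampling_lawD(1)[OF L] by (simp cong: measurable_cong_sets)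
    ultimately have "AE m in L. ?D i j k m = 0"
      by (subst (asm) nn_integral_0_iff_AE) auto
    then show ?thesis using AE_space
    proof eventually_elim
      case (elim m)
      note m = Lm[OF elim(2)]
      show ?case
      proof
        assume f: "finite_dimensional m"
        have "(\<integral>\<^sup>+v. overlap_defect i j k (gram_matrix v) \<partial>iid m) = 0"
          using elim(1) nn_integral_overlap_defect(1)[OF m d] by simp
        moreover have "(\<lambda>v. overlap_defect i j k (gram_matrix v)) \<in> borel_measurable (iid m)"
          by (rule measurable_compose[OF measurable_gram_matrix[OF sets_unit_ball_space(1)[OF m]]
              measurable_overlap_defect])
        ultimately have "AE v in iid m. overlap_defect i j k (gram_matrix v) = 0"
          by (subst (asm) nn_integral_0_iff_AE) auto
        then show "AE v in iid m. v i \<bullet> v j = v i \<bullet> v k"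
          using AE_gram_matrix_in_finite_rank_event[OF m f]
          by eventually_elim (use d in \<open>auto simp: overlap_defect_def gram_matrix_def\<close>)
      qed
    qed
  qed
  \<comment> \<open>There are countably many triples of indices, so one exceptional set serves them
    all.\<close>
  then have "AE m in L. \<forall>i j k. distinct [i, j, k] \<longrightarrow> finite_dimensional m
      \<longrightarrow> (AE v in iid m. v i \<bullet> v j = v i \<bullet> v k)"
    unfolding AE_all_countable by (intro allI AE_impI)
  then show ?thesis using AE_space
  proof eventually_elim
    case (elim m)
    show ?case
    proof
      assume "finite_dimensional m"
      then have "AE v in iid m. \<forall>i j k. distinct [i, j, k] \<longrightarrow> v i \<bullet> v j = v i \<bullet> v k"
        unfolding AE_all_countable using elim(1) by (intro allI AE_impI) blast
      then show "\<exists>a\<in>cball 0 1. m = return unit_ball a"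
        by (rule eq_return_if_overlaps_constant[OF Lm[OF elim(2)]])
    qed
  qed
qed

end

theorem theorem1p7:
  fixes e :: "nat \<Rightarrow> 'h::{real_inner, banach, second_countable_topology}"
    and c :: real
    and M :: "'w measure"
    and Q :: "'w \<Rightarrow> nat \<times> nat \<Rightarrow> real"
    and \<mu> :: "'w \<Rightarrow> 'h measure"
  assumes "orthonormal_basis e"
    and "c > 0"
    and "prob_space M"
    and "Q \<in> M \<rightarrow>\<^sub>M matrix_space"
    and "ROSt_law (distr M matrix_space Q)"
    and "cavity_invariant e c (distr M matrix_space Q)"
    and "sampling_measure M Q \<mu>"
  shows "AE \<omega> in M. (\<exists>v\<in>cball 0 1. \<mu> \<omega> = return unit_ball v) \<or> mdim (\<mu> \<omega>) = \<infinity>"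
proof -
  interpret prob_space M by fact
  let ?P = "distr M matrix_space Q"
  let ?L = "distr M (prob_algebra unit_ball) \<mu>"
  have \<mu>: "\<mu> \<in> M \<rightarrow>\<^sub>M prob_algebra unit_ball" using assms(7) by (simp add: sampling_measure_def)
  have L: "?L \<in> space (prob_algebra (prob_algebra unit_ball))"
    using prob_space_distr[OF \<mu>] by (simp add: space_prob_algebra)
  have "ROSt_of ?L = ?P"
  proof (rule measure_eqI)
    show "sets (ROSt_of ?L) = sets ?P" using ROSt_of_in_prob_algebra(2)[OF L] by simp
    fix C assume "C \<in> sets (ROSt_of ?L)"
    then have C: "C \<in> sets matrix_space" using ROSt_of_in_prob_algebra(2)[OF L] by simp
    \<comment> \<open>Taking the whole space as the event for \<mu> in
      \<open>sampling_measure\<close> leaves the unconditional law of \<open>Q\<close>.\<close>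
    have "emeasure ?P C = emeasure M {\<omega>\<in>space M. \<mu> \<omega> \<in> space (prob_algebra unit_ball) \<and> Q \<omega> \<in> C}"
      using C measurable_space[OF \<mu>] by (subst emeasure_distr[OF assms(4)]) (auto intro!:
          arg_cong[where f = "emeasure M"])
    also have "\<dots> = (\<integral>\<^sup>+\<omega>. indicator (space (prob_algebra unit_ball)) (\<mu> \<omega>) * emeasure (gram_law (\<mu>
        \<omega>)) C \<partial>M)"
      using assms(7) C unfolding sampling_measure_def by blast
    also have "\<dots> = (\<integral>\<^sup>+\<omega>. emeasure (gram_law (\<mu> \<omega>)) C \<partial>M)"
      using measurable_space[OF \<mu>] by (intro nn_integral_cong) simp
    also have "\<dots> = (\<integral>\<^sup>+m. emeasure (gram_law m) C \<partial>?L)"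
      by (rule nn_integral_distr[OF \<mu>, symmetric]) (simp add: measurable_emeasure_prob_algebra[OF
          measurable_gram_law C])
    also have "\<dots> = emeasure (ROSt_of ?L) C"
      unfolding ROSt_of_def using sampling_lawD(3)[OF L]
      by (intro emeasure_bind[OF _ gram_law_kernel[OF L] C, symmetric] prob_space.not_empty)
    finally show "emeasure (ROSt_of ?L) C = emeasure ?P C" by simp
  qed
  then have sL: "sampling_law ?P ?L" using L by (simp add: sampling_law_def)
  \<comment> \<open>The hypothesis speaks of this arbitrarily chosen sampling law; the congruence
    carries invariance over to the law of \<mu>.\<close>
  define L0 where "L0 = (SOME L :: 'h measure measure. sampling_law ?P L)"
  have "sampling_law ?P L0" unfolding L0_def using sL by (rule someI)
  then have L0: "L0 \<in> space (prob_algebra (prob_algebra unit_ball))" "ROSt_of L0 = ?P"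
    by (auto simp: sampling_law_def)
  have "ROSt_of (cavity_law e c L0) = ?P"
    using assms(6) by (simp add: cavity_invariant_def cavity_map_def L0_def)
  then have "ROSt_of (cavity_law e c ?L) = ROSt_of ?L"
    using ROSt_of_cavity_law_cong[OF assms(1) L L0(1), of c] L0(2) \<open>ROSt_of ?L = ?P\<close> by simp
  then have "AE m in ?L. finite_dimensional m \<longrightarrow> (\<exists>a\<in>cball 0 1. m = return unit_ball a)"
    by (rule AE_dirac_if_finite_dimensional[OF assms(1) L assms(2)])
  from AE_distrD[OF \<mu> this] show ?thesis using AE_space
  proof eventually_elim
    case (elim \<omega>)
    have "finite_dimensional (\<mu> \<omega>)" if "mdim (\<mu> \<omega>) \<noteq> \<infinity>"
      using mdim_finite_imp_carried_by_span[OF assms(1) measurable_space[OF \<mu> elim(2)] that]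
      unfolding finite_dimensional_def by metis
    then show ?case using elim(1) by blast
  qed
qed

end
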